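(* Let $E$ be an $n|n$-dimensional odd symplectic supermanifold with odd symplectic form $\omega$, equipped with a volume element $\boldsymbol\rho$, and let $C\subset E$ be a non-degenerate submanifold of codimension $1|1$. Then the half-density $\mathbf s_C(\nabla)=A(\nabla,\Psi)\sqrt{\boldsymbol\rho_\Psi}$ on $C$ does not depend on the choice of a connection in the class of Darboux flat affine connections: $\mathbf s_C(\nabla)=\mathbf s_C(\nabla')$ for two arbitrary Darboux flat affine connections $\nabla$ and $\nabla'$ on $E$.
   Context: An odd symplectic supermanifold is an $n|n$-dimensional supermanifold with a non-degenerate odd Poisson bracket. Darboux coordinates are local coordinates $z^A=(x^a,\theta_a)$ ($x^a$ even, $\theta_a$ odd) with $\{x^a,x^b\}=0$, $\{x^a,\theta_b\}=\delta^a_b$, $\{\theta_a,\theta_b\}=0$. A submanifold $C$ of codimension $1|1$ is non-degenerate if the restriction of $\omega$ to $C$ is non-degenerate. Then at points of $C$ the tangent space of $E$ splits as $TC$ plus its $1|1$-dimensional symplectic orthogonal, and $\Pi$ denotes the projector (along $TC$) onto this symplecto-orthogonal $1|1$-plane, extended to a neighbourhood of $C$. An affine symmetric (torsion-free) connection $\nabla$ on $E$ with Christoffel symbols $\Gamma^C_{AB}$ is Darboux flat if (near every point) there exist Darboux coordinates in which $\Gamma^C_{AB}=0$, i.e. $\nabla_A\partial_B=0$. Let $\Psi=\Psi^A\partial_A$ be a vector field defined at the points of $C$ such that: $\Psi$ is symplecto-orthogonal to $C$; $\Psi$ is odd, $p(\Psi^A)+p(A)=1$; $\Psi$ is non-degenerate,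 i.e. at least one of its components is non-nilpotent; and $\omega(\Psi,\Psi)=0$. These conditions determine $\Psi$ up to multiplication by an invertible function. Put $$A(\nabla,\Psi)=\operatorname{Tr}\bigl(\Pi(\nabla\Psi)\bigr)-\operatorname{div}_{\boldsymbol\rho}\Psi ,$$ where $\nabla\Psi$ is the map $Y\mapsto\nabla_Y\Psi$ (for any extension of $\Psi$ to a neighbourhood of $C$). Since $\Psi$ is odd, in coordinates $\operatorname{Tr}(\Pi(\nabla\Psi))=\sum_{A,B}(\nabla_A\Psi)^B\,\Pi_B{}^A$ with $\Pi(\partial_B)=\Pi_B{}^A\partial_A$, and $\operatorname{div}_{\boldsymbol\rho}\Psi=\frac1\rho\sum_A\partial_A(\rho\Psi^A)$ for $\boldsymbol\rho=\rho(z)D(z)$. At points of $C$, $A(\nabla,\Psi)$ does not depend on the extension, and $A(\nabla,f\Psi)=fA(\nabla,\Psi)$. Let $\mathbf H$ be an even vector field at points of $C$, symplecto-orthogonal to $C$, with $\omega(\mathbf H,\Psi)=1$. The volume form $\boldsymbol\rho_\Psi$ on $C$ is defined by $$\boldsymbol\rho_\Psi(\mathbf e_1,\dots,\mathbf e_{n-1};\mathbf f_1,\dots,\mathbf f_{n-1})=\boldsymbol\rho(\mathbf e_1,\dots,\mathbf e_{n-1},\mathbf H;\mathbf f_1,\dots,\mathbf f_{n-1},\Psi)$$ for an arbitrary tangent frame of $C$ with even vectors $\mathbf e_i$ and odd vectors $\mathbf f_i$. It satisfies $\boldsymbol\rho_{f\Psi}=f^{-2}\boldsymbol\rho_\Psi$,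 so $\mathbf s_C(\nabla)=A(\nabla,\Psi)\sqrt{\boldsymbol\rho_\Psi}$ is a half-density on $C$ independent of the choice of $\Psi$. *)

theory Defs
  imports "HOL-Analysis.Analysis"
begin

section \<open>Supercommutative algebras\<close>

text \<open>The \<open>\<int>/2\<close>-grading is given by its parity automorphism, which is the identity on
  even and minus the identity on odd elements.\<close>

class supercommutative_algebra = real_algebra_1 +
  fixes grade_inv :: "'a \<Rightarrow> 'a"
  assumes grade_inv_add: "grade_inv (x + y) = grade_inv x + grade_inv y"
    and grade_inv_scaleR: "grade_inv (scaleR r x) = scaleR r (grade_inv x)"
    and grade_inv_mult: "grade_inv (x * y) = grade_inv x * grade_inv y"
    and grade_inv_grade_inv: "grade_inv (grade_inv x) = x"
    and even_commute: "grade_inv x = x \<Longrightarrow> x * y = y * x"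
    and odd_anticommute: "grade_inv x = - x \<Longrightarrow> grade_inv y = - y \<Longrightarrow> x * y = - (y * x)"

lemma grade_inv_0: "grade_inv (0 :: 'a::supercommutative_algebra) = 0"
  using grade_inv_scaleR[of 0 "0::'a"] by simp

lemma grade_inv_minus: "grade_inv (- x :: 'a::supercommutative_algebra) = - grade_inv x"
  using grade_inv_scaleR[of "-1" x] by simp

lemma grade_inv_1: "grade_inv (1 :: 'a::supercommutative_algebra) = 1"
  using grade_inv_mult[of 1 "grade_inv (1::'a)"] by (simp add: grade_inv_grade_inv)

definition unit_elem :: "'g::supercommutative_algebra \<Rightarrow> bool" where
  "unit_elem g \<longleftrightarrow> (\<exists>h. g * h = 1 \<and> h * g = 1)"

definition unit_inv :: "'g::supercommutative_algebra \<Rightarrow> 'g" where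
  "unit_inv g = (THE h. g * h = 1 \<and> h * g = 1)"

text \<open>For a germ of a superfunction this is its numerical value at the base point: the stalks are
  local rings with residue field \<open>\<real>\<close>.\<close>

definition body :: "'g::supercommutative_algebra \<Rightarrow> real" where
  "body g = (THE c. \<not> unit_elem (g - of_real c))"

typedef (overloaded) 'g even_part = "{x :: 'g::supercommutative_algebra. grade_inv x = x}"
  by (rule exI[of _ 0]) (simp add: grade_inv_0)

setup_lifting type_definition_even_part

instantiation even_part :: (supercommutative_algebra) comm_ring_1
begin

lift_definition zero_even_part :: "'a even_part" is 0 by (rule grade_inv_0)
lift_definition one_even_part :: "'a even_part" is 1 by (rule grade_inv_1)
lift_definition plus_even_part :: "'a even_part \<Rightarrow> 'a even_part \<Rightarrow> 'a even_part" is "(+)"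
  by (simp add: grade_inv_add)
lift_definition uminus_even_part :: "'a even_part \<Rightarrow> 'a even_part" is uminus
  by (simp add: grade_inv_minus)
lift_definition minus_even_part :: "'a even_part \<Rightarrow> 'a even_part \<Rightarrow> 'a even_part" is "(-)"
  by (metis diff_conv_add_uminus grade_inv_add grade_inv_minus)
lift_definition times_even_part :: "'a even_part \<Rightarrow> 'a even_part \<Rightarrow> 'a even_part" is "(*)"
  by (simp add: grade_inv_mult)

instance
  by standard (transfer; simp add: algebra_simps even_commute)+

end

definition even_det :: "('n::finite \<Rightarrow> 'n \<Rightarrow> 'g::supercommutative_algebra) \<Rightarrow> 'g" where
  "even_det M = Rep_even_part (det (\<chi> i j. Abs_even_part (M i j)))"

definition even_matrix_inv ::
    "('n::finite \<Rightarrow> 'n \<Rightarrow> 'g::supercommutative_algebra) \<Rightarrow> 'n \<Rightarrow> 'n \<Rightarrow> 'g" where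
  "even_matrix_inv M i j = Rep_even_part (matrix_inv (\<chi> k l. Abs_even_part (M k l)) $ i $ j)"

text \<open>Rows and columns of an \<open>n|n\<close> supermatrix are indexed by the type \<open>'n + 'n\<close>,
  \<open>Inl\<close> being even and \<open>Inr\<close> odd.\<close>

fun par :: "'n + 'n \<Rightarrow> nat" where
  "par (Inl a) = 0"
| "par (Inr a) = 1"

definition Ber :: "('n::finite + 'n \<Rightarrow> 'n + 'n \<Rightarrow> 'g::supercommutative_algebra) \<Rightarrow> 'g" where
  "Ber M =
    (let D = (\<lambda>i j. M (Inr i) (Inr j));
         D' = even_matrix_inv D
     in even_det (\<lambda>i j. M (Inl i) (Inl j) -
                         (\<Sum>k\<in>UNIV. \<Sum>l\<in>UNIV. M (Inl i) (Inr k) * D' k l * M (Inr l) (Inl j)))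
        * unit_inv (even_det D))"

definition invertible_mod ::
    "'g::supercommutative_algebra set \<Rightarrow> 'i set \<Rightarrow> ('i \<Rightarrow> 'i \<Rightarrow> 'g) \<Rightarrow> bool" where
  "invertible_mod K S W \<longleftrightarrow>
    (\<exists>N. \<forall>A\<in>S. \<forall>B\<in>S.
       (\<Sum>X\<in>S. W A X * N X B) - (if A = B then 1 else 0) \<in> K \<and>
       (\<Sum>X\<in>S. N A X * W X B) - (if A = B then 1 else 0) \<in> K)"


section \<open>Smooth functions on open subsets of Euclidean space\<close>

primrec Ck_on :: "nat \<Rightarrow> (real ^ 'n::finite) set \<Rightarrow> (real ^ 'n \<Rightarrow> real) \<Rightarrow> bool" where
  "Ck_on 0 S f = continuous_on S f"
| "Ck_on (Suc k) S f =
    (f differentiable_on S \<and> (\<forall>i. Ck_on k S (\<lambda>x. frechet_derivative f (at x) (axis i 1))))"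

definition smooth_fun_on :: "(real ^ 'n::finite) set \<Rightarrow> (real ^ 'n \<Rightarrow> real) \<Rightarrow> bool" where
  "smooth_fun_on S f \<longleftrightarrow> (\<forall>k. Ck_on k S f)"


section \<open>Supermanifolds\<close>

text \<open>The underlying manifold is a type \<open>'p\<close>. The structure sheaf is presented as the sheaf of
  sections of its etale space: a superfunction on an open set is represented by the family of its
  germs, and \<open>\<O> U\<close> is the set of superfunctions on \<open>U\<close> (values outside \<open>U\<close> are irrelevant).
  All stalks of a supermanifold of given dimension are isomorphic superalgebras, so they are
  identified, non-canonically, with one type \<open>'g\<close>.\<close>

type_synonym 'n coord_space = "(real, 'n) vec"
type_synonym ('p, 'g) sect = "'p \<Rightarrow> 'g"
type_synonym ('p, 'g) vfield = "('p \<Rightarrow> 'g) \<Rightarrow> ('p \<Rightarrow> 'g)"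

definition structure_sheaf ::
    "('p::topological_space set \<Rightarrow> ('p, 'g::supercommutative_algebra) sect set) \<Rightarrow> bool" where
  "structure_sheaf \<O> \<longleftrightarrow>
    (\<forall>U V f. open U \<and> open V \<and> V \<subseteq> U \<and> f \<in> \<O> U \<longrightarrow> f \<in> \<O> V) \<and>
    (\<forall>U f. open U \<and> (\<forall>p\<in>U. \<exists>V. open V \<and> p \<in> V \<and> V \<subseteq> U \<and> f \<in> \<O> V) \<longrightarrow> f \<in> \<O> U) \<and>
    (\<forall>U f g. open U \<and> f \<in> \<O> U \<and> (\<forall>p\<in>U. f p = g p) \<longrightarrow> g \<in> \<O> U) \<and>
    (\<forall>U f g p. open U \<and> p \<in> U \<and> f \<in> \<O> U \<and> g \<in> \<O> U \<and> f p = g p \<longrightarrow>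
       (\<exists>V. open V \<and> p \<in> V \<and> V \<subseteq> U \<and> (\<forall>q\<in>V. f q = g q))) \<and>
    (\<forall>p a. \<exists>U f. open U \<and> p \<in> U \<and> f \<in> \<O> U \<and> f p = a) \<and>
    (\<forall>U f g. open U \<and> f \<in> \<O> U \<and> g \<in> \<O> U \<longrightarrow>
       (\<lambda>q. f q + g q) \<in> \<O> U \<and> (\<lambda>q. f q * g q) \<in> \<O> U \<and> (\<lambda>q. grade_inv (f q)) \<in> \<O> U) \<and>
    (\<forall>U r. open U \<longrightarrow> (\<lambda>q. of_real r) \<in> \<O> U)"

definition hom_sect ::
    "('p::topological_space set \<Rightarrow> ('p, 'g::supercommutative_algebra) sect set) \<Rightarrow>
     nat \<Rightarrow> 'p set \<Rightarrow> ('p, 'g) sect set" where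
  "hom_sect \<O> k U = {f \<in> \<O> U. \<forall>q\<in>U. grade_inv (f q) = (-1) ^ k * f q}"

definition odd_monomial ::
    "('n::{finite,linorder} \<Rightarrow> ('p, 'g::supercommutative_algebra) sect) \<Rightarrow> 'n set \<Rightarrow> ('p, 'g) sect" where
  "odd_monomial \<theta> I q = prod_list (map (\<lambda>i. \<theta> i q) (sorted_list_of_set I))"

text \<open>A chart identifies \<open>\<O>\<close> on \<open>U\<close> with smooth functions on the open set \<open>\<phi> ` U\<close> with values in
  the Grassmann algebra generated by \<open>\<theta>\<close>. Here \<open>\<iota>\<close> sends a smooth function \<open>f\<close> of the even
  coordinates to the even superfunction \<open>f(x)\<close>, and every superfunction is uniquely
  \<open>\<Sum>\<^sub>I f\<^sub>I(x) \<theta>\<^sup>I\<close>.\<close>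

definition chart ::
    "('p::topological_space set \<Rightarrow> ('p, 'g::supercommutative_algebra) sect set) \<Rightarrow> 'p set \<Rightarrow>
     ('p \<Rightarrow> 'n::{finite,linorder} coord_space) \<Rightarrow> (('n coord_space \<Rightarrow> real) \<Rightarrow> ('p, 'g) sect) \<Rightarrow>
     ('n \<Rightarrow> ('p, 'g) sect) \<Rightarrow> bool" where
  "chart \<O> U \<phi> \<iota> \<theta> \<longleftrightarrow>
    open U \<and> open (\<phi> ` U) \<and> (\<exists>\<psi>. homeomorphism U (\<phi> ` U) \<phi> \<psi>) \<and>
    (\<forall>i. \<theta> i \<in> hom_sect \<O> 1 U) \<and>
    (\<forall>V. open V \<and> V \<subseteq> U \<longrightarrow>
      (\<forall>f. smooth_fun_on (\<phi> ` V) f \<longrightarrow> \<iota> f \<in> hom_sect \<O> 0 V) \<and>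
      (\<forall>f g. smooth_fun_on (\<phi> ` V) f \<and> smooth_fun_on (\<phi> ` V) g \<longrightarrow>
        (\<forall>q\<in>V. \<iota> (\<lambda>x. f x + g x) q = \<iota> f q + \<iota> g q \<and>
               \<iota> (\<lambda>x. f x * g x) q = \<iota> f q * \<iota> g q) \<and>
        ((\<forall>x\<in>\<phi> ` V. f x = g x) \<longrightarrow> (\<forall>q\<in>V. \<iota> f q = \<iota> g q))) \<and>
      (\<forall>r. \<forall>q\<in>V. \<iota> (\<lambda>x. r) q = of_real r) \<and>
      (\<forall>s\<in>\<O> V. \<exists>F. (\<forall>I. smooth_fun_on (\<phi> ` V) (F I)) \<and>
        (\<forall>q\<in>V. s q = (\<Sum>I\<in>UNIV. \<iota> (F I) q * odd_monomial \<theta> I q))) \<and>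
      (\<forall>F. (\<forall>I. smooth_fun_on (\<phi> ` V) (F I)) \<and>
        (\<forall>q\<in>V. (\<Sum>I\<in>UNIV. \<iota> (F I) q * odd_monomial \<theta> I q) = 0) \<longrightarrow>
        (\<forall>I. \<forall>x\<in>\<phi> ` V. F I x = 0)))"

definition coords ::
    "(('n::{finite,linorder} coord_space \<Rightarrow> real) \<Rightarrow> ('p, 'g::supercommutative_algebra) sect) \<Rightarrow>
     ('n \<Rightarrow> ('p, 'g) sect) \<Rightarrow> 'n + 'n \<Rightarrow> ('p, 'g) sect" where
  "coords \<iota> \<theta> = case_sum (\<lambda>a. \<iota> (\<lambda>x. x $ a)) \<theta>"

text \<open>An \<open>n|n\<close>-dimensional supermanifold with \<open>n = CARD('n)\<close>; the order on \<open>'n\<close> only serves to write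
  down the monomials in the odd coordinates.\<close>

definition supermanifold ::
    "'n::{finite,linorder} itself \<Rightarrow>
     ('p::{t2_space,second_countable_topology} set \<Rightarrow>
       ('p, 'g::supercommutative_algebra) sect set) \<Rightarrow> bool" where
  "supermanifold _ \<O> \<longleftrightarrow> structure_sheaf \<O> \<and>
    (\<forall>p. \<exists>U (\<phi> :: 'p \<Rightarrow> 'n coord_space) \<iota> \<theta>. p \<in> U \<and> chart \<O> U \<phi> \<iota> \<theta>)"


section \<open>Vector fields\<close>

text \<open>A vector field of parity \<open>p\<close> on \<open>U\<close> is a derivation of parity \<open>p\<close> of the sheaf \<open>\<O>\<close> restricted
  to \<open>U\<close>. Parities are natural numbers, relevant only modulo 2.\<close>

definition vector_field ::
    "('p::topological_space set \<Rightarrow> ('p, 'g::supercommutative_algebra) sect set) \<Rightarrow>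
     'p set \<Rightarrow> nat \<Rightarrow> ('p, 'g) vfield \<Rightarrow> bool" where
  "vector_field \<O> U p X \<longleftrightarrow>
    (\<forall>V. open V \<and> V \<subseteq> U \<longrightarrow>
      (\<forall>f\<in>\<O> V. X f \<in> \<O> V) \<and>
      (\<forall>f\<in>\<O> V. \<forall>g\<in>\<O> V. (\<forall>q\<in>V. f q = g q) \<longrightarrow> (\<forall>q\<in>V. X f q = X g q)) \<and>
      (\<forall>f\<in>\<O> V. \<forall>g\<in>\<O> V. \<forall>q\<in>V. X (\<lambda>r. f r + g r) q = X f q + X g q) \<and>
      (\<forall>f\<in>\<O> V. \<forall>c. \<forall>q\<in>V. X (\<lambda>r. c *\<^sub>R f r) q = c *\<^sub>R X f q) \<and>
      (\<forall>k. \<forall>f\<in>hom_sect \<O> k V. X f \<in> hom_sect \<O> (p + k) V) \<and>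
      (\<forall>k. \<forall>f\<in>hom_sect \<O> k V. \<forall>g\<in>\<O> V. \<forall>q\<in>V.
         X (\<lambda>r. f r * g r) q = X f q * g q + (-1) ^ (p * k) * f q * X g q))"

definition field_eq ::
    "('p::topological_space set \<Rightarrow> ('p, 'g::supercommutative_algebra) sect set) \<Rightarrow>
     'p set \<Rightarrow> ('p, 'g) vfield \<Rightarrow> ('p, 'g) vfield \<Rightarrow> bool" where
  "field_eq \<O> U X Y \<longleftrightarrow> (\<forall>V. open V \<and> V \<subseteq> U \<longrightarrow> (\<forall>f\<in>\<O> V. \<forall>q\<in>V. X f q = Y f q))"

definition add_field :: "('p, 'g::supercommutative_algebra) vfield \<Rightarrow> ('p, 'g) vfield \<Rightarrow> ('p, 'g) vfield"
  where "add_field X Y = (\<lambda>f q. X f q + Y f q)"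

definition sub_field :: "('p, 'g::supercommutative_algebra) vfield \<Rightarrow> ('p, 'g) vfield \<Rightarrow> ('p, 'g) vfield"
  where "sub_field X Y = (\<lambda>f q. X f q - Y f q)"

definition scale_field :: "('p, 'g::supercommutative_algebra) sect \<Rightarrow> ('p, 'g) vfield \<Rightarrow> ('p, 'g) vfield"
  where "scale_field h X = (\<lambda>f q. h q * X f q)"

definition comb_field ::
    "'i set \<Rightarrow> ('i \<Rightarrow> ('p, 'g::supercommutative_algebra) sect) \<Rightarrow> ('i \<Rightarrow> ('p, 'g) vfield) \<Rightarrow> ('p, 'g) vfield"
  where "comb_field S a b = (\<lambda>f q. \<Sum>A\<in>S. a A q * b A f q)"

definition coord_fields ::
    "('p::topological_space set \<Rightarrow> ('p, 'g::supercommutative_algebra) sect set) \<Rightarrow> 'p set \<Rightarrow>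
     ('n + 'n \<Rightarrow> ('p, 'g) sect) \<Rightarrow> ('n + 'n \<Rightarrow> ('p, 'g) vfield) \<Rightarrow> bool" where
  "coord_fields \<O> U z D \<longleftrightarrow>
    (\<forall>A. vector_field \<O> U (par A) (D A)) \<and>
    (\<forall>A B. \<forall>q\<in>U. D A (z B) q = (if A = B then 1 else 0))"

definition frame ::
    "('p::topological_space set \<Rightarrow> ('p, 'g::supercommutative_algebra) sect set) \<Rightarrow> 'p set \<Rightarrow>
     ('n::finite + 'n \<Rightarrow> ('p, 'g) vfield) \<Rightarrow> bool" where
  "frame \<O> U b \<longleftrightarrow>
    (\<forall>A. vector_field \<O> U (par A) (b A)) \<and>
    (\<forall>V. open V \<and> V \<subseteq> U \<longrightarrow>
      (\<forall>p X. vector_field \<O> V p X \<longrightarrow>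
        (\<exists>a. (\<forall>A. a A \<in> \<O> V) \<and> field_eq \<O> V X (comb_field UNIV a b))) \<and>
      (\<forall>a. (\<forall>A. a A \<in> \<O> V) \<and> field_eq \<O> V (comb_field UNIV a b) (\<lambda>f q. 0) \<longrightarrow>
        (\<forall>A. \<forall>q\<in>V. a A q = 0)))"

text \<open>A volume element is given by its values \<open>\<rho>(e\<^sub>1,\<dots>,e\<^sub>n; f\<^sub>1,\<dots>,f\<^sub>n)\<close> on local frames, with
  \<open>b = (e; f)\<close>. In coordinates, \<open>\<rho>(z) = \<rho>(\<partial>\<^sub>A)\<close>.\<close>

definition volume_element ::
    "('p::topological_space set \<Rightarrow> ('p, 'g::supercommutative_algebra) sect set) \<Rightarrow>
     (('n::finite + 'n \<Rightarrow> ('p, 'g) vfield) \<Rightarrow> ('p, 'g) sect) \<Rightarrow> bool" where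
  "volume_element \<O> \<rho> \<longleftrightarrow>
    (\<forall>U b. open U \<and> frame \<O> U b \<longrightarrow>
      \<rho> b \<in> hom_sect \<O> 0 U \<and> (\<forall>q\<in>U. unit_elem (\<rho> b q)) \<and>
      (\<forall>b' M. frame \<O> U b' \<and> (\<forall>A B. M A B \<in> \<O> U) \<and>
         (\<forall>A. field_eq \<O> U (b' A) (comb_field UNIV (M A) b)) \<longrightarrow>
         (\<forall>q\<in>U. \<rho> b' q = Ber (\<lambda>A B. M A B q) * \<rho> b q)))"

text \<open>For an odd field \<open>X\<close>, in coordinates \<open>z\<close> with coordinate fields \<open>D\<close>.\<close>

definition divergence ::
    "('n::finite + 'n \<Rightarrow> ('p, 'g::supercommutative_algebra) sect) \<Rightarrow> ('n + 'n \<Rightarrow> ('p, 'g) vfield) \<Rightarrow>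
     (('n + 'n \<Rightarrow> ('p, 'g) vfield) \<Rightarrow> ('p, 'g) sect) \<Rightarrow> ('p, 'g) vfield \<Rightarrow> ('p, 'g) sect" where
  "divergence z D \<rho> X q =
    unit_inv (\<rho> D q) * (\<Sum>A\<in>UNIV. D A (\<lambda>r. \<rho> D r * X (z A) r) q)"


section \<open>Odd symplectic structures\<close>

definition odd_poisson_bracket ::
    "('p::topological_space set \<Rightarrow> ('p, 'g::supercommutative_algebra) sect set) \<Rightarrow>
     (('p, 'g) sect \<Rightarrow> ('p, 'g) sect \<Rightarrow> ('p, 'g) sect) \<Rightarrow> bool" where
  "odd_poisson_bracket \<O> br \<longleftrightarrow>
    (\<forall>V. open V \<longrightarrow>
      (\<forall>f\<in>\<O> V. \<forall>g\<in>\<O> V. br f g \<in> \<O> V) \<and>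
      (\<forall>f\<in>\<O> V. \<forall>f'\<in>\<O> V. \<forall>g\<in>\<O> V. \<forall>g'\<in>\<O> V.
         (\<forall>q\<in>V. f q = f' q \<and> g q = g' q) \<longrightarrow> (\<forall>q\<in>V. br f g q = br f' g' q)) \<and>
      (\<forall>f\<in>\<O> V. \<forall>g\<in>\<O> V. \<forall>h\<in>\<O> V. \<forall>q\<in>V.
         br (\<lambda>r. f r + g r) h q = br f h q + br g h q \<and>
         br h (\<lambda>r. f r + g r) q = br h f q + br h g q) \<and>
      (\<forall>f\<in>\<O> V. \<forall>g\<in>\<O> V. \<forall>c. \<forall>q\<in>V.
         br (\<lambda>r. c *\<^sub>R f r) g q = c *\<^sub>R br f g q \<and> br f (\<lambda>r. c *\<^sub>R g r) q = c *\<^sub>R br f g q) \<and>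
      (\<forall>k l m. \<forall>f\<in>hom_sect \<O> k V. \<forall>g\<in>hom_sect \<O> l V. \<forall>h\<in>hom_sect \<O> m V.
         br f g \<in> hom_sect \<O> (k + l + 1) V \<and>
         (\<forall>q\<in>V.
           br f g q = - ((-1) ^ ((k + 1) * (l + 1)) * br g f q) \<and>
           br f (\<lambda>r. g r * h r) q =
             br f g q * h q + (-1) ^ ((k + 1) * l) * g q * br f h q \<and>
           br f (br g h) q =
             br (br f g) h q + (-1) ^ ((k + 1) * (l + 1)) * br g (br f h) q)))"

definition nondegenerate_bracket ::
    "'n::{finite,linorder} itself \<Rightarrow>
     ('p::topological_space set \<Rightarrow> ('p, 'g::supercommutative_algebra) sect set) \<Rightarrow>
     (('p, 'g) sect \<Rightarrow> ('p, 'g) sect \<Rightarrow> ('p, 'g) sect) \<Rightarrow> bool" where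
  "nondegenerate_bracket _ \<O> br \<longleftrightarrow>
    (\<forall>U (\<phi> :: 'p \<Rightarrow> 'n coord_space) \<iota> \<theta>. chart \<O> U \<phi> \<iota> \<theta> \<longrightarrow>
      (\<forall>q\<in>U. invertible_mod {0} UNIV (\<lambda>A B. br (coords \<iota> \<theta> A) (coords \<iota> \<theta> B) q)))"

text \<open>The odd symplectic form of a non-degenerate bracket is determined by
  \<open>\<omega>(Y, X\<^sub>f) = Y f\<close>, where \<open>X\<^sub>f = {f, \<cdot>}\<close>. Thus \<open>\<omega>(X\<^sub>f, X\<^sub>g) = {f, g}\<close>, and in Darboux
  coordinates \<open>\<omega>(\<partial>/\<partial>x\<^sup>a, \<partial>/\<partial>\<theta>\<^sub>b) = \<delta>\<^sub>a\<^sub>b\<close>. It is symmetric on odd vector fields.\<close>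

definition symplectic_form_of ::
    "('p::topological_space set \<Rightarrow> ('p, 'g::supercommutative_algebra) sect set) \<Rightarrow>
     (('p, 'g) sect \<Rightarrow> ('p, 'g) sect \<Rightarrow> ('p, 'g) sect) \<Rightarrow>
     (('p, 'g) vfield \<Rightarrow> ('p, 'g) vfield \<Rightarrow> ('p, 'g) sect) \<Rightarrow> bool" where
  "symplectic_form_of \<O> br \<omega> \<longleftrightarrow>
    (\<forall>V. open V \<longrightarrow>
      (\<forall>p q X Y. vector_field \<O> V p X \<and> vector_field \<O> V q Y \<longrightarrow>
        \<omega> X Y \<in> hom_sect \<O> (p + q + 1) V \<and>
        (\<forall>r\<in>V. \<omega> X Y r = - ((-1) ^ (p * q) * \<omega> Y X r)) \<and>
        (\<forall>X' Y'. vector_field \<O> V p X' \<and> vector_field \<O> V q Y' \<and>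
           field_eq \<O> V X X' \<and> field_eq \<O> V Y Y' \<longrightarrow> (\<forall>r\<in>V. \<omega> X Y r = \<omega> X' Y' r)) \<and>
        (\<forall>X'. vector_field \<O> V p X' \<longrightarrow>
           (\<forall>r\<in>V. \<omega> (add_field X X') Y r = \<omega> X Y r + \<omega> X' Y r)) \<and>
        (\<forall>k. \<forall>h\<in>hom_sect \<O> k V. \<forall>r\<in>V. \<omega> (scale_field h X) Y r = h r * \<omega> X Y r)) \<and>
      (\<forall>p Y k. \<forall>f\<in>hom_sect \<O> k V. vector_field \<O> V p Y \<longrightarrow>
         (\<forall>r\<in>V. \<omega> Y (br f) r = Y f r)))"

definition odd_symplectic_supermanifold ::
    "'n::{finite,linorder} itself \<Rightarrow>
     ('p::{t2_space,second_countable_topology} set \<Rightarrow>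
       ('p, 'g::supercommutative_algebra) sect set) \<Rightarrow>
     (('p, 'g) sect \<Rightarrow> ('p, 'g) sect \<Rightarrow> ('p, 'g) sect) \<Rightarrow>
     (('p, 'g) vfield \<Rightarrow> ('p, 'g) vfield \<Rightarrow> ('p, 'g) sect) \<Rightarrow> bool" where
  "odd_symplectic_supermanifold n \<O> br \<omega> \<longleftrightarrow>
    supermanifold n \<O> \<and> odd_poisson_bracket \<O> br \<and> nondegenerate_bracket n \<O> br \<and>
    symplectic_form_of \<O> br \<omega>"

definition darboux_coords ::
    "(('p, 'g::supercommutative_algebra) sect \<Rightarrow> ('p, 'g) sect \<Rightarrow> ('p, 'g) sect) \<Rightarrow>
     'p set \<Rightarrow> ('n + 'n \<Rightarrow> ('p, 'g) sect) \<Rightarrow> bool" where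
  "darboux_coords br U z \<longleftrightarrow>
    (\<forall>a b. \<forall>q\<in>U.
      br (z (Inl a)) (z (Inl b)) q = 0 \<and>
      br (z (Inl a)) (z (Inr b)) q = (if a = b then 1 else 0) \<and>
      br (z (Inr a)) (z (Inr b)) q = 0)"


section \<open>Affine connections\<close>

definition affine_connection ::
    "('p::topological_space set \<Rightarrow> ('p, 'g::supercommutative_algebra) sect set) \<Rightarrow>
     (('p, 'g) vfield \<Rightarrow> ('p, 'g) vfield \<Rightarrow> ('p, 'g) vfield) \<Rightarrow> bool" where
  "affine_connection \<O> nab \<longleftrightarrow>
    (\<forall>U p q X Y. open U \<and> vector_field \<O> U p X \<and> vector_field \<O> U q Y \<longrightarrow>
      vector_field \<O> U (p + q) (nab X Y) \<and>
      (\<forall>X' Y'. vector_field \<O> U p X' \<and> vector_field \<O> U q Y' \<and>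
         field_eq \<O> U X X' \<and> field_eq \<O> U Y Y' \<longrightarrow> field_eq \<O> U (nab X Y) (nab X' Y')) \<and>
      (\<forall>X'. vector_field \<O> U p X' \<longrightarrow>
         field_eq \<O> U (nab (add_field X X') Y) (add_field (nab X Y) (nab X' Y))) \<and>
      (\<forall>Y'. vector_field \<O> U q Y' \<longrightarrow>
         field_eq \<O> U (nab X (add_field Y Y')) (add_field (nab X Y) (nab X Y'))) \<and>
      (\<forall>k. \<forall>h\<in>hom_sect \<O> k U.
         field_eq \<O> U (nab (scale_field h X) Y) (scale_field h (nab X Y)) \<and>
         field_eq \<O> U (nab X (scale_field h Y))
           (add_field (scale_field (X h) Y)
                      (scale_field (\<lambda>r. (-1) ^ (p * k) * h r) (nab X Y)))))"

definition torsion_free ::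
    "('p::topological_space set \<Rightarrow> ('p, 'g::supercommutative_algebra) sect set) \<Rightarrow>
     (('p, 'g) vfield \<Rightarrow> ('p, 'g) vfield \<Rightarrow> ('p, 'g) vfield) \<Rightarrow> bool" where
  "torsion_free \<O> nab \<longleftrightarrow>
    (\<forall>U p q X Y. open U \<and> vector_field \<O> U p X \<and> vector_field \<O> U q Y \<longrightarrow>
      field_eq \<O> U (\<lambda>f r. nab X Y f r - (-1) ^ (p * q) * nab Y X f r)
                   (\<lambda>f r. X (Y f) r - (-1) ^ (p * q) * Y (X f) r))"

definition darboux_flat ::
    "'n::{finite,linorder} itself \<Rightarrow>
     ('p::topological_space set \<Rightarrow> ('p, 'g::supercommutative_algebra) sect set) \<Rightarrow>
     (('p, 'g) sect \<Rightarrow> ('p, 'g) sect \<Rightarrow> ('p, 'g) sect) \<Rightarrow>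
     (('p, 'g) vfield \<Rightarrow> ('p, 'g) vfield \<Rightarrow> ('p, 'g) vfield) \<Rightarrow> bool" where
  "darboux_flat _ \<O> br nab \<longleftrightarrow>
    affine_connection \<O> nab \<and> torsion_free \<O> nab \<and>
    (\<forall>p. \<exists>U (\<phi> :: 'p \<Rightarrow> 'n coord_space) \<iota> \<theta> D.
      p \<in> U \<and> chart \<O> U \<phi> \<iota> \<theta> \<and> darboux_coords br U (coords \<iota> \<theta>) \<and>
      coord_fields \<O> U (coords \<iota> \<theta>) D \<and>
      (\<forall>A B. field_eq \<O> U (nab (D A) (D B)) (\<lambda>f q. 0)))"


section \<open>Submanifolds of codimension \<open>1|1\<close>\<close>

text \<open>A submanifold is given by its underlying point set \<open>C\<close> and, for \<open>q \<in> C\<close>, the ideal \<open>J q\<close> of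
  germs vanishing on it. Near each of its points it is \<open>x\<^sup>c = \<theta>\<^sub>c = 0\<close> in suitable coordinates.
  Superfunctions on the submanifold are superfunctions modulo \<open>J\<close>. Vector fields defined at its
  points are represented by vector fields on an open subset of the ambient supermanifold, two such
  being identified if they agree along \<open>C\<close>.\<close>

definition adapted_chart ::
    "('p::topological_space set \<Rightarrow> ('p, 'g::supercommutative_algebra) sect set) \<Rightarrow>
     'p set \<Rightarrow> ('p \<Rightarrow> 'g set) \<Rightarrow> 'p set \<Rightarrow> ('p \<Rightarrow> 'n::{finite,linorder} coord_space) \<Rightarrow>
     (('n coord_space \<Rightarrow> real) \<Rightarrow> ('p, 'g) sect) \<Rightarrow> ('n \<Rightarrow> ('p, 'g) sect) \<Rightarrow> 'n \<Rightarrow> bool" where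
  "adapted_chart \<O> C J U \<phi> \<iota> \<theta> c \<longleftrightarrow>
    chart \<O> U \<phi> \<iota> \<theta> \<and> C \<inter> U = {q \<in> U. \<phi> q $ c = 0} \<and>
    (\<forall>q\<in>C \<inter> U. J q = {\<iota> (\<lambda>x. x $ c) q * a + \<theta> c q * b | a b. True})"

definition submanifold ::
    "'n::{finite,linorder} itself \<Rightarrow>
     ('p::topological_space set \<Rightarrow> ('p, 'g::supercommutative_algebra) sect set) \<Rightarrow>
     'p set \<Rightarrow> ('p \<Rightarrow> 'g set) \<Rightarrow> bool" where
  "submanifold _ \<O> C J \<longleftrightarrow>
    (\<forall>p\<in>C. \<exists>U (\<phi> :: 'p \<Rightarrow> 'n coord_space) \<iota> \<theta> c. p \<in> U \<and> adapted_chart \<O> C J U \<phi> \<iota> \<theta> c)"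

definition eq_on_C :: "'p set \<Rightarrow> ('p \<Rightarrow> 'g::supercommutative_algebra set) \<Rightarrow> 'p set \<Rightarrow>
     ('p, 'g) sect \<Rightarrow> ('p, 'g) sect \<Rightarrow> bool" where
  "eq_on_C C J U f g \<longleftrightarrow> (\<forall>q\<in>C \<inter> U. f q - g q \<in> J q)"

definition field_eq_on_C ::
    "('p::topological_space set \<Rightarrow> ('p, 'g::supercommutative_algebra) sect set) \<Rightarrow>
     'p set \<Rightarrow> ('p \<Rightarrow> 'g set) \<Rightarrow> 'p set \<Rightarrow> ('p, 'g) vfield \<Rightarrow> ('p, 'g) vfield \<Rightarrow> bool" where
  "field_eq_on_C \<O> C J U X Y \<longleftrightarrow>
    (\<forall>V. open V \<and> V \<subseteq> U \<longrightarrow> (\<forall>f\<in>\<O> V. eq_on_C C J V (X f) (Y f)))"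

definition tangent_to ::
    "('p::topological_space set \<Rightarrow> ('p, 'g::supercommutative_algebra) sect set) \<Rightarrow>
     'p set \<Rightarrow> ('p \<Rightarrow> 'g set) \<Rightarrow> 'p set \<Rightarrow> ('p, 'g) vfield \<Rightarrow> bool" where
  "tangent_to \<O> C J U X \<longleftrightarrow>
    (\<forall>V. open V \<and> V \<subseteq> U \<longrightarrow>
      (\<forall>f\<in>\<O> V. eq_on_C C J V f (\<lambda>q. 0) \<longrightarrow> eq_on_C C J V (X f) (\<lambda>q. 0)))"

definition orthogonal_to ::
    "('p::topological_space set \<Rightarrow> ('p, 'g::supercommutative_algebra) sect set) \<Rightarrow>
     (('p, 'g) vfield \<Rightarrow> ('p, 'g) vfield \<Rightarrow> ('p, 'g) sect) \<Rightarrow>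
     'p set \<Rightarrow> ('p \<Rightarrow> 'g set) \<Rightarrow> 'p set \<Rightarrow> ('p, 'g) vfield \<Rightarrow> bool" where
  "orthogonal_to \<O> \<omega> C J U X \<longleftrightarrow>
    (\<forall>V p Y. open V \<and> V \<subseteq> U \<and> vector_field \<O> V p Y \<and> tangent_to \<O> C J V Y \<longrightarrow>
      eq_on_C C J V (\<omega> X Y) (\<lambda>q. 0))"

definition tangent_indices :: "'n \<Rightarrow> ('n + 'n) set" where
  "tangent_indices c = UNIV - {Inl c, Inr c}"

text \<open>In an adapted chart the coordinate fields other than \<open>\<partial>/\<partial>x\<^sup>c\<close> and \<open>\<partial>/\<partial>\<theta>\<^sub>c\<close> restrict to the
  coordinate fields of the submanifold, so the matrix below is that of the restricted form.\<close>

definition nondegenerate_submanifold ::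
    "'n::{finite,linorder} itself \<Rightarrow>
     ('p::topological_space set \<Rightarrow> ('p, 'g::supercommutative_algebra) sect set) \<Rightarrow>
     (('p, 'g) vfield \<Rightarrow> ('p, 'g) vfield \<Rightarrow> ('p, 'g) sect) \<Rightarrow>
     'p set \<Rightarrow> ('p \<Rightarrow> 'g set) \<Rightarrow> bool" where
  "nondegenerate_submanifold n \<O> \<omega> C J \<longleftrightarrow>
    submanifold n \<O> C J \<and>
    (\<forall>U (\<phi> :: 'p \<Rightarrow> 'n coord_space) \<iota> \<theta> c D.
      adapted_chart \<O> C J U \<phi> \<iota> \<theta> c \<and> coord_fields \<O> U (coords \<iota> \<theta>) D \<longrightarrow>
      (\<forall>q\<in>C \<inter> U. invertible_mod (J q) (tangent_indices c) (\<lambda>A B. \<omega> (D A) (D B) q)))"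

text \<open>A frame of \<open>TC\<close>, consisting of the fields \<open>b A\<close> with \<open>A \<in> tangent_indices c\<close>; here \<open>c\<close> is an
  arbitrary index, used to reserve a pair of places for the normal directions.\<close>

definition tangent_frame ::
    "('p::topological_space set \<Rightarrow> ('p, 'g::supercommutative_algebra) sect set) \<Rightarrow>
     'p set \<Rightarrow> ('p \<Rightarrow> 'g set) \<Rightarrow> 'p set \<Rightarrow> 'n::finite \<Rightarrow> ('n + 'n \<Rightarrow> ('p, 'g) vfield) \<Rightarrow> bool" where
  "tangent_frame \<O> C J U c b \<longleftrightarrow>
    (\<forall>A\<in>tangent_indices c. vector_field \<O> U (par A) (b A) \<and> tangent_to \<O> C J U (b A)) \<and>
    (\<forall>V. open V \<and> V \<subseteq> U \<longrightarrow>
      (\<forall>p X. vector_field \<O> V p X \<and> tangent_to \<O> C J V X \<longrightarrow>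
        (\<forall>q\<in>C \<inter> V. \<exists>W a. open W \<and> q \<in> W \<and> W \<subseteq> V \<and> (\<forall>A. a A \<in> \<O> W) \<and>
          field_eq_on_C \<O> C J W X (comb_field (tangent_indices c) a b))) \<and>
      (\<forall>a. (\<forall>A. a A \<in> \<O> V) \<and>
         field_eq_on_C \<O> C J V (comb_field (tangent_indices c) a b) (\<lambda>f q. 0) \<longrightarrow>
         (\<forall>A\<in>tangent_indices c. eq_on_C C J V (a A) (\<lambda>q. 0))))"

text \<open>An even endomorphism of \<open>TE\<close> over \<open>U\<close> which, along \<open>C\<close>, is the projector onto the
  symplecto-orthogonal of \<open>TC\<close> along \<open>TC\<close>.\<close>

definition orthogonal_projector ::
    "('p::topological_space set \<Rightarrow> ('p, 'g::supercommutative_algebra) sect set) \<Rightarrow>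
     (('p, 'g) vfield \<Rightarrow> ('p, 'g) vfield \<Rightarrow> ('p, 'g) sect) \<Rightarrow>
     'p set \<Rightarrow> ('p \<Rightarrow> 'g set) \<Rightarrow> 'p set \<Rightarrow> (('p, 'g) vfield \<Rightarrow> ('p, 'g) vfield) \<Rightarrow> bool" where
  "orthogonal_projector \<O> \<omega> C J U \<P> \<longleftrightarrow>
    (\<forall>V p X. open V \<and> V \<subseteq> U \<and> vector_field \<O> V p X \<longrightarrow>
      vector_field \<O> V p (\<P> X) \<and>
      (\<forall>Y. vector_field \<O> V p Y \<longrightarrow>
        (field_eq \<O> V X Y \<longrightarrow> field_eq \<O> V (\<P> X) (\<P> Y)) \<and>
        field_eq \<O> V (\<P> (add_field X Y)) (add_field (\<P> X) (\<P> Y))) \<and>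
      (\<forall>k. \<forall>h\<in>hom_sect \<O> k V. field_eq \<O> V (\<P> (scale_field h X)) (scale_field h (\<P> X))) \<and>
      orthogonal_to \<O> \<omega> C J V (\<P> X) \<and>
      tangent_to \<O> C J V (sub_field X (\<P> X)) \<and>
      (tangent_to \<O> C J V X \<longrightarrow> field_eq_on_C \<O> C J V (\<P> X) (\<lambda>f q. 0)) \<and>
      (orthogonal_to \<O> \<omega> C J V X \<longrightarrow> field_eq_on_C \<O> C J V (\<P> X) X))"


section \<open>The half-density of a connection\<close>

text \<open>The conditions determining \<open>\<Psi>\<close> up to an invertible factor. ``Non-nilpotent'' is
  understood pointwise: at each point of \<open>C\<close> some component has non-zero numerical value.\<close>

definition admissible_field ::
    "('p::topological_space set \<Rightarrow> ('p, 'g::supercommutative_algebra) sect set) \<Rightarrow>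
     (('p, 'g) vfield \<Rightarrow> ('p, 'g) vfield \<Rightarrow> ('p, 'g) sect) \<Rightarrow>
     'p set \<Rightarrow> ('p \<Rightarrow> 'g set) \<Rightarrow> 'p set \<Rightarrow> ('n + 'n \<Rightarrow> ('p, 'g) sect) \<Rightarrow> ('p, 'g) vfield \<Rightarrow> bool" where
  "admissible_field \<O> \<omega> C J U z \<Psi> \<longleftrightarrow>
    vector_field \<O> U 1 \<Psi> \<and> orthogonal_to \<O> \<omega> C J U \<Psi> \<and>
    (\<forall>q\<in>C \<inter> U. \<exists>A. body (\<Psi> (z A) q) \<noteq> 0) \<and>
    eq_on_C C J U (\<omega> \<Psi> \<Psi>) (\<lambda>q. 0)"

definition normal_companion ::
    "('p::topological_space set \<Rightarrow> ('p, 'g::supercommutative_algebra) sect set) \<Rightarrow>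
     (('p, 'g) vfield \<Rightarrow> ('p, 'g) vfield \<Rightarrow> ('p, 'g) sect) \<Rightarrow>
     'p set \<Rightarrow> ('p \<Rightarrow> 'g set) \<Rightarrow> 'p set \<Rightarrow> ('p, 'g) vfield \<Rightarrow> ('p, 'g) vfield \<Rightarrow> bool" where
  "normal_companion \<O> \<omega> C J U \<Psi> H \<longleftrightarrow>
    vector_field \<O> U 0 H \<and> orthogonal_to \<O> \<omega> C J U H \<and> eq_on_C C J U (\<omega> H \<Psi>) (\<lambda>q. 1)"

text \<open>\<open>A(\<nabla>, \<Psi>) = Tr(\<P>(\<nabla>\<Psi>)) - div \<Psi>\<close>, computed from an extension \<open>\<Psi>\<close> to a neighbourhood; only
  its restriction to \<open>C\<close> is meaningful. The component \<open>X\<^sup>B\<close> of a field is \<open>X z\<^sup>B\<close>.\<close>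

definition A_conn ::
    "('n::finite + 'n \<Rightarrow> ('p, 'g::supercommutative_algebra) sect) \<Rightarrow> ('n + 'n \<Rightarrow> ('p, 'g) vfield) \<Rightarrow>
     (('n + 'n \<Rightarrow> ('p, 'g) vfield) \<Rightarrow> ('p, 'g) sect) \<Rightarrow>
     (('p, 'g) vfield \<Rightarrow> ('p, 'g) vfield) \<Rightarrow>
     (('p, 'g) vfield \<Rightarrow> ('p, 'g) vfield \<Rightarrow> ('p, 'g) vfield) \<Rightarrow> ('p, 'g) vfield \<Rightarrow> ('p, 'g) sect" where
  "A_conn z D \<rho> \<P> nab \<Psi> q =
    (\<Sum>A\<in>UNIV. \<Sum>B\<in>UNIV. nab (D A) \<Psi> (z B) q * \<P> (D B) (z A) q) - divergence z D \<rho> \<Psi> q"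

text \<open>\<open>\<rho>\<^sub>\<Psi>(e; f) = \<rho>(e, H; f, \<Psi>)\<close> on a tangent frame \<open>b = (e; f)\<close>. Putting \<open>H\<close> and \<open>\<Psi>\<close> in place
  \<open>c\<close> instead of last applies the same permutation to the even and to the odd vectors and hence
  does not change the value.\<close>

definition volume_on_C ::
    "(('n + 'n \<Rightarrow> ('p, 'g) vfield) \<Rightarrow> ('p, 'g::supercommutative_algebra) sect) \<Rightarrow>
     ('p, 'g) vfield \<Rightarrow> ('p, 'g) vfield \<Rightarrow> 'n \<Rightarrow> ('n + 'n \<Rightarrow> ('p, 'g) vfield) \<Rightarrow> ('p, 'g) sect" where
  "volume_on_C \<rho> H \<Psi> c b = \<rho> (b(Inl c := H, Inr c := \<Psi>))"

text \<open>The square root, in the stalk at \<open>q\<close> of the structure sheaf of the submanifold, of the even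
  invertible germ \<open>g\<close>, or of \<open>- g\<close> if the value of \<open>g\<close> is negative: half-densities scale with
  \<open>|Ber|\<^sup>1\<^sup>/\<^sup>2\<close>. It is determined modulo \<open>J q\<close>.\<close>

definition sqrt_on_C :: "('p \<Rightarrow> 'g::supercommutative_algebra set) \<Rightarrow> ('p, 'g) sect \<Rightarrow> ('p, 'g) sect" where
  "sqrt_on_C J g q =
    (SOME r. grade_inv r = r \<and> body r > 0 \<and> r * r - of_real (sgn (body (g q))) * g q \<in> J q)"

text \<open>The value of \<open>s\<^sub>C(\<nabla>) = A(\<nabla>, \<Psi>) \<surd>\<rho>\<^sub>\<Psi>\<close> on the tangent frame \<open>b\<close>, with \<open>A(\<nabla>, \<Psi>)\<close> computed from
  the extensions \<open>\<P>\<close> and \<open>\<Psi>'\<close>.\<close>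

definition s_C ::
    "('p \<Rightarrow> 'g::supercommutative_algebra set) \<Rightarrow>
     ('n::finite + 'n \<Rightarrow> ('p, 'g) sect) \<Rightarrow> ('n + 'n \<Rightarrow> ('p, 'g) vfield) \<Rightarrow>
     (('n + 'n \<Rightarrow> ('p, 'g) vfield) \<Rightarrow> ('p, 'g) sect) \<Rightarrow>
     (('p, 'g) vfield \<Rightarrow> ('p, 'g) vfield \<Rightarrow> ('p, 'g) vfield) \<Rightarrow>
     (('p, 'g) vfield \<Rightarrow> ('p, 'g) vfield) \<Rightarrow> ('p, 'g) vfield \<Rightarrow>
     ('p, 'g) vfield \<Rightarrow> ('p, 'g) vfield \<Rightarrow> 'n \<Rightarrow> ('n + 'n \<Rightarrow> ('p, 'g) vfield) \<Rightarrow> ('p, 'g) sect" where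
  "s_C J z D \<rho> nab \<P> \<Psi>' \<Psi> H c b q =
    A_conn z D \<rho> \<P> nab \<Psi>' q * sqrt_on_C J (volume_on_C \<rho> H \<Psi> c b) q"

end

theory Submission
  imports Defs
begin

text \<open>By Hadamard's lemma a derivation is determined by its values on coordinates, so every
  expression that is linear over superfunctions in a vector field \<open>X\<close> (such as \<open>\<omega>(X, \<Psi>)\<close> or
  \<open>\<nabla>\<^sub>X \<Psi>\<close>) is the combination, with coefficients \<open>X\<^sup>A\<close>, of its values at
  \<open>X = \<partial>\<^sub>A\<close>; in particular it lies in \<open>J\<close> as soon as all \<open>X\<^sup>A\<close> do.

  Replacing the extension of \<open>\<Psi>\<close> by another one changes \<open>Tr(\<Pi>(\<nabla>\<Psi>)) - div \<Psi>\<close> by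
  \<open>\<Sum> (\<Pi>\<partial>\<^sub>B - \<partial>\<^sub>B) \<chi>\<^sup>B\<close> modulo \<open>J\<close>, where \<open>\<chi>\<close> vanishes on \<open>C\<close>; this lies in \<open>J\<close> because
  \<open>\<partial>\<^sub>B - \<Pi>\<partial>\<^sub>B\<close> is tangent to \<open>C\<close>. It remains to treat the difference \<open>S = \<nabla> - \<nabla>'\<close> of the
  connections. Since \<open>\<omega>(H, \<Psi>) = 1\<close> and \<open>\<omega>(\<Psi>, \<Psi>) = \<omega>(H, H) = 0\<close> on \<open>C\<close>, one has
  \<open>\<Pi>\<partial>\<^sub>B = \<omega>(\<partial>\<^sub>B, \<Psi>) H - \<omega>(\<Pi>\<partial>\<^sub>B, H) \<Psi>\<close>. The second term does not contribute: for odd \<open>\<Psi>\<close>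
  vanishing torsion gives \<open>\<nabla>\<^sub>\<Psi> \<Psi> = \<Psi>\<^sup>2\<close>, hence \<open>S(\<Psi>, \<Psi>) = 0\<close>. The first one contributes
  \<open>\<Sum> \<omega>(\<partial>\<^sub>B, \<Psi>) S(H, \<Psi>)\<^sup>B = \<omega>(S(H, \<Psi>), \<Psi>)\<close>, which vanishes because a Darboux flat connection
  preserves \<open>\<omega>\<close>, so that \<open>2 \<omega>(\<nabla>\<^sub>H \<Psi>, \<Psi>) = H \<omega>(\<Psi>, \<Psi>)\<close> for both connections.\<close>

section \<open>Smooth functions and Hadamard's lemma\<close>

lemma Ck_on_has_derivative:
  assumes "open S" "Ck_on (Suc k) S f" "x \<in> S"
  shows "(f has_derivative frechet_derivative f (at x)) (at x)"
proof -
  have "f differentiable (at x within S)"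
    using assms(2,3) by (auto simp: differentiable_on_def)
  then show ?thesis
    unfolding at_within_open[OF assms(3,1)] by (simp add: frechet_derivative_works)
qed

text \<open>At points of an open set \<open>frechet_derivative\<close> depends only on the values
  near the point, so agreement on \<open>S\<close> passes to all partial derivatives.\<close>

lemma Ck_on_cong:
  assumes "open S" "\<And>x. x \<in> S \<Longrightarrow> f x = g x" "Ck_on k S f"
  shows "Ck_on k S g"
  using assms(2,3)
proof (induction k arbitrary: f g)
  case 0
  then show ?case using continuous_on_cong[of S S f g] by auto
next
  case (Suc k)
  have d: "(f has_derivative frechet_derivative f (at x)) (at x)" if "x \<in> S" for x
    using Ck_on_has_derivative[OF \<open>open S\<close> Suc.prems(2) that] .
  have dg: "(g has_derivative frechet_derivative f (at x)) (at x)" if "x \<in> S" for x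
    using has_derivative_transform_within_open[OF d[OF that] \<open>open S\<close> that Suc.prems(1)] .
  have e: "frechet_derivative f (at x) (axis i 1) = frechet_derivative g (at x) (axis i 1)"
    if "x \<in> S" for x i
    using frechet_derivative_at[OF dg[OF that]] by simp
  have "g differentiable_on S"
    unfolding differentiable_on_def differentiable_def
    using dg has_derivative_at_withinI by blast
  moreover have "Ck_on k S (\<lambda>x. frechet_derivative f (at x) (axis i 1))" for i
    using Suc.prems(2) by (subst (asm) Ck_on.simps(2)) blast
  then have "Ck_on k S (\<lambda>x. frechet_derivative g (at x) (axis i 1))" for i
    by (rule Suc.IH[rotated]) (rule e)
  ultimately show ?case by (subst Ck_on.simps(2)) blast
qed

text \<open>Derivatives at interior points are unique, so an explicitly known derivative
  \<open>f'\<close> may replace \<open>frechet_derivative\<close>. All closure properties of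
  \<open>Ck_on\<close> below are obtained in this way.\<close>

lemma Ck_on_Suc_I:
  assumes "open S" "\<And>x. x \<in> S \<Longrightarrow> (f has_derivative f' x) (at x)"
    "\<And>i. Ck_on k S (\<lambda>x. f' x (axis i 1))"
  shows "Ck_on (Suc k) S f"
proof -
  have "f differentiable_on S"
    unfolding differentiable_on_def differentiable_def
    using assms(2) has_derivative_at_withinI by blast
  moreover have "Ck_on k S (\<lambda>x. frechet_derivative f (at x) (axis i 1))" for i
    by (rule Ck_on_cong[OF \<open>open S\<close> _ assms(3)[of i]]) (metis assms(2) frechet_derivative_at)
  ultimately show ?thesis by simp
qed

lemma Ck_on_Suc_D: "open S \<Longrightarrow> Ck_on (Suc k) S f \<Longrightarrow> Ck_on k S f"
proof (induction k arbitrary: f)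
  case 0
  then show ?case by (auto intro: differentiable_imp_continuous_on)
next
  case (Suc k)
  have "Ck_on (Suc k) S (\<lambda>x. frechet_derivative f (at x) (axis i 1))" for i
    using Suc.prems(2) by (subst (asm) Ck_on.simps(2)) blast
  then have "Ck_on k S (\<lambda>x. frechet_derivative f (at x) (axis i 1))" for i
    using Suc.IH[OF \<open>open S\<close>] by blast
  moreover have "f differentiable_on S"
    using Suc.prems(2) by (subst (asm) Ck_on.simps(2)) blast
  ultimately show ?case by (subst Ck_on.simps(2)) blast
qed

lemma Ck_on_subset: "T \<subseteq> S \<Longrightarrow> Ck_on k S f \<Longrightarrow> Ck_on k T f"
  by (induction k arbitrary: f)
    (auto intro: continuous_on_subset differentiable_on_subset)

lemma smooth_fun_on_subset: "smooth_fun_on S f \<Longrightarrow> T \<subseteq> S \<Longrightarrow> smooth_fun_on T f"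
  by (auto simp: smooth_fun_on_def intro: Ck_on_subset)

lemma Ck_on_const: "open S \<Longrightarrow> Ck_on k S (\<lambda>x. c)"
proof (induction k arbitrary: c)
  case (Suc k)
  then show ?case by (intro Ck_on_Suc_I[where f' = "\<lambda>x h. 0"]) auto
qed auto

lemma Ck_on_component: "open S \<Longrightarrow> Ck_on k S (\<lambda>x. x $ i)"
proof (cases k)
  case (Suc m)
  assume "open S"
  then show ?thesis unfolding Suc
    by (intro Ck_on_Suc_I[where f' = "\<lambda>x h. h $ i"])
      (auto intro!: Ck_on_const bounded_linear_imp_has_derivative bounded_linear_vec_nth)
qed (auto intro!: continuous_intros)

lemma Ck_on_add:
  "open S \<Longrightarrow> Ck_on k S f \<Longrightarrow> Ck_on k S g \<Longrightarrow> Ck_on k S (\<lambda>x. f x + g x)"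
proof (induction k arbitrary: f g)
  case 0
  then show ?case by (auto intro: continuous_intros)
next
  case (Suc k)
  have h: "(f has_derivative frechet_derivative f (at x)) (at x)"
    "(g has_derivative frechet_derivative g (at x)) (at x)" if "x \<in> S" for x
    using Ck_on_has_derivative[OF \<open>open S\<close> _ that] Suc.prems(2,3) by (simp_all only:)
  have d: "((\<lambda>x. f x + g x) has_derivative
      (\<lambda>v. frechet_derivative f (at x) v + frechet_derivative g (at x) v)) (at x)" if "x \<in> S" for x
    using has_derivative_add[OF h[OF that]] .
  have "Ck_on k S (\<lambda>x. frechet_derivative f (at x) (axis i 1) + frechet_derivative g (at x) (axis i 1))" for i
    by (rule Suc.IH) (use Suc.prems in simp_all)
  then show ?case by (rule Ck_on_Suc_I[OF \<open>open S\<close> d, rotated])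
qed

text \<open>The product rule multiplies partial derivatives, which are of class \<open>k\<close>,
  with factors of class \<open>Suc k\<close>; \<open>Ck_on_Suc_D\<close> lowers the latter so that
  the induction hypothesis applies to both products.\<close>

lemma Ck_on_mult:
  "open S \<Longrightarrow> Ck_on k S f \<Longrightarrow> Ck_on k S g \<Longrightarrow> Ck_on k S (\<lambda>x. f x * g x)"
proof (induction k arbitrary: f g)
  case 0
  then show ?case by (simp add: continuous_on_mult)
next
  case (Suc k)
  have d: "Ck_on k S f" "Ck_on k S g" using Suc.prems by (auto intro: Ck_on_Suc_D simp del: Ck_on.simps)
  have h: "(f has_derivative frechet_derivative f (at x)) (at x)"
    "(g has_derivative frechet_derivative g (at x)) (at x)" if "x \<in> S" for x
    using Ck_on_has_derivative[OF \<open>open S\<close> _ that] Suc.prems(2,3) by (simp_all only:)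
  have p: "Ck_on k S (\<lambda>x. frechet_derivative f (at x) (axis i 1))"
    "Ck_on k S (\<lambda>x. frechet_derivative g (at x) (axis i 1))" for i
    using Suc.prems by simp_all
  have e: "((\<lambda>x. f x * g x) has_derivative
      (\<lambda>v. f x * frechet_derivative g (at x) v + frechet_derivative f (at x) v * g x)) (at x)"
    if "x \<in> S" for x
    using has_derivative_mult[OF h[OF that]] .
  have "Ck_on k S (\<lambda>x. f x * frechet_derivative g (at x) (axis i 1) +
      frechet_derivative f (at x) (axis i 1) * g x)" for i
    using Ck_on_add[OF \<open>open S\<close> Suc.IH[OF \<open>open S\<close> d(1) p(2)] Suc.IH[OF \<open>open S\<close> p(1) d(2)]] .
  then show ?case by (rule Ck_on_Suc_I[OF \<open>open S\<close> e, rotated])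
qed

lemma smooth_fun_on_const: "open S \<Longrightarrow> smooth_fun_on S (\<lambda>x. c)"
  and smooth_fun_on_component: "open S \<Longrightarrow> smooth_fun_on S (\<lambda>x. x $ i)"
  and smooth_fun_on_add:
    "open S \<Longrightarrow> smooth_fun_on S f \<Longrightarrow> smooth_fun_on S g \<Longrightarrow> smooth_fun_on S (\<lambda>x. f x + g x)"
  and smooth_fun_on_mult:
    "open S \<Longrightarrow> smooth_fun_on S f \<Longrightarrow> smooth_fun_on S g \<Longrightarrow> smooth_fun_on S (\<lambda>x. f x * g x)"
  by (simp_all add: smooth_fun_on_def Ck_on_const Ck_on_component Ck_on_add Ck_on_mult)

lemma smooth_fun_on_sum:
  "finite I \<Longrightarrow> open S \<Longrightarrow> (\<And>i. i \<in> I \<Longrightarrow> smooth_fun_on S (f i)) \<Longrightarrow>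
    smooth_fun_on S (\<lambda>x. \<Sum>i\<in>I. f i x)"
  by (induction I rule: finite_induct) (auto intro: smooth_fun_on_const smooth_fun_on_add)

lemma smooth_fun_on_partial:
  "smooth_fun_on S f \<Longrightarrow> smooth_fun_on S (\<lambda>x. frechet_derivative f (at x) (axis i 1))"
  unfolding smooth_fun_on_def by (metis Ck_on.simps(2))

lemma smooth_fun_on_has_derivative:
  "open S \<Longrightarrow> smooth_fun_on S f \<Longrightarrow> x \<in> S \<Longrightarrow>
    (f has_derivative frechet_derivative f (at x)) (at x)"
  unfolding smooth_fun_on_def using Ck_on_has_derivative by blast

lemma smooth_fun_on_continuous: "smooth_fun_on S f \<Longrightarrow> continuous_on S f"
  unfolding smooth_fun_on_def by (metis Ck_on.simps(1))

lemma frechet_derivative_sum_partials: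
  fixes f :: "real ^ 'n::finite \<Rightarrow> real"
  assumes "(f has_derivative frechet_derivative f (at x)) (at x)"
  shows "frechet_derivative f (at x) h = (\<Sum>i\<in>UNIV. h $ i * frechet_derivative f (at x) (axis i 1))"
proof -
  have l: "linear (frechet_derivative f (at x))"
    using assms has_derivative_linear by blast
  have "h = (\<Sum>i\<in>UNIV. h $ i *\<^sub>R axis i 1)"
    using basis_expansion[of h, symmetric] unfolding scalar_mult_eq_scaleR .
  then have "frechet_derivative f (at x) h = frechet_derivative f (at x) (\<Sum>i\<in>UNIV. h $ i *\<^sub>R axis i 1)"
    by (rule arg_cong)
  also have "\<dots> = (\<Sum>i\<in>UNIV. h $ i * frechet_derivative f (at x) (axis i 1))"
    using l by (simp add: linear_sum linear_cmul)
  finally show ?thesis .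
qed

section \<open>Radial integrals and Hadamard's lemma\<close>

lemma segment_in_ball:
  fixes a :: "'a::real_normed_vector"
  assumes "x \<in> ball a r" "t \<in> {0..1}"
  shows "a + t *\<^sub>R (x - a) \<in> ball a r"
proof -
  have "norm (t *\<^sub>R (x - a)) \<le> norm (x - a)"
    using assms(2) by (simp add: mult_left_le_one_le)
  then show ?thesis using assms(1) by (simp add: dist_norm norm_minus_commute)
qed

lemma continuous_on_radial:
  fixes f :: "real ^ 'n::finite \<Rightarrow> real"
  assumes "smooth_fun_on (ball a r) f"
  shows "continuous_on (ball a r \<times> {0..1}) (\<lambda>(x, t). t ^ m * f (a + t *\<^sub>R (x - a)))"
proof -
  have "continuous_on (ball a r \<times> {0..1}) (\<lambda>z. f (a + snd z *\<^sub>R (fst z - a)))"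
  proof (rule continuous_on_compose2[OF smooth_fun_on_continuous[OF assms]])
    show "(\<lambda>z. a + snd z *\<^sub>R (fst z - a)) ` (ball a r \<times> {0..1}) \<subseteq> ball a r"
      using segment_in_ball by fastforce
  qed (intro continuous_intros)
  then show ?thesis by (auto simp: case_prod_beta intro!: continuous_intros)
qed

text \<open>Differentiation under the integral sign gives an integral of the same shape:
  \<open>f\<close> is replaced by a partial derivative, and the chain rule contributes one more
  factor \<open>t\<close>. The power \<open>t ^ m\<close> is carried along so that the induction on
  \<open>k\<close> closes; Hadamard's lemma uses \<open>m = 0\<close>.\<close>

lemma Ck_on_radial_integral:
  fixes f :: "real ^ 'n::finite \<Rightarrow> real"
  assumes "smooth_fun_on (ball a r) f"
  shows "Ck_on k (ball a r) (\<lambda>x. integral {0..1} (\<lambda>t. t ^ m * f (a + t *\<^sub>R (x - a))))"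
  using assms
proof (induction k arbitrary: f m)
  case 0
  show ?case
    using integral_continuous_on_param[of "ball a r" 0 "1::real"
        "\<lambda>x t. t ^ m * f (a + t *\<^sub>R (x - a))"] continuous_on_radial[OF 0] by simp
next
  case (Suc k)
  let ?d = "\<lambda>i y. frechet_derivative f (at y) (axis i 1)"
  \<comment> \<open>The derivative of the integrand in \<open>x\<close>, written as a bounded linear
    functional because Leibniz's rule is stated for these.\<close>
  let ?F = "\<lambda>x t. \<Sum>i\<in>UNIV. (t ^ Suc m * ?d i (a + t *\<^sub>R (x - a))) *\<^sub>R blinfun_inner_right (axis i (1::real))"
  have sd: "smooth_fun_on (ball a r) (?d i)" for i
    using Suc.prems by (rule smooth_fun_on_partial)
  have cF: "continuous_on (ball a r \<times> {0..1}) (\<lambda>(x, t). ?F x t)"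
    unfolding case_prod_beta
    by (intro continuous_on_sum continuous_on_scaleR continuous_on_const
        continuous_on_radial[OF sd, of "Suc m", unfolded case_prod_beta])
  have slice: "continuous_on {0..1} (\<lambda>t. h x t)"
    if "x \<in> ball a r" "continuous_on (ball a r \<times> {0..1}) (\<lambda>(x, t). h x t)"
    for x and h :: "_ \<Rightarrow> real \<Rightarrow> 'z::topological_space"
  proof -
    have "continuous_on {0..1} (\<lambda>t. (\<lambda>(x, t). h x t) (x, t))"
      by (rule continuous_on_compose2[OF that(2)]) (use that(1) in \<open>auto intro!: continuous_intros\<close>)
    then show ?thesis by simp
  qed
  note cFx = slice[OF _ cF]
  note cfx = slice[OF _ continuous_on_radial[OF Suc.prems, of m]]
  have der: "((\<lambda>x. integral {0..1} (\<lambda>t. t ^ m * f (a + t *\<^sub>R (x - a))))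
      has_derivative blinfun_apply (integral {0..1} (?F x))) (at x)" if x: "x \<in> ball a r" for x
  proof -
    have "((\<lambda>x. t ^ m * f (a + t *\<^sub>R (x - a))) has_derivative blinfun_apply (?F y t)) (at y within ball a r)"
      if "y \<in> ball a r" "t \<in> cbox 0 1" for y t
    proof -
      let ?y = "a + t *\<^sub>R (y - a)"
      have "?y \<in> ball a r" using segment_in_ball that by auto
      then have h: "(f has_derivative frechet_derivative f (at ?y)) (at ?y)"
        using smooth_fun_on_has_derivative[OF open_ball Suc.prems] by blast
      have "((\<lambda>x. a + t *\<^sub>R (x - a)) has_derivative (\<lambda>h. t *\<^sub>R h)) (at y)"
        by (auto intro!: derivative_eq_intros)
      from has_derivative_compose[OF this h]
      have "((\<lambda>x. t ^ m * f (a + t *\<^sub>R (x - a))) has_derivative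
          (\<lambda>v. t ^ m * frechet_derivative f (at ?y) (t *\<^sub>R v))) (at y)"
        by (intro has_derivative_mult_right)
      moreover have "(\<lambda>v. t ^ m * frechet_derivative f (at ?y) (t *\<^sub>R v)) = blinfun_apply (?F y t)"
      proof
        fix v
        show "t ^ m * frechet_derivative f (at ?y) (t *\<^sub>R v) = blinfun_apply (?F y t) v"
          unfolding frechet_derivative_sum_partials[OF h, of "t *\<^sub>R v"] sum_distrib_left
            blinfun.sum_left blinfun.scaleR_left
          by (rule sum.cong) (simp_all add: inner_axis')
      qed
      ultimately have "((\<lambda>x. t ^ m * f (a + t *\<^sub>R (x - a))) has_derivative blinfun_apply (?F y t)) (at y)"
        by (rule subst[rotated])
      then show ?thesis by (rule has_derivative_at_withinI)
    qed
    then have "((\<lambda>x. integral (cbox 0 1) (\<lambda>t. t ^ m * f (a + t *\<^sub>R (x - a))))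
      has_derivative blinfun_apply (integral (cbox 0 1) (?F x))) (at x within ball a r)"
      by (rule leibniz_rule[of "ball a r" 0 1 _ ?F])
        (use x cF cfx in \<open>auto intro!: integrable_continuous_real simp del: mem_ball\<close>)
    then show ?thesis unfolding at_within_open[OF x open_ball] by simp
  qed
  \<comment> \<open>Evaluation at a basis vector is bounded linear and commutes with the integral.
    The result is a radial integral with exponent \<open>Suc m\<close>, to which the induction
    hypothesis applies.\<close>
  have app: "blinfun_apply (integral {0..1} (?F x)) (axis j 1) =
      integral {0..1} (\<lambda>t. t ^ Suc m * ?d j (a + t *\<^sub>R (x - a)))" if x: "x \<in> ball a r" for x j
  proof -
    have "integral {0..1} ((\<lambda>b. blinfun_apply b (axis j 1)) \<circ> ?F x) =
        blinfun_apply (integral {0..1} (?F x)) (axis j 1)"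
      by (rule integral_linear[OF integrable_continuous_real[OF cFx[OF x]] blinfun.bounded_linear_left])
    moreover have "((\<lambda>b. blinfun_apply b (axis j 1)) \<circ> ?F x) =
        (\<lambda>t. t ^ Suc m * ?d j (a + t *\<^sub>R (x - a)))"
      by (auto simp: fun_eq_iff blinfun.sum_left blinfun.scaleR_left inner_axis_axis if_distrib cong: if_cong)
    ultimately show ?thesis by simp
  qed
  have "Ck_on k (ball a r) (\<lambda>x. blinfun_apply (integral {0..1} (?F x)) (axis i 1))" for i
    by (rule Ck_on_cong[OF open_ball app[symmetric] Suc.IH[OF sd]])
  then show ?case by (rule Ck_on_Suc_I[OF open_ball der, rotated])
qed

text \<open>The fundamental theorem of calculus along the segment from \<open>a\<close> to
  \<open>x\<close> expresses \<open>f x - f a\<close> through the partial derivatives of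
  \<open>f\<close>. The factors \<open>x $ i - a $ i\<close> do not depend on \<open>t\<close> and
  leave the integral; what remains are smooth radial integrals.\<close>

lemma Hadamard:
  fixes f :: "real ^ 'n::finite \<Rightarrow> real"
  assumes "smooth_fun_on (ball a r) f" "r > 0"
  obtains g where "\<And>i. smooth_fun_on (ball a r) (g i)"
    "\<And>x. x \<in> ball a r \<Longrightarrow> f x = f a + (\<Sum>i\<in>UNIV. (x $ i - a $ i) * g i x)"
proof
  let ?d = "\<lambda>i y. frechet_derivative f (at y) (axis i 1)"
  let ?g = "\<lambda>i x. integral {0..1} (\<lambda>t. ?d i (a + t *\<^sub>R (x - a)))"
  have sd: "smooth_fun_on (ball a r) (?d i)" for i
    using assms(1) by (rule smooth_fun_on_partial)
  show "smooth_fun_on (ball a r) (?g i)" for i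
    unfolding smooth_fun_on_def using Ck_on_radial_integral[OF sd, of _ 0 i] by simp
  fix x assume x: "x \<in> ball a r"
  have c: "continuous_on {0..1} (\<lambda>t. ?d i (a + t *\<^sub>R (x - a)))" for i
    by (rule continuous_on_compose2[OF smooth_fun_on_continuous[OF sd]])
      (intro continuous_intros, use segment_in_ball[OF x] in blast)
  have "((\<lambda>t. \<Sum>i\<in>UNIV. (x $ i - a $ i) * ?d i (a + t *\<^sub>R (x - a))) has_integral
      f (a + 1 *\<^sub>R (x - a)) - f (a + 0 *\<^sub>R (x - a))) {0..1}"
  proof (rule fundamental_theorem_of_calculus)
    fix t :: real assume t: "t \<in> {0..1}"
    let ?y = "a + t *\<^sub>R (x - a)"
    have h: "(f has_derivative frechet_derivative f (at ?y)) (at ?y)"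
      using smooth_fun_on_has_derivative[OF open_ball assms(1)] segment_in_ball x t by blast
    have "((\<lambda>t. a + t *\<^sub>R (x - a)) has_derivative (\<lambda>s. s *\<^sub>R (x - a))) (at t)"
      by (auto intro!: derivative_eq_intros)
    from has_derivative_compose[OF this h]
    have "((\<lambda>t. f (a + t *\<^sub>R (x - a))) has_derivative
        (\<lambda>s. frechet_derivative f (at ?y) (s *\<^sub>R (x - a)))) (at t within {0..1})"
      using has_derivative_at_withinI by blast
    moreover have "(\<lambda>s. frechet_derivative f (at ?y) (s *\<^sub>R (x - a))) =
        (\<lambda>s. s *\<^sub>R (\<Sum>i\<in>UNIV. (x $ i - a $ i) * ?d i ?y))"
      by (subst frechet_derivative_sum_partials[OF h]) (simp add: sum_distrib_left algebra_simps)
    ultimately show "((\<lambda>t. f (a + t *\<^sub>R (x - a))) has_vector_derivative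
        (\<Sum>i\<in>UNIV. (x $ i - a $ i) * ?d i ?y)) (at t within {0..1})"
      by (simp add: has_vector_derivative_def)
  qed simp
  then have "f x - f a = integral {0..1} (\<lambda>t. \<Sum>i\<in>UNIV. (x $ i - a $ i) * ?d i (a + t *\<^sub>R (x - a)))"
    by (simp add: integral_unique)
  also have "\<dots> = (\<Sum>i\<in>UNIV. integral {0..1} (\<lambda>t. (x $ i - a $ i) * ?d i (a + t *\<^sub>R (x - a))))"
    by (rule integral_sum[OF finite_class.finite_UNIV])
      (intro integrable_continuous_real continuous_on_mult continuous_on_const c)
  also have "\<dots> = (\<Sum>i\<in>UNIV. (x $ i - a $ i) * ?g i x)"
    by simp
  finally show "f x = f a + (\<Sum>i\<in>UNIV. (x $ i - a $ i) * ?g i x)" by simp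
qed

section \<open>Superfunctions and vector fields\<close>

text \<open>If one parity is even, that factor is central and the sign is trivial; two odd factors
  anticommute. Parities only matter modulo 2, so they are not restricted to 0 and 1.\<close>

lemma supercommute:
  fixes a b :: "'g::supercommutative_algebra"
  assumes "grade_inv a = (-1) ^ k * a" "grade_inv b = (-1) ^ l * b"
  shows "a * b = (-1) ^ (k * l) * (b * a)"
proof (cases "even k \<or> even l")
  case True
  then show ?thesis using assms even_commute[of a b] even_commute[of b a] by auto
next
  case False
  then show ?thesis using assms odd_anticommute[of a b] by auto
qed

text \<open>Anticommuting with itself gives \<open>2 *\<^sub>R (a * a) = 0\<close>, and 2 is
  invertible among the real scalars.\<close>

lemma odd_square_zero:
  fixes a :: "'g::supercommutative_algebra"
  assumes "grade_inv a = - a"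
  shows "a * a = 0"
proof -
  have "a * a = - (a * a)" using odd_anticommute[OF assms assms] .
  then have "2 *\<^sub>R (a * a) = 0" by (metis add.right_inverse scaleR_2)
  then show ?thesis by simp
qed

lemma grade_inv_diff: "grade_inv (a - b :: 'g::supercommutative_algebra) = grade_inv a - grade_inv b"
  by (simp only: diff_conv_add_uminus grade_inv_add grade_inv_minus)

lemma grade_inv_sum: "grade_inv (sum f A :: 'g::supercommutative_algebra) = (\<Sum>a\<in>A. grade_inv (f a))"
  by (induction A rule: infinite_finite_induct) (auto simp: grade_inv_0 grade_inv_add)

lemma grade_inv_of_real: "grade_inv (of_real c :: 'g::supercommutative_algebra) = of_real c"
  by (simp add: of_real_def grade_inv_scaleR grade_inv_1)

lemma neg_one_power_parity: "even k = even l \<Longrightarrow> (-1 :: 'a::ring_1) ^ k = (-1) ^ l"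
  by (cases "even k") auto

lemma sign_commute: "(a :: 'g::supercommutative_algebra) * (-1) ^ k = (-1) ^ k * a"
  by (cases "even k") auto

section \<open>Sections of the structure sheaf\<close>

locale supersheaf =
  fixes \<O> :: "'p::topological_space set \<Rightarrow> ('p, 'g::supercommutative_algebra) sect set"
  assumes sheaf: "structure_sheaf \<O>"
begin

lemma O_mono: "open U \<Longrightarrow> open V \<Longrightarrow> V \<subseteq> U \<Longrightarrow> f \<in> \<O> U \<Longrightarrow> f \<in> \<O> V"
  using sheaf[unfolded structure_sheaf_def, THEN conjunct1] by meson

lemma germ_eq:
  assumes "open U" "p \<in> U" "f \<in> \<O> U" "g \<in> \<O> U" "f p = g p"
  obtains V where "open V" "p \<in> V" "V \<subseteq> U" "\<And>q. q \<in> V \<Longrightarrow> f q = g q"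
  using sheaf[unfolded structure_sheaf_def, THEN conjunct2, THEN conjunct2, THEN conjunct2, THEN conjunct1,
      rule_format, of U p f g] assms by meson

lemma germ_section:
  obtains U f where "open U" "p \<in> U" "f \<in> \<O> U" "f p = a"
proof -
  have "\<exists>U f. open U \<and> p \<in> U \<and> f \<in> \<O> U \<and> f p = a"
    using sheaf[unfolded structure_sheaf_def, THEN conjunct2, THEN conjunct2, THEN conjunct2, THEN conjunct2,
      THEN conjunct1] by (elim allE)
  with that show thesis by blast
qed

lemma O_add: "open U \<Longrightarrow> f \<in> \<O> U \<Longrightarrow> g \<in> \<O> U \<Longrightarrow> (\<lambda>q. f q + g q) \<in> \<O> U"
  and O_mult: "open U \<Longrightarrow> f \<in> \<O> U \<Longrightarrow> g \<in> \<O> U \<Longrightarrow> (\<lambda>q. f q * g q) \<in> \<O> U"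
  and O_grade: "open U \<Longrightarrow> f \<in> \<O> U \<Longrightarrow> (\<lambda>q. grade_inv (f q)) \<in> \<O> U"
  using sheaf[unfolded structure_sheaf_def, THEN conjunct2, THEN conjunct2, THEN conjunct2, THEN conjunct2,
      THEN conjunct2, THEN conjunct1, rule_format] by meson+

lemma O_of_real: "open U \<Longrightarrow> (\<lambda>q. of_real r) \<in> \<O> U"
  using sheaf[unfolded structure_sheaf_def, THEN conjunct2, THEN conjunct2, THEN conjunct2, THEN conjunct2,
      THEN conjunct2, THEN conjunct2, rule_format] by meson

lemma O_0: "open U \<Longrightarrow> (\<lambda>q. 0) \<in> \<O> U" and O_1: "open U \<Longrightarrow> (\<lambda>q. 1) \<in> \<O> U"
  using O_of_real[of U 0] O_of_real[of U 1] by auto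

lemma O_scaleR: "open U \<Longrightarrow> f \<in> \<O> U \<Longrightarrow> (\<lambda>q. c *\<^sub>R f q) \<in> \<O> U"
  using O_mult[OF _ O_of_real[of U c], of f] by (simp add: of_real_def)

lemma O_uminus: "open U \<Longrightarrow> f \<in> \<O> U \<Longrightarrow> (\<lambda>q. - f q) \<in> \<O> U"
  using O_scaleR[of U f "-1"] by simp

lemma O_sign: "open U \<Longrightarrow> f \<in> \<O> U \<Longrightarrow> (\<lambda>q. (-1) ^ k * f q) \<in> \<O> U"
  by (cases "even k") (auto intro: O_uminus)

lemma O_sum: "open U \<Longrightarrow> (\<And>a. a \<in> A \<Longrightarrow> f a \<in> \<O> U) \<Longrightarrow> (\<lambda>q. \<Sum>a\<in>A. f a q) \<in> \<O> U"
  by (induction A rule: infinite_finite_induct) (auto intro: O_0 O_add)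

lemma hom_O: "f \<in> hom_sect \<O> k U \<Longrightarrow> f \<in> \<O> U"
  and hom_grade: "f \<in> hom_sect \<O> k U \<Longrightarrow> q \<in> U \<Longrightarrow> grade_inv (f q) = (-1) ^ k * f q"
  by (simp_all add: hom_sect_def)

lemma hom_I: "f \<in> \<O> U \<Longrightarrow> (\<And>q. q \<in> U \<Longrightarrow> grade_inv (f q) = (-1) ^ k * f q) \<Longrightarrow> f \<in> hom_sect \<O> k U"
  by (simp add: hom_sect_def)

lemma hom_mono: "open U \<Longrightarrow> open V \<Longrightarrow> V \<subseteq> U \<Longrightarrow> f \<in> hom_sect \<O> k U \<Longrightarrow> f \<in> hom_sect \<O> k V"
  by (meson O_mono hom_I hom_O hom_grade subsetD)

lemma hom_parity: "even k = even l \<Longrightarrow> hom_sect \<O> k U = hom_sect \<O> l U"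
  using neg_one_power_parity[of k l, where 'a='g] by (simp add: hom_sect_def)

lemma hom_add:
  "open U \<Longrightarrow> f \<in> hom_sect \<O> k U \<Longrightarrow> g \<in> hom_sect \<O> k U \<Longrightarrow> (\<lambda>q. f q + g q) \<in> hom_sect \<O> k U"
  by (auto intro!: hom_I O_add intro: hom_O
      simp: grade_inv_add hom_grade[of f k U] hom_grade[of g k U] algebra_simps)

lemma hom_mult:
  assumes "open U" "f \<in> hom_sect \<O> k U" "g \<in> hom_sect \<O> l U"
  shows "(\<lambda>q. f q * g q) \<in> hom_sect \<O> (k + l) U"
proof (rule hom_I)
  fix q assume "q \<in> U"
  then show "grade_inv (f q * g q) = (-1) ^ (k + l) * (f q * g q)"
    using assms hom_grade[of f k U q] hom_grade[of g l U q]
    by (cases "even k"; cases "even l") (auto simp: grade_inv_mult)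
qed (use assms in \<open>auto intro: O_mult hom_O\<close>)

lemma hom_0: "open U \<Longrightarrow> (\<lambda>q. 0) \<in> hom_sect \<O> k U"
  by (auto intro!: hom_I O_0 simp: grade_inv_0)

lemma hom_of_real: "open U \<Longrightarrow> (\<lambda>q. of_real c) \<in> hom_sect \<O> 0 U"
  by (auto intro!: hom_I O_of_real simp: grade_inv_of_real)

text \<open>The components are the projections to the eigenspaces of the parity automorphism. The
  splitting extends the Leibniz rule of the bracket from homogeneous to arbitrary second
  factors.\<close>

lemma even_odd_split:
  assumes "open U" "f \<in> \<O> U"
  obtains g h where "g \<in> hom_sect \<O> 0 U" "h \<in> hom_sect \<O> 1 U" "\<And>q. f q = g q + h q"
proof
  let ?g = "\<lambda>q. (1/2) *\<^sub>R (f q + grade_inv (f q))"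
  let ?h = "\<lambda>q. (1/2) *\<^sub>R (f q + - grade_inv (f q))"
  have O: "?g \<in> \<O> U" "?h \<in> \<O> U"
    by (intro O_scaleR O_add O_uminus O_grade assms)+
  show "?g \<in> hom_sect \<O> 0 U"
    by (rule hom_I[OF O(1)])
      (simp add: grade_inv_scaleR grade_inv_add grade_inv_grade_inv add.commute)
  show "?h \<in> hom_sect \<O> 1 U"
    by (rule hom_I[OF O(2)])
      (simp add: grade_inv_scaleR grade_inv_diff grade_inv_grade_inv scaleR_right_diff_distrib)
  show "f q = ?g q + ?h q" for q
    by (simp add: scaleR_add_right[symmetric] flip: scaleR_2)
qed

section \<open>Vector fields as derivations of the sheaf\<close>

context
  fixes U V :: "'p set" and p :: nat and X :: "('p, 'g) vfield"
  assumes vf: "vector_field \<O> U p X" and V: "open V" "V \<subseteq> U"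
begin

lemma vf_O: "f \<in> \<O> V \<Longrightarrow> X f \<in> \<O> V"
  and vf_cong: "f \<in> \<O> V \<Longrightarrow> g \<in> \<O> V \<Longrightarrow> (\<And>q. q \<in> V \<Longrightarrow> f q = g q) \<Longrightarrow> q \<in> V \<Longrightarrow> X f q = X g q"
  and vf_add: "f \<in> \<O> V \<Longrightarrow> g \<in> \<O> V \<Longrightarrow> q \<in> V \<Longrightarrow> X (\<lambda>r. f r + g r) q = X f q + X g q"
  and vf_scaleR: "f \<in> \<O> V \<Longrightarrow> q \<in> V \<Longrightarrow> X (\<lambda>r. c *\<^sub>R f r) q = c *\<^sub>R X f q"
  and vf_hom: "f \<in> hom_sect \<O> k V \<Longrightarrow> X f \<in> hom_sect \<O> (p + k) V"
  and vf_leibniz: "f \<in> hom_sect \<O> k V \<Longrightarrow> g \<in> \<O> V \<Longrightarrow> q \<in> V \<Longrightarrow>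
      X (\<lambda>r. f r * g r) q = X f q * g q + (-1) ^ (p * k) * f q * X g q"
  using vf[unfolded vector_field_def, rule_format, OF conjI[OF V]] by (simp_all only: Ball_def) meson+

lemma vf_0: "q \<in> V \<Longrightarrow> X (\<lambda>r. 0) q = 0"
  using vf_scaleR[OF O_0[OF V(1)], of q 0] by simp

lemma vf_sum:
  "(\<And>a. a \<in> A \<Longrightarrow> f a \<in> \<O> V) \<Longrightarrow> q \<in> V \<Longrightarrow> X (\<lambda>r. \<Sum>a\<in>A. f a r) q = (\<Sum>a\<in>A. X (f a) q)"
proof (induction A rule: infinite_finite_induct)
  case (insert a A)
  then show ?case using vf_add[of "f a" "\<lambda>r. \<Sum>a\<in>A. f a r" q] O_sum[OF V(1), of A f] by simp
qed (auto simp: vf_0)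

end

text \<open>Equal germs come from sections that agree on a neighbourhood, and there the derivation
  respects equality of sections. Thus a vector field acts on germs.\<close>

lemma vf_germ:
  assumes "vector_field \<O> U p X" "open V" "V \<subseteq> U" "f \<in> \<O> V" "g \<in> \<O> V" "q \<in> V" "f q = g q"
  shows "X f q = X g q"
proof -
  obtain W where W: "open W" "q \<in> W" "W \<subseteq> V" "\<And>r. r \<in> W \<Longrightarrow> f r = g r"
    by (rule germ_eq[OF assms(2,6,4,5,7)]) blast
  then have "W \<subseteq> U" using assms(3) by blast
  show ?thesis
    by (rule vf_cong[OF assms(1) W(1) \<open>W \<subseteq> U\<close> O_mono[OF assms(2) W(1,3) assms(4)]
        O_mono[OF assms(2) W(1,3) assms(5)] W(4,2)])
qed

lemma vf_restrict: "vector_field \<O> U p X \<Longrightarrow> V \<subseteq> U \<Longrightarrow> vector_field \<O> V p X"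
  unfolding vector_field_def by (meson subset_trans)

lemma vector_fieldI:
  assumes "\<And>V f. open V \<Longrightarrow> V \<subseteq> U \<Longrightarrow> f \<in> \<O> V \<Longrightarrow> X f \<in> \<O> V"
    and "\<And>V f g q. open V \<Longrightarrow> V \<subseteq> U \<Longrightarrow> f \<in> \<O> V \<Longrightarrow> g \<in> \<O> V \<Longrightarrow> \<forall>q\<in>V. f q = g q \<Longrightarrow> q \<in> V \<Longrightarrow>
      X f q = X g q"
    and "\<And>V f g q. open V \<Longrightarrow> V \<subseteq> U \<Longrightarrow> f \<in> \<O> V \<Longrightarrow> g \<in> \<O> V \<Longrightarrow> q \<in> V \<Longrightarrow>
      X (\<lambda>r. f r + g r) q = X f q + X g q"
    and "\<And>V f c q. open V \<Longrightarrow> V \<subseteq> U \<Longrightarrow> f \<in> \<O> V \<Longrightarrow> q \<in> V \<Longrightarrow> X (\<lambda>r. c *\<^sub>R f r) q = c *\<^sub>R X f q"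
    and "\<And>V k f. open V \<Longrightarrow> V \<subseteq> U \<Longrightarrow> f \<in> hom_sect \<O> k V \<Longrightarrow> X f \<in> hom_sect \<O> (p + k) V"
    and "\<And>V k f g q. open V \<Longrightarrow> V \<subseteq> U \<Longrightarrow> f \<in> hom_sect \<O> k V \<Longrightarrow> g \<in> \<O> V \<Longrightarrow> q \<in> V \<Longrightarrow>
      X (\<lambda>r. f r * g r) q = X f q * g q + (-1) ^ (p * k) * f q * X g q"
  shows "vector_field \<O> U p X"
  unfolding vector_field_def
proof (intro allI impI, elim conjE, intro conjI ballI allI impI)
  fix V assume V: "open V" "V \<subseteq> U"
  note a = assms[OF V]
  show "X f \<in> \<O> V" if "f \<in> \<O> V" for f by (rule a(1)[OF that])
  show "X f q = X g q" if "f \<in> \<O> V" "g \<in> \<O> V" "\<forall>q\<in>V. f q = g q" "q \<in> V" for f g q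
    by (rule a(2)[OF that])
  show "X (\<lambda>r. f r + g r) q = X f q + X g q" if "f \<in> \<O> V" "g \<in> \<O> V" "q \<in> V" for f g q
    by (rule a(3)[OF that])
  show "X (\<lambda>r. c *\<^sub>R f r) q = c *\<^sub>R X f q" if "f \<in> \<O> V" "q \<in> V" for f c q
    by (rule a(4)[OF that])
  show "X f \<in> hom_sect \<O> (p + k) V" if "f \<in> hom_sect \<O> k V" for f k
    by (rule a(5)[OF that])
  show "X (\<lambda>r. f r * g r) q = X f q * g q + (-1) ^ (p * k) * f q * X g q"
    if "f \<in> hom_sect \<O> k V" "g \<in> \<O> V" "q \<in> V" for f g k q
    by (rule a(6)[OF that])
qed

text \<open>Parities of products and compositions arise as sums of natural numbers; the signs and
  the homogeneous sections see only their class modulo 2.\<close>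

lemma vf_parity:
  assumes "even p = even p'"
  shows "vector_field \<O> U p X \<longleftrightarrow> vector_field \<O> U p' X"
proof -
  have "(-1::'g) ^ (p * k) = (-1) ^ (p' * k)" for k
    using assms by (intro neg_one_power_parity) auto
  moreover have "hom_sect \<O> (p + k) V = hom_sect \<O> (p' + k) V" for k V
    using assms by (intro hom_parity) auto
  ultimately show ?thesis unfolding vector_field_def by (simp only:)
qed

lemma vf_zero: "open U \<Longrightarrow> vector_field \<O> U p (\<lambda>f q. 0)"
  by (rule vector_fieldI) (auto intro: O_0 hom_0)

lemma vf_add_field:
  assumes "vector_field \<O> U p X" "vector_field \<O> U p Y"
  shows "vector_field \<O> U p (add_field X Y)"
proof (rule vector_fieldI)
  fix V assume V: "open V" "V \<subseteq> U"
  note X = vf_O[OF assms(1) V] vf_cong[OF assms(1) V] vf_add[OF assms(1) V] vf_scaleR[OF assms(1) V]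
    vf_hom[OF assms(1) V] vf_leibniz[OF assms(1) V]
  note Y = vf_O[OF assms(2) V] vf_cong[OF assms(2) V] vf_add[OF assms(2) V] vf_scaleR[OF assms(2) V]
    vf_hom[OF assms(2) V] vf_leibniz[OF assms(2) V]
  show "add_field X Y f \<in> \<O> V" if "f \<in> \<O> V" for f
    unfolding add_field_def by (intro O_add V X(1) Y(1) that)
  show "add_field X Y f q = add_field X Y g q"
    if "f \<in> \<O> V" "g \<in> \<O> V" "\<forall>q\<in>V. f q = g q" "q \<in> V" for f g q
    unfolding add_field_def using X(2)[OF that(1,2) bspec[OF that(3)] that(4)]
      Y(2)[OF that(1,2) bspec[OF that(3)] that(4)] by simp
  show "add_field X Y (\<lambda>r. f r + g r) q = add_field X Y f q + add_field X Y g q"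
    if "f \<in> \<O> V" "g \<in> \<O> V" "q \<in> V" for f g q
    unfolding add_field_def X(3)[OF that] Y(3)[OF that] by simp
  show "add_field X Y (\<lambda>r. c *\<^sub>R f r) q = c *\<^sub>R add_field X Y f q" if "f \<in> \<O> V" "q \<in> V" for f c q
    unfolding add_field_def X(4)[OF that] Y(4)[OF that] by (simp add: scaleR_right_distrib)
  show "add_field X Y f \<in> hom_sect \<O> (p + k) V" if "f \<in> hom_sect \<O> k V" for f k
    unfolding add_field_def by (intro hom_add V X(5) Y(5) that)
  show "add_field X Y (\<lambda>r. f r * g r) q = add_field X Y f q * g q + (-1) ^ (p * k) * f q * add_field X Y g q"
    if "f \<in> hom_sect \<O> k V" "g \<in> \<O> V" "q \<in> V" for f g k q
    unfolding add_field_def X(6)[OF that] Y(6)[OF that] by (simp add: algebra_simps)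
qed

lemma vf_scale_field:
  assumes "open U" "vector_field \<O> U p X" "h \<in> hom_sect \<O> l U"
  shows "vector_field \<O> U (l + p) (scale_field h X)"
proof (rule vector_fieldI)
  fix V assume V: "open V" "V \<subseteq> U"
  note X = vf_O[OF assms(2) V] vf_cong[OF assms(2) V] vf_add[OF assms(2) V] vf_scaleR[OF assms(2) V]
    vf_hom[OF assms(2) V] vf_leibniz[OF assms(2) V]
  have h: "h \<in> hom_sect \<O> l V" by (rule hom_mono[OF assms(1) V assms(3)])
  show "scale_field h X f \<in> \<O> V" if "f \<in> \<O> V" for f
    unfolding scale_field_def by (intro O_mult V X(1) that hom_O[OF h])
  show "scale_field h X f q = scale_field h X g q"
    if "f \<in> \<O> V" "g \<in> \<O> V" "\<forall>q\<in>V. f q = g q" "q \<in> V" for f g q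
    unfolding scale_field_def using X(2)[OF that(1,2) bspec[OF that(3)] that(4)] by simp
  show "scale_field h X (\<lambda>r. f r + g r) q = scale_field h X f q + scale_field h X g q"
    if "f \<in> \<O> V" "g \<in> \<O> V" "q \<in> V" for f g q
    unfolding scale_field_def X(3)[OF that] by (simp add: algebra_simps)
  show "scale_field h X (\<lambda>r. c *\<^sub>R f r) q = c *\<^sub>R scale_field h X f q" if "f \<in> \<O> V" "q \<in> V" for f c q
    unfolding scale_field_def X(4)[OF that] by simp
  show "scale_field h X f \<in> hom_sect \<O> (l + p + k) V" if "f \<in> hom_sect \<O> k V" for f k
    unfolding scale_field_def using hom_mult[OF V(1) h X(5)[OF that]] by (simp add: add.assoc)
  show "scale_field h X (\<lambda>r. f r * g r) q =
      scale_field h X f q * g q + (-1) ^ ((l + p) * k) * f q * scale_field h X g q"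
    if "f \<in> hom_sect \<O> k V" "g \<in> \<O> V" "q \<in> V" for f g k q
  proof -
    \<comment> \<open>Moving \<open>f\<close> past the coefficient \<open>h\<close> costs
      \<open>(-1) ^ (l * k)\<close>, which together with \<open>(-1) ^ (p * k)\<close> is the sign
      for a derivation of parity \<open>l + p\<close>.\<close>
    have c: "h q * f q = (-1) ^ (l * k) * (f q * h q)"
      using supercommute[OF hom_grade[OF h that(3)] hom_grade[OF that(1,3)]] .
    have "h q * ((-1) ^ (p * k) * f q * X g q) = (-1) ^ (p * k) * ((h q * f q) * X g q)"
      by (simp add: mult.assoc[symmetric] sign_commute[of "h q"])
    also have "\<dots> = (-1) ^ ((l + p) * k) * f q * (h q * X g q)"
      unfolding c by (simp add: mult.assoc[symmetric] power_add distrib_right sign_commute[of "(-1) ^ (l * k)"])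
    finally show ?thesis
      unfolding scale_field_def X(6)[OF that] by (simp add: distrib_left mult.assoc)
  qed
qed

lemma vf_comb_field:
  assumes "open U" "finite S" "\<And>A. A \<in> S \<Longrightarrow> a A \<in> hom_sect \<O> (k A) U"
    "\<And>A. A \<in> S \<Longrightarrow> vector_field \<O> U (m A) (b A)" "\<And>A. A \<in> S \<Longrightarrow> even (k A + m A) = even p"
  shows "vector_field \<O> U p (comb_field S a b)"
  using assms(2-)
proof (induction S rule: finite_induct)
  case empty
  show ?case unfolding comb_field_def using vf_zero[OF assms(1)] by simp
next
  case (insert A S)
  have "vector_field \<O> U (k A + m A) (scale_field (a A) (b A))"
    by (rule vf_scale_field[OF assms(1)]) (use insert.prems in blast)+
  then have "vector_field \<O> U p (scale_field (a A) (b A))"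
    using vf_parity insert.prems(3)[of A] by blast
  moreover have "vector_field \<O> U p (comb_field S a b)"
    by (rule insert.IH) (use insert.prems in blast)+
  ultimately have "vector_field \<O> U p (add_field (scale_field (a A) (b A)) (comb_field S a b))"
    by (rule vf_add_field)
  moreover have "add_field (scale_field (a A) (b A)) (comb_field S a b) = comb_field (insert A S) a b"
    unfolding add_field_def scale_field_def comb_field_def using insert.hyps by simp
  ultimately show ?case by simp
qed

lemma vf_sub_field:
  assumes "open U" "vector_field \<O> U p X" "vector_field \<O> U p Y"
  shows "vector_field \<O> U p (sub_field X Y)"
proof -
  have "vector_field \<O> U (0 + p) (scale_field (\<lambda>q. of_real (-1)) Y)"
    by (rule vf_scale_field[OF assms(1,3) hom_of_real[OF assms(1)]])
  then have "vector_field \<O> U p (add_field X (scale_field (\<lambda>q. of_real (-1)) Y))"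
    using vf_add_field[OF assms(2)] by simp
  moreover have "add_field X (scale_field (\<lambda>q. of_real (-1)) Y) = sub_field X Y"
    unfolding add_field_def scale_field_def sub_field_def by simp
  ultimately show ?thesis by simp
qed

end

section \<open>Charts\<close>

locale super_chart = supersheaf \<O>
  for \<O> :: "'p::topological_space set \<Rightarrow> ('p, 'g::supercommutative_algebra) sect set" +
  fixes U :: "'p set" and \<phi> :: "'p \<Rightarrow> 'n::{finite,linorder} coord_space"
    and \<iota> :: "('n coord_space \<Rightarrow> real) \<Rightarrow> ('p, 'g) sect" and \<theta> :: "'n \<Rightarrow> ('p, 'g) sect"
  assumes chart: "chart \<O> U \<phi> \<iota> \<theta>"
begin

abbreviation z :: "'n + 'n \<Rightarrow> ('p, 'g) sect" where "z \<equiv> coords \<iota> \<theta>"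

lemma chart_open: "open U"
  and chart_homeo: "\<exists>\<psi>. homeomorphism U (\<phi> ` U) \<phi> \<psi>"
  and chart_image: "open (\<phi> ` U)"
  and theta_hom: "\<theta> i \<in> hom_sect \<O> 1 U"
  using chart unfolding chart_def by blast+

lemma open_image:
  assumes "open V" "V \<subseteq> U"
  shows "open (\<phi> ` V)"
proof -
  obtain \<psi> where "homeomorphism U (\<phi> ` U) \<phi> \<psi>" using chart_homeo by blast
  moreover have "openin (top_of_set U) V" using assms by (simp add: openin_open_eq chart_open)
  ultimately have "openin (top_of_set (\<phi> ` U)) (\<phi> ` V)" by (rule homeomorphism_imp_open_map)
  then show ?thesis using chart_image openin_open_trans by blast
qed

lemma continuous_chart: "continuous_on U \<phi>"
  using chart_homeo by (auto simp: homeomorphism_def)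

context
  fixes V assumes V: "open V" "V \<subseteq> U"
begin

lemma iota_hom: "smooth_fun_on (\<phi> ` V) f \<Longrightarrow> \<iota> f \<in> hom_sect \<O> 0 V"
  and iota_add: "smooth_fun_on (\<phi> ` V) f \<Longrightarrow> smooth_fun_on (\<phi> ` V) g \<Longrightarrow> q \<in> V \<Longrightarrow>
      \<iota> (\<lambda>x. f x + g x) q = \<iota> f q + \<iota> g q"
  and iota_mult: "smooth_fun_on (\<phi> ` V) f \<Longrightarrow> smooth_fun_on (\<phi> ` V) g \<Longrightarrow> q \<in> V \<Longrightarrow>
      \<iota> (\<lambda>x. f x * g x) q = \<iota> f q * \<iota> g q"
  and iota_cong: "smooth_fun_on (\<phi> ` V) f \<Longrightarrow> smooth_fun_on (\<phi> ` V) g \<Longrightarrow>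
      (\<And>x. x \<in> \<phi> ` V \<Longrightarrow> f x = g x) \<Longrightarrow> q \<in> V \<Longrightarrow> \<iota> f q = \<iota> g q"
  and iota_const: "q \<in> V \<Longrightarrow> \<iota> (\<lambda>x. r) q = of_real r"
  and expand_ex: "s \<in> \<O> V \<Longrightarrow> \<exists>F. (\<forall>I. smooth_fun_on (\<phi> ` V) (F I)) \<and>
        (\<forall>q\<in>V. s q = (\<Sum>I\<in>UNIV. \<iota> (F I) q * odd_monomial \<theta> I q))"
  and expand_0: "(\<And>I. smooth_fun_on (\<phi> ` V) (F I)) \<Longrightarrow>
        (\<And>q. q \<in> V \<Longrightarrow> (\<Sum>I\<in>UNIV. \<iota> (F I) q * odd_monomial \<theta> I q) = 0) \<Longrightarrow>
        x \<in> \<phi> ` V \<Longrightarrow> F I x = 0"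
  using chart[unfolded chart_def, THEN conjunct2, THEN conjunct2, THEN conjunct2, THEN conjunct2,
    THEN spec, THEN mp, OF conjI[OF V]] by meson+

lemma iota_sum:
  "finite K \<Longrightarrow> (\<And>k. k \<in> K \<Longrightarrow> smooth_fun_on (\<phi> ` V) (f k)) \<Longrightarrow> q \<in> V \<Longrightarrow>
    \<iota> (\<lambda>x. \<Sum>k\<in>K. f k x) q = (\<Sum>k\<in>K. \<iota> (f k) q)"
proof (induction K rule: finite_induct)
  case empty
  then show ?case using iota_const[of q 0] by simp
next
  case (insert k K)
  have "smooth_fun_on (\<phi> ` V) (\<lambda>x. \<Sum>k\<in>K. f k x)"
    by (rule smooth_fun_on_sum[OF insert.hyps(1) open_image[OF V]]) (use insert.prems in blast)
  then have "\<iota> (\<lambda>x. f k x + (\<Sum>k\<in>K. f k x)) q = \<iota> (f k) q + \<iota> (\<lambda>x. \<Sum>k\<in>K. f k x) q"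
    by (intro iota_add insert.prems) simp
  also have "\<iota> (\<lambda>x. \<Sum>k\<in>K. f k x) q = (\<Sum>k\<in>K. \<iota> (f k) q)"
    by (rule insert.IH) (use insert.prems in blast)+
  finally show ?case using insert.hyps by simp
qed

text \<open>The chart asserts uniqueness for expansions of zero. Since \<open>\<iota>\<close> is
  additive and multiplicative and sends constants to constants, this applies to the differences of
  the coefficients.\<close>

lemma expand_unique:
  assumes F: "\<And>I. smooth_fun_on (\<phi> ` V) (F I)" and G: "\<And>I. smooth_fun_on (\<phi> ` V) (G I)"
    and eq: "\<And>q. q \<in> V \<Longrightarrow> (\<Sum>I\<in>UNIV. \<iota> (F I) q * odd_monomial \<theta> I q) =
      (\<Sum>I\<in>UNIV. \<iota> (G I) q * odd_monomial \<theta> I q)"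
    and x: "x \<in> \<phi> ` V"
  shows "F I x = G I x"
proof -
  have m: "smooth_fun_on (\<phi> ` V) (\<lambda>x. (-1) * G I x)" for I
    by (intro smooth_fun_on_mult smooth_fun_on_const open_image[OF V] G)
  have "F I x + (-1) * G I x = 0"
  proof (rule expand_0[where F = "\<lambda>I x. F I x + (-1) * G I x", OF _ _ x])
    show "smooth_fun_on (\<phi> ` V) (\<lambda>x. F I x + (-1) * G I x)" for I
      by (intro smooth_fun_on_add F m open_image[OF V])
    fix q assume q: "q \<in> V"
    have "\<iota> (\<lambda>x. F I x + (-1) * G I x) q = \<iota> (F I) q - \<iota> (G I) q" for I
      unfolding iota_add[OF F m q] iota_mult[OF smooth_fun_on_const[OF open_image[OF V]] G q] iota_const[OF q]
      by simp
    then show "(\<Sum>I\<in>UNIV. \<iota> (\<lambda>x. F I x + (-1) * G I x) q * odd_monomial \<theta> I q) = 0"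
      using eq[OF q] by (simp only: left_diff_distrib sum_subtractf) simp
  qed
  then show ?thesis by simp
qed

end

lemma coords_hom: "z A \<in> hom_sect \<O> (par A) U"
proof (cases A)
  case (Inl a)
  have "smooth_fun_on (\<phi> ` U) (\<lambda>x. x $ a)" by (rule smooth_fun_on_component[OF chart_image])
  then show ?thesis using iota_hom[OF chart_open subset_refl] Inl by (simp add: coords_def)
next
  case (Inr a)
  then show ?thesis using theta_hom by (simp add: coords_def)
qed

text \<open>Near a point \<open>a\<close> of the image, Hadamard's lemma writes \<open>f\<close> as
  a constant plus a sum of products of \<open>x $ i - a $ i\<close> with smooth functions. The
  derivation \<open>E\<close> kills constants and coordinates, so in what is left of
  \<open>E (\<iota> f)\<close> each term keeps a factor \<open>x $ i - a $ i\<close>. Hence every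
  Grassmann coefficient of \<open>E (\<iota> f)\<close> vanishes at \<open>a\<close>; as
  \<open>a\<close> is arbitrary, the coefficients vanish identically.\<close>

lemma derivation_iota_zero:
  assumes vf: "vector_field \<O> W p E" and W: "open W" "W \<subseteq> U"
    and z: "\<And>A q. q \<in> W \<Longrightarrow> E (z A) q = 0"
    and V: "open V" "V \<subseteq> W" and f: "smooth_fun_on (\<phi> ` V) f" and q: "q \<in> V"
  shows "E (\<iota> f) q = 0"
proof -
  have VU: "V \<subseteq> U" using V W by blast
  have iV: "\<iota> f \<in> \<O> V" by (rule hom_O[OF iota_hom[OF V(1) VU f]])
  obtain F where F: "\<And>I. smooth_fun_on (\<phi> ` V) (F I)"
    "\<And>q. q \<in> V \<Longrightarrow> E (\<iota> f) q = (\<Sum>I\<in>UNIV. \<iota> (F I) q * odd_monomial \<theta> I q)"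
    using expand_ex[OF V(1) VU vf_O[OF vf V iV]] by blast
  have F0: "F I (\<phi> v) = 0" if v: "v \<in> V" for I v
  proof -
    define a where "a = \<phi> v"
    have "a \<in> \<phi> ` V" using v unfolding a_def by blast
    then obtain r where r: "r > 0" "ball a r \<subseteq> \<phi> ` V"
      using open_image[OF V(1) VU] open_contains_ball by blast
    \<comment> \<open>Hadamard's lemma is available on a ball. As the ball lies in the image of
      \<open>V\<close>, its preimage \<open>N\<close> is mapped onto it.\<close>
    define N where "N = V \<inter> \<phi> -` ball a r"
    have N: "open N"
      unfolding N_def
      by (rule continuous_open_preimage[OF continuous_on_subset[OF continuous_chart VU] V(1) open_ball])
    have NV: "N \<subseteq> V" and NU: "N \<subseteq> U" and NW: "N \<subseteq> W" using VU V(2) unfolding N_def by blast+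
    have im: "\<phi> ` N = ball a r" using r(2) unfolding N_def by blast
    obtain g where g: "\<And>i. smooth_fun_on (ball a r) (g i)"
      "\<And>x. x \<in> ball a r \<Longrightarrow> f x = f a + (\<Sum>i\<in>UNIV. (x $ i - a $ i) * g i x)"
      using Hadamard[of a r f] smooth_fun_on_subset[OF f r(2)] r(1) by blast
    note g' = g(1)[folded im]
    let ?d = "\<lambda>i x. x $ i + - a $ i"
    have oN: "open (\<phi> ` N)" using im by simp
    have d: "smooth_fun_on (\<phi> ` N) (?d i)" for i
      by (intro smooth_fun_on_add smooth_fun_on_component smooth_fun_on_const oN)
    have dg: "smooth_fun_on (\<phi> ` N) (\<lambda>x. ?d i x * g i x)" for i
      by (intro smooth_fun_on_mult d g' oN)
    have sdg: "smooth_fun_on (\<phi> ` N) (\<lambda>x. \<Sum>i\<in>UNIV. ?d i x * g i x)"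
      by (rule smooth_fun_on_sum[OF _ oN dg]) simp
    have c: "smooth_fun_on (\<phi> ` N) (\<lambda>x. f a)" by (rule smooth_fun_on_const[OF oN])
    have dz: "\<iota> (?d i) n = z (Inl i) n + of_real (- a $ i)" if "n \<in> N" for i n
      unfolding iota_add[OF N NU smooth_fun_on_component[OF oN, of i] smooth_fun_on_const[OF oN] that]
        iota_const[OF N NU that] coords_def by simp
    have fexp: "\<iota> f n = of_real (f a) + (\<Sum>i\<in>UNIV. \<iota> (?d i) n * \<iota> (g i) n)" if n: "n \<in> N" for n
    proof -
      have "\<iota> f n = \<iota> (\<lambda>x. f a + (\<Sum>i\<in>UNIV. ?d i x * g i x)) n"
        by (rule iota_cong[OF N NU smooth_fun_on_subset[OF f] smooth_fun_on_add[OF oN c sdg] _ n])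
          (use NV g(2) im r(2) in auto)
      also have "\<dots> = of_real (f a) + (\<Sum>i\<in>UNIV. \<iota> (\<lambda>x. ?d i x * g i x) n)"
        unfolding iota_add[OF N NU c sdg n] iota_const[OF N NU n]
        by (subst iota_sum[OF N NU _ dg n]) simp_all
      also have "\<dots> = of_real (f a) + (\<Sum>i\<in>UNIV. \<iota> (?d i) n * \<iota> (g i) n)"
        unfolding iota_mult[OF N NU d g' n] ..
      finally show ?thesis .
    qed
    have gO: "\<iota> (g i) \<in> \<O> N" for i by (rule hom_O[OF iota_hom[OF N NU g']])
    have dh: "\<iota> (?d i) \<in> hom_sect \<O> 0 N" for i by (rule iota_hom[OF N NU d])
    have dgO: "(\<lambda>n. \<iota> (?d i) n * \<iota> (g i) n) \<in> \<O> N" for i by (rule O_mult[OF N hom_O[OF dh] gO])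
    \<comment> \<open>The Leibniz rule for \<open>1 * 1\<close> says that \<open>E 1\<close> equals
      its own double.\<close>
    have Ec: "E (\<lambda>n. of_real c) n = 0" if "n \<in> N" for c n
    proof -
      have o: "(\<lambda>n. 1) \<in> hom_sect \<O> 0 N" using hom_of_real[OF N, of 1] by simp
      have "E (\<lambda>n. 1 * 1) n = E (\<lambda>n. 1) n * 1 + (-1) ^ (p * 0) * 1 * E (\<lambda>n. 1) n"
        by (rule vf_leibniz[OF vf N NW o O_1[OF N] that])
      then have "E (\<lambda>n. 1) n = 0" by simp
      then show ?thesis
        using vf_scaleR[OF vf N NW O_1[OF N] that, of c] by (simp add: of_real_def)
    qed
    have zO: "z (Inl i) \<in> \<O> N" for i by (rule O_mono[OF chart_open N NU hom_O[OF coords_hom]])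
    have Ed: "E (\<iota> (?d i)) n = 0" if n: "n \<in> N" for i n
    proof -
      have "E (\<iota> (?d i)) n = E (\<lambda>n. z (Inl i) n + of_real (- a $ i)) n"
        by (rule vf_cong[OF vf N NW hom_O[OF dh] O_add[OF N zO O_of_real[OF N]] dz n])
      also have "\<dots> = 0"
        unfolding vf_add[OF vf N NW zO O_of_real[OF N] n] Ec[OF n] using z NW n by auto
      finally show ?thesis .
    qed
    obtain G where G: "\<And>i I. smooth_fun_on (\<phi> ` N) (G i I)"
      "\<And>i q. q \<in> N \<Longrightarrow> E (\<iota> (g i)) q = (\<Sum>I\<in>UNIV. \<iota> (G i I) q * odd_monomial \<theta> I q)"
      using expand_ex[OF N NU vf_O[OF vf N NW gO]] by metis
    have sG: "smooth_fun_on (\<phi> ` N) (\<lambda>x. \<Sum>i\<in>UNIV. ?d i x * G i I x)" for I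
      by (intro smooth_fun_on_sum smooth_fun_on_mult d G(1) oN) simp
    \<comment> \<open>Comparison of the Grassmann coefficients of two expansions of
      \<open>E (\<iota> f)\<close> on \<open>N\<close>. At the centre \<open>a\<close> the
      right-hand side is zero, because every \<open>?d i a\<close> is.\<close>
    have "F I a = (\<Sum>i\<in>UNIV. ?d i a * G i I a)"
    proof (rule expand_unique[OF N NU smooth_fun_on_subset[OF F(1)] sG])
      show "\<phi> ` N \<subseteq> \<phi> ` V" using NV by blast
      show "a \<in> \<phi> ` N" unfolding im using r by simp
      fix n assume n: "n \<in> N"
      have "(\<Sum>I\<in>UNIV. \<iota> (F I) n * odd_monomial \<theta> I n) = E (\<iota> f) n"
        using F(2) NV n by auto
      also have "\<dots> = E (\<lambda>n. of_real (f a) + (\<Sum>i\<in>UNIV. \<iota> (?d i) n * \<iota> (g i) n)) n"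
        by (rule vf_cong[OF vf N NW O_mono[OF V(1) N NV iV] O_add[OF N O_of_real[OF N] O_sum[OF N dgO]] fexp n])
      also have "\<dots> = (\<Sum>i\<in>UNIV. E (\<lambda>n. \<iota> (?d i) n * \<iota> (g i) n) n)"
        unfolding vf_add[OF vf N NW O_of_real[OF N] O_sum[OF N dgO] n] Ec[OF n]
          vf_sum[OF vf N NW dgO n] by simp
      also have "\<dots> = (\<Sum>i\<in>UNIV. \<iota> (?d i) n * E (\<iota> (g i)) n)"
        unfolding vf_leibniz[OF vf N NW dh gO n] Ed[OF n] by simp
      also have "\<dots> = (\<Sum>I\<in>UNIV. \<Sum>i\<in>UNIV. \<iota> (?d i) n * (\<iota> (G i I) n * odd_monomial \<theta> I n))"
        unfolding G(2)[OF n] sum_distrib_left by (rule sum.swap)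
      also have "\<dots> = (\<Sum>I\<in>UNIV. \<iota> (\<lambda>x. \<Sum>i\<in>UNIV. ?d i x * G i I x) n * odd_monomial \<theta> I n)"
        unfolding iota_sum[OF N NU finite_class.finite_UNIV smooth_fun_on_mult[OF oN d G(1)] n]
          iota_mult[OF N NU d G(1) n] by (simp only: sum_distrib_right mult.assoc)
      finally show "(\<Sum>I\<in>UNIV. \<iota> (F I) n * odd_monomial \<theta> I n) =
        (\<Sum>I\<in>UNIV. \<iota> (\<lambda>x. \<Sum>i\<in>UNIV. ?d i x * G i I x) n * odd_monomial \<theta> I n)" .
    qed
    then show ?thesis unfolding a_def by simp
  qed
  have "\<iota> (F I) q = 0" for I
    using iota_cong[OF V(1) VU F(1) smooth_fun_on_const[OF open_image[OF V(1) VU], of 0] _ q, of I]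
      iota_const[OF V(1) VU q, of 0] F0 by auto
  then show ?thesis using F(2)[OF q] by simp
qed

text \<open>A superfunction is a finite sum of products of some \<open>\<iota> (F I)\<close> with a
  monomial in the odd coordinates. The first factor is killed by
  \<open>derivation_iota_zero\<close>, the second by the Leibniz rule applied along the list of its
  factors.\<close>

lemma derivation_zero:
  assumes vf: "vector_field \<O> W p E" and W: "open W" "W \<subseteq> U"
    and z: "\<And>A q. q \<in> W \<Longrightarrow> E (z A) q = 0"
    and V: "open V" "V \<subseteq> W" and s: "s \<in> \<O> V" and q: "q \<in> V"
  shows "E s q = 0"
proof -
  have VU: "V \<subseteq> U" using V W by blast
  obtain F where F: "\<And>I. smooth_fun_on (\<phi> ` V) (F I)"
    "\<And>q. q \<in> V \<Longrightarrow> s q = (\<Sum>I\<in>UNIV. \<iota> (F I) q * odd_monomial \<theta> I q)"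
    using expand_ex[OF V(1) VU s] by blast
  have th: "\<theta> i \<in> hom_sect \<O> 1 V" for i by (rule hom_mono[OF chart_open V(1) VU theta_hom])
  \<comment> \<open>Membership in the sheaf is proved along with the vanishing, since the Leibniz
    rule in the induction step requires it.\<close>
  have pl: "(\<lambda>q. prod_list (map (\<lambda>i. \<theta> i q) xs)) \<in> \<O> V \<and>
      E (\<lambda>q. prod_list (map (\<lambda>i. \<theta> i q) xs)) q = 0" for xs
  proof (induction xs)
    case Nil
    have o: "(\<lambda>n. 1) \<in> hom_sect \<O> 0 V" using hom_of_real[OF V(1), of 1] by simp
    have "E (\<lambda>n. 1 * 1) q = E (\<lambda>n. 1) q * 1 + (-1) ^ (p * 0) * 1 * E (\<lambda>n. 1) q"
      by (rule vf_leibniz[OF vf V o O_1[OF V(1)] q])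
    then show ?case using O_1[OF V(1)] by simp
  next
    case (Cons i xs)
    have "E (\<theta> i) q = 0" using z[of q "Inr i"] q V(2) by (auto simp: coords_def)
    then show ?case
      using Cons.IH vf_leibniz[OF vf V th conjunct1[OF Cons.IH] q] O_mult[OF V(1) hom_O[OF th] conjunct1[OF Cons.IH]]
      by simp
  qed
  have m: "odd_monomial \<theta> I \<in> \<O> V" "E (odd_monomial \<theta> I) q = 0" for I
    using pl[of "sorted_list_of_set I"] by (simp_all add: odd_monomial_def[abs_def])
  have iF: "\<iota> (F I) \<in> hom_sect \<O> 0 V" for I by (rule iota_hom[OF V(1) VU F(1)])
  have t: "(\<lambda>q. \<iota> (F I) q * odd_monomial \<theta> I q) \<in> \<O> V" for I
    by (rule O_mult[OF V(1) hom_O[OF iF] m(1)])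
  have e: "E (\<iota> (F I)) q = 0" for I
    by (rule derivation_iota_zero[OF vf W z V F(1) q])
  have "E s q = E (\<lambda>q. \<Sum>I\<in>UNIV. \<iota> (F I) q * odd_monomial \<theta> I q) q"
    by (rule vf_cong[OF vf V s O_sum[OF V(1) t] F(2) q])
  also have "\<dots> = (\<Sum>I\<in>UNIV. E (\<lambda>q. \<iota> (F I) q * odd_monomial \<theta> I q) q)"
    by (rule vf_sum[OF vf V t q])
  also have "\<dots> = 0"
    unfolding vf_leibniz[OF vf V iF m(1) q] m(2) e by simp
  finally show ?thesis .
qed

text \<open>The difference of \<open>X\<close> and its proposed expansion is a derivation vanishing
  on all coordinates, hence zero by \<open>derivation_zero\<close>.\<close>

lemma field_expand:
  assumes D: "coord_fields \<O> U z D" and X: "vector_field \<O> V p X" and V: "open V" "V \<subseteq> U"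
    and f: "f \<in> \<O> V" and q: "q \<in> V"
  shows "X f q = (\<Sum>A\<in>UNIV. X (z A) q * D A f q)"
proof -
  have vD: "vector_field \<O> V (par A) (D A)" for A
    using D V(2) vf_restrict unfolding coord_fields_def by blast
  have zV: "z A \<in> hom_sect \<O> (par A) V" for A by (rule hom_mono[OF chart_open V coords_hom])
  have c: "vector_field \<O> V p (comb_field UNIV (\<lambda>A. X (z A)) D)"
    by (rule vf_comb_field[OF V(1) finite_class.finite_UNIV, where k = "\<lambda>A. p + par A" and m = par])
      (auto intro: vf_hom[OF X V(1) subset_refl zV] vD)
  let ?E = "sub_field X (comb_field UNIV (\<lambda>A. X (z A)) D)"
  have E: "vector_field \<O> V p ?E" by (rule vf_sub_field[OF V(1) X c])
  have "?E (z B) r = 0" if "r \<in> V" for B r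
  proof -
    have "D A (z B) r = (if A = B then 1 else 0)" for A
      using D that V(2) unfolding coord_fields_def by blast
    then show ?thesis
      unfolding sub_field_def comb_field_def by (simp add: if_distrib[of "(*) _"] cong: if_cong)
  qed
  from derivation_zero[OF E V this V(1) subset_refl f q]
  show ?thesis unfolding sub_field_def comb_field_def by simp
qed

text \<open>Coefficients exist by \<open>field_expand\<close>, and evaluation on the coordinates
  recovers them. Being a frame makes \<open>\<rho> D\<close> an invertible even superfunction, as
  the divergence requires.\<close>

lemma coord_frame:
  assumes D: "coord_fields \<O> U z D"
  shows "frame \<O> U D"
  unfolding frame_def
proof (intro conjI allI impI ballI; (elim conjE)?)
  show "vector_field \<O> U (par A) (D A)" for A using D unfolding coord_fields_def by blast
next
  fix V p X assume V: "open V" "V \<subseteq> U" and X: "vector_field \<O> V p X"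
  have zV: "z A \<in> \<O> V" for A by (rule O_mono[OF chart_open V hom_O[OF coords_hom]])
  have "field_eq \<O> V X (comb_field UNIV (\<lambda>A. X (z A)) D)"
    unfolding field_eq_def comb_field_def
  proof (intro allI impI ballI, elim conjE)
    fix W f q assume W: "open W" "W \<subseteq> V" "f \<in> \<O> W" "q \<in> W"
    show "X f q = (\<Sum>A\<in>UNIV. X (z A) q * D A f q)"
      by (rule field_expand[OF D vf_restrict[OF X W(2)] W(1) subset_trans[OF W(2) V(2)] W(3,4)])
  qed
  then show "\<exists>a. (\<forall>A. a A \<in> \<O> V) \<and> field_eq \<O> V X (comb_field UNIV a D)"
    using vf_O[OF X V(1) subset_refl zV] by (intro exI[of _ "\<lambda>A. X (z A)"] conjI allI)
next
  fix V a A q assume V: "open V" "V \<subseteq> U" and q: "q \<in> V"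
    and e: "field_eq \<O> V (comb_field UNIV a D) (\<lambda>f q. 0)"
  have zV: "z A \<in> \<O> V" by (rule O_mono[OF chart_open V hom_O[OF coords_hom]])
  have "(\<Sum>B\<in>UNIV. a B q * D B (z A) q) = 0"
    using e zV V(1) q unfolding field_eq_def comb_field_def by blast
  moreover have "D B (z A) q = (if B = A then 1 else 0)" for B
    using D q V(2) unfolding coord_fields_def by blast
  ultimately show "a A q = 0" by (simp add: if_distrib[of "(*) _"] cong: if_cong)
qed

end

section \<open>Ideals and tensorial functionals\<close>

text \<open>Two-sided, because stalks are only graded commutative. Identities along the submanifold
  are identities modulo such an ideal.\<close>

definition ring_ideal :: "'g::supercommutative_algebra set \<Rightarrow> bool" where
  "ring_ideal I \<longleftrightarrow> 0 \<in> I \<and> (\<forall>a\<in>I. \<forall>b\<in>I. a + b \<in> I) \<and> (\<forall>a\<in>I. \<forall>x. a * x \<in> I \<and> x * a \<in> I)"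

context
  fixes I :: "'g::supercommutative_algebra set"
  assumes I: "ring_ideal I"
begin

lemma ideal_0: "0 \<in> I"
  and ideal_add: "a \<in> I \<Longrightarrow> b \<in> I \<Longrightarrow> a + b \<in> I"
  and ideal_right: "a \<in> I \<Longrightarrow> a * x \<in> I"
  and ideal_left: "a \<in> I \<Longrightarrow> x * a \<in> I"
  using I unfolding ring_ideal_def by blast+

lemma ideal_uminus: "a \<in> I \<Longrightarrow> - a \<in> I"
  using ideal_right[of a "-1"] by simp

lemma ideal_diff: "a \<in> I \<Longrightarrow> b \<in> I \<Longrightarrow> a - b \<in> I"
  using ideal_add[of a "-b"] ideal_uminus[of b] by simp

lemma ideal_sum: "(\<And>k. k \<in> K \<Longrightarrow> a k \<in> I) \<Longrightarrow> sum a K \<in> I"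
  by (induction K rule: infinite_finite_induct) (auto intro: ideal_0 ideal_add)

lemma ideal_cong: "a - b \<in> I \<Longrightarrow> a \<in> I \<longleftrightarrow> b \<in> I"
  using ideal_add[of "a - b" b] ideal_diff[of a "a - b"] by auto

lemma ideal_trans: "a - b \<in> I \<Longrightarrow> b - d \<in> I \<Longrightarrow> a - d \<in> I"
  using ideal_add[of "a - b" "b - d"] by simp

text \<open>Solves a linear system with a 1|1 matrix modulo \<open>I\<close>; the hypotheses
  \<open>n\<close> make the even entries \<open>e\<close> and \<open>e'\<close> invertible up to odd
  corrections. Odd elements square to zero, so multiplying the first equation by \<open>r\<close>
  and the second by \<open>s\<close> puts \<open>Y0 * r\<close> and \<open>Y1 * s\<close> into
  \<open>I\<close>. After that each unknown is expressed through the other, and substitution leads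
  back to \<open>Y0 * r\<close>. The unknowns may have any parity and therefore stay on the left
  throughout.\<close>

lemma odd_elimination:
  fixes Y0 Y1 e e' r s H0 H1 P0 P1 :: 'g
  assumes Y: "Y0 * e + Y1 * r \<in> I" "Y0 * s + Y1 * e' \<in> I"
    and n: "H0 * e + H1 * r - 1 \<in> I" "P0 * s + P1 * e' + 1 \<in> I"
    and even: "grade_inv e = e" "grade_inv e' = e'" "grade_inv P1 = P1"
    and odd: "grade_inv r = - r" "grade_inv s = - s" "grade_inv H1 = - H1" "grade_inv P0 = - P0"
  shows "Y0 \<in> I" "Y1 \<in> I"
proof -
  have rr: "r * r = 0" and ss: "s * s = 0" using odd odd_square_zero by auto
  have er: "e * x = x * e" and er': "e' * x = x * e'" and p1: "P1 * x = x * P1" for x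
    using even even_commute by auto
  have rH: "r * H1 = - (H1 * r)" and sP: "s * P0 = - (P0 * s)" and sr: "s * r = - (r * s)"
    using odd odd_anticommute by auto
  \<comment> \<open>The extra factor \<open>r\<close> removes the term with \<open>Y1\<close>.
    Modulo \<open>I\<close> one may replace \<open>H0 * e\<close> by \<open>1 - H1 * r\<close>, and
    \<open>r * (H1 * r)\<close> is zero.\<close>
  have "(Y0 * e + Y1 * r) * r * H0 \<in> I" by (intro ideal_right Y)
  moreover have "(Y0 * e + Y1 * r) * r * H0 = Y0 * r * (H0 * e)"
    using rr by (simp add: distrib_right mult.assoc er)
  ultimately have "Y0 * r * (H0 * e) - Y0 * r * (H0 * e + H1 * r - 1) \<in> I"
    using ideal_diff ideal_left n by metis
  moreover have "r * (H1 * r) = 0"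
    unfolding mult.assoc[symmetric] rH by (simp add: mult.assoc rr)
  ultimately have Yr: "Y0 * r \<in> I"
    by (simp add: distrib_left right_diff_distrib mult.assoc)
  have "(Y0 * s + Y1 * e') * s * P1 \<in> I" by (intro ideal_right Y)
  moreover have "(Y0 * s + Y1 * e') * s * P1 = Y1 * s * (P1 * e')"
    using ss by (simp add: distrib_right mult.assoc er'[of "s * P1"])
  ultimately have "Y1 * s * (P0 * s + P1 * e' + 1) - Y1 * s * (P1 * e') \<in> I"
    using ideal_diff ideal_left n by metis
  moreover have "s * (P0 * s) = 0"
    unfolding mult.assoc[symmetric] sP by (simp add: mult.assoc ss)
  ultimately have Ys: "Y1 * s \<in> I"
    by (simp add: distrib_left mult.assoc)
  \<comment> \<open>\<open>H0\<close> inverts \<open>e\<close> up to \<open>H1 * r\<close>, and this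
    error is absorbed by \<open>Y0 * r\<close>.\<close>
  have "(Y0 * e + Y1 * r) * H0 - Y0 * (H0 * e + H1 * r - 1) - Y0 * r * H1 \<in> I"
    by (intro ideal_diff ideal_right[OF Y(1)] ideal_left n(1) ideal_right[OF Yr])
  moreover have "(Y0 * e + Y1 * r) * H0 - Y0 * (H0 * e + H1 * r - 1) - Y0 * r * H1 = Y0 + Y1 * r * H0"
    by (simp add: algebra_simps er[of H0] rH)
  ultimately have a: "Y0 + Y1 * r * H0 \<in> I" by simp
  have "Y1 * (P0 * s + P1 * e' + 1) - (Y0 * s + Y1 * e') * P1 + Y1 * s * P0 \<in> I"
    by (intro ideal_diff ideal_add ideal_right[OF Y(2)] ideal_left n(2) ideal_right[OF Ys])
  moreover have "Y1 * (P0 * s + P1 * e' + 1) - (Y0 * s + Y1 * e') * P1 + Y1 * s * P0 = Y1 - Y0 * s * P1"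
    by (simp add: algebra_simps er'[of P1] sP)
  ultimately have b: "Y1 - Y0 * s * P1 \<in> I" by simp
  \<comment> \<open>Replacing \<open>Y1\<close> by \<open>Y0 * s * P1\<close> leaves, once
    \<open>s\<close> and \<open>r\<close> are interchanged, a right multiple of
    \<open>Y0 * r\<close>.\<close>
  have "Y0 + Y1 * r * H0 - (Y1 - Y0 * s * P1) * r * H0 + Y0 * r * (s * P1 * H0) \<in> I"
    by (rule ideal_add[OF ideal_diff[OF a ideal_right[OF ideal_right[OF b]]] ideal_right[OF Yr]])
  moreover have "s * (P1 * (r * H0)) = - (r * (s * (P1 * H0)))"
  proof -
    have "s * (P1 * (r * H0)) = (s * r) * (P1 * H0)" using p1[of r] by (metis mult.assoc)
    then show ?thesis unfolding sr by (simp add: mult.assoc)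
  qed
  then have "Y0 + Y1 * r * H0 - (Y1 - Y0 * s * P1) * r * H0 + Y0 * r * (s * P1 * H0) = Y0"
    by (simp add: left_diff_distrib mult.assoc)
  ultimately show Y0: "Y0 \<in> I" by simp
  have "(Y1 - Y0 * s * P1) + Y0 * (s * P1) \<in> I" by (rule ideal_add[OF b ideal_right[OF Y0]])
  then show "Y1 \<in> I" by (simp add: mult.assoc)
qed

end

section \<open>Functionals linear over superfunctions\<close>

context supersheaf
begin

text \<open>The notion covers the first slot of \<omega> and of a connection, where scalars leave on
  the left without a sign. Compatibility with \<open>field_eq\<close> is part of it because vector
  fields are represented by maps on all families of germs, only their action on sections being
  meaningful. Additivity is asked for fields of equal parity, since fields are homogeneous.\<close>

definition tensorial :: "'p set \<Rightarrow> (('p, 'g) vfield \<Rightarrow> ('p, 'g) sect) \<Rightarrow> bool" where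
  "tensorial V L \<longleftrightarrow> (\<forall>p X. vector_field \<O> V p X \<longrightarrow>
    (\<forall>Y. vector_field \<O> V p Y \<and> field_eq \<O> V X Y \<longrightarrow> (\<forall>r\<in>V. L X r = L Y r)) \<and>
    (\<forall>Y. vector_field \<O> V p Y \<longrightarrow> (\<forall>r\<in>V. L (add_field X Y) r = L X r + L Y r)) \<and>
    (\<forall>k. \<forall>h\<in>hom_sect \<O> k V. \<forall>r\<in>V. L (scale_field h X) r = h r * L X r))"

lemma tensorial_cong: "tensorial V L \<Longrightarrow> vector_field \<O> V p X \<Longrightarrow> vector_field \<O> V p Y \<Longrightarrow>
      field_eq \<O> V X Y \<Longrightarrow> r \<in> V \<Longrightarrow> L X r = L Y r"
  and tensorial_add: "tensorial V L \<Longrightarrow> vector_field \<O> V p X \<Longrightarrow> vector_field \<O> V p Y \<Longrightarrow>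
      r \<in> V \<Longrightarrow> L (add_field X Y) r = L X r + L Y r"
  and tensorial_scale: "tensorial V L \<Longrightarrow> vector_field \<O> V p X \<Longrightarrow> h \<in> hom_sect \<O> k V \<Longrightarrow>
      r \<in> V \<Longrightarrow> L (scale_field h X) r = h r * L X r"
  unfolding tensorial_def by meson+

lemma tensorial_diff:
  assumes "tensorial V L" "tensorial V M"
  shows "tensorial V (\<lambda>X q. L X q - M X q)"
  unfolding tensorial_def
  by (intro allI impI conjI ballI; (elim conjE)?)
    (simp_all add: tensorial_cong[OF assms(1)] tensorial_cong[OF assms(2)]
      tensorial_add[OF assms(1)] tensorial_add[OF assms(2)]
      tensorial_scale[OF assms(1)] tensorial_scale[OF assms(2)] right_diff_distrib)

lemma tensorial_sub_field:
  assumes "open V" "tensorial V L" "vector_field \<O> V p X" "vector_field \<O> V p Y" "r \<in> V"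
  shows "L (sub_field X Y) r = L X r - L Y r"
proof -
  let ?m = "scale_field (\<lambda>q. of_real (-1)) Y"
  note h = hom_of_real[OF assms(1), of "-1"]
  have "vector_field \<O> V (0 + p) ?m" by (rule vf_scale_field[OF assms(1,4) h])
  then have "L (add_field X ?m) r = L X r + L ?m r"
    using tensorial_add[OF assms(2,3) _ assms(5)] by simp
  moreover have "L ?m r = - L Y r"
    using tensorial_scale[OF assms(2,4) h assms(5)] by simp
  moreover have "add_field X ?m = sub_field X Y"
    unfolding add_field_def scale_field_def sub_field_def by simp
  ultimately show ?thesis by simp
qed

lemma tensorial_comb_field:
  fixes p :: nat
  assumes "open U" "tensorial U L" "finite S" "\<And>A. A \<in> S \<Longrightarrow> a A \<in> hom_sect \<O> (k A) U"
    "\<And>A. A \<in> S \<Longrightarrow> vector_field \<O> U (m A) (b A)" "\<And>A. A \<in> S \<Longrightarrow> even (k A + m A) = even p"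
    and r: "r \<in> U"
  shows "L (comb_field S a b) r = (\<Sum>A\<in>S. a A r * L (b A) r)"
  using assms(3-6)
proof (induction S rule: finite_induct)
  case empty
  have z: "vector_field \<O> U 0 (\<lambda>f q. 0)" by (rule vf_zero[OF assms(1)])
  \<comment> \<open>The zero field is its own multiple by the scalar 0.\<close>
  have "L (scale_field (\<lambda>q. of_real 0) (\<lambda>f q. 0)) r = of_real 0 * L (\<lambda>f q. 0) r"
    by (rule tensorial_scale[OF assms(2) z hom_of_real[OF assms(1)] r])
  then show ?case unfolding comb_field_def scale_field_def by simp
next
  case (insert A S)
  have aA: "a A \<in> hom_sect \<O> (k A) U" and bA: "vector_field \<O> U (m A) (b A)"
    using insert.prems by blast+
  have "vector_field \<O> U (k A + m A) (scale_field (a A) (b A))"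
    by (rule vf_scale_field[OF assms(1) bA aA])
  then have v: "vector_field \<O> U p (scale_field (a A) (b A))"
    using vf_parity insert.prems(3)[of A] by blast
  have c: "vector_field \<O> U p (comb_field S a b)"
    by (rule vf_comb_field[OF assms(1) insert.hyps(1)]) (use insert.prems in blast)+
  have "add_field (scale_field (a A) (b A)) (comb_field S a b) = comb_field (insert A S) a b"
    unfolding add_field_def scale_field_def comb_field_def using insert.hyps by simp
  moreover have "L (comb_field S a b) r = (\<Sum>A\<in>S. a A r * L (b A) r)"
    by (rule insert.IH) (use insert.prems in blast)+
  ultimately show ?case
    using tensorial_add[OF assms(2) v c r] tensorial_scale[OF assms(2) bA aA r] insert.hyps by simp
qed

lemma field_eq_refl: "field_eq \<O> V X X"
  unfolding field_eq_def by simp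

end

section \<open>Expansion in coordinate fields\<close>

locale coord_chart = super_chart \<O> U \<phi> \<iota> \<theta>
  for \<O> :: "'p::topological_space set \<Rightarrow> ('p, 'g::supercommutative_algebra) sect set"
    and U and \<phi> :: "'p \<Rightarrow> 'n::{finite,linorder} coord_space"
    and \<iota> :: "('n coord_space \<Rightarrow> real) \<Rightarrow> ('p, 'g) sect" and \<theta> :: "'n \<Rightarrow> ('p, 'g) sect" +
  fixes D :: "'n + 'n \<Rightarrow> ('p, 'g) vfield"
  assumes D: "coord_fields \<O> U z D"
begin

lemma D_coord: "q \<in> U \<Longrightarrow> D A (z B) q = (if A = B then 1 else 0)"
  using D unfolding coord_fields_def by blast

lemma D_vf: "V \<subseteq> U \<Longrightarrow> vector_field \<O> V (par A) (D A)"
  using D vf_restrict unfolding coord_fields_def by blast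

lemma z_hom: "open V \<Longrightarrow> V \<subseteq> U \<Longrightarrow> z A \<in> hom_sect \<O> (par A) V"
  by (rule hom_mono[OF chart_open _ _ coords_hom])

lemma comp_hom:
  "open V \<Longrightarrow> V \<subseteq> U \<Longrightarrow> vector_field \<O> V p X \<Longrightarrow> X (z A) \<in> hom_sect \<O> (p + par A) V"
  by (rule vf_hom[OF _ _ subset_refl z_hom])

lemma field_eq_comb:
  assumes V: "open V" "V \<subseteq> U" and X: "vector_field \<O> V p X"
  shows "field_eq \<O> V X (comb_field UNIV (\<lambda>A. X (z A)) D)"
  unfolding field_eq_def comb_field_def
proof (intro allI impI ballI, elim conjE)
  fix W f q assume W: "open W" "W \<subseteq> V" "f \<in> \<O> W" "q \<in> W"
  show "X f q = (\<Sum>A\<in>UNIV. X (z A) q * D A f q)"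
    by (rule field_expand[OF D vf_restrict[OF X W(2)] W(1) subset_trans[OF W(2) V(2)] W(3,4)])
qed

lemma comb_vf:
  assumes V: "open V" "V \<subseteq> U" and X: "vector_field \<O> V p X"
  shows "vector_field \<O> V p (comb_field UNIV (\<lambda>A. X (z A)) D)"
  by (rule vf_comb_field[OF V(1) finite_class.finite_UNIV comp_hom[OF V X] D_vf[OF V(2)]]) auto

text \<open>\<open>field_eq\<close> lets \<open>X\<close> be replaced by its expansion, and the
  functional then acts term by term. The coefficients have parity \<open>p + par A\<close>, so all
  terms have parity \<open>p\<close> modulo 2.\<close>

lemma tensorial_expand:
  assumes V: "open V" "V \<subseteq> U" and L: "tensorial V L" and X: "vector_field \<O> V p X" and q: "q \<in> V"
  shows "L X q = (\<Sum>A\<in>UNIV. X (z A) q * L (D A) q)"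
  unfolding tensorial_cong[OF L X comb_vf[OF V X] field_eq_comb[OF V X] q]
  by (rule tensorial_comb_field[OF V(1) L finite_class.finite_UNIV comp_hom[OF V X] D_vf[OF V(2)] _ q,
        where p = p]) auto

lemma tensorial_in_ideal:
  assumes V: "open V" "V \<subseteq> U" and L: "tensorial V L" and X: "vector_field \<O> V p X" and q: "q \<in> V"
    and I: "ring_ideal I" and c: "\<And>A. X (z A) q \<in> I"
  shows "L X q \<in> I"
  unfolding tensorial_expand[OF V L X q] by (intro ideal_sum[OF I] ideal_right[OF I] c)

end

section \<open>Odd symplectic structures and connections\<close>

locale odd_symplectic = supersheaf \<O>
  for \<O> :: "'p::topological_space set \<Rightarrow> ('p, 'g::supercommutative_algebra) sect set" +
  fixes br :: "('p, 'g) sect \<Rightarrow> ('p, 'g) sect \<Rightarrow> ('p, 'g) sect"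
    and \<omega> :: "('p, 'g) vfield \<Rightarrow> ('p, 'g) vfield \<Rightarrow> ('p, 'g) sect"
  assumes bracket: "odd_poisson_bracket \<O> br" and form: "symplectic_form_of \<O> br \<omega>"
begin

context
  fixes V :: "'p set"
  assumes V: "open V"
begin

lemma br_O: "f \<in> \<O> V \<Longrightarrow> g \<in> \<O> V \<Longrightarrow> br f g \<in> \<O> V"
  and br_cong: "f \<in> \<O> V \<Longrightarrow> f' \<in> \<O> V \<Longrightarrow> g \<in> \<O> V \<Longrightarrow> g' \<in> \<O> V \<Longrightarrow>
      (\<And>q. q \<in> V \<Longrightarrow> f q = f' q \<and> g q = g' q) \<Longrightarrow> q \<in> V \<Longrightarrow> br f g q = br f' g' q"
  and br_add: "f \<in> \<O> V \<Longrightarrow> g \<in> \<O> V \<Longrightarrow> h \<in> \<O> V \<Longrightarrow> q \<in> V \<Longrightarrow>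
      br h (\<lambda>r. f r + g r) q = br h f q + br h g q"
  and br_scaleR: "f \<in> \<O> V \<Longrightarrow> g \<in> \<O> V \<Longrightarrow> q \<in> V \<Longrightarrow> br f (\<lambda>r. c *\<^sub>R g r) q = c *\<^sub>R br f g q"
  and br_hom: "f \<in> hom_sect \<O> k V \<Longrightarrow> g \<in> hom_sect \<O> l V \<Longrightarrow> br f g \<in> hom_sect \<O> (k + l + 1) V"
  and br_antisym: "f \<in> hom_sect \<O> k V \<Longrightarrow> g \<in> hom_sect \<O> l V \<Longrightarrow> q \<in> V \<Longrightarrow>
      br f g q = - ((-1) ^ ((k + 1) * (l + 1)) * br g f q)"
  and br_leibniz: "f \<in> hom_sect \<O> k V \<Longrightarrow> g \<in> hom_sect \<O> l V \<Longrightarrow> h \<in> hom_sect \<O> m V \<Longrightarrow> q \<in> V \<Longrightarrow>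
      br f (\<lambda>r. g r * h r) q = br f g q * h q + (-1) ^ ((k + 1) * l) * g q * br f h q"
  using bracket[unfolded odd_poisson_bracket_def, rule_format, OF V] by meson+

lemma omega_hom: "vector_field \<O> V p X \<Longrightarrow> vector_field \<O> V q Y \<Longrightarrow> \<omega> X Y \<in> hom_sect \<O> (p + q + 1) V"
  and omega_antisym: "vector_field \<O> V p X \<Longrightarrow> vector_field \<O> V q Y \<Longrightarrow> r \<in> V \<Longrightarrow>
      \<omega> X Y r = - ((-1) ^ (p * q) * \<omega> Y X r)"
  and omega_cong: "vector_field \<O> V p X \<Longrightarrow> vector_field \<O> V q Y \<Longrightarrow> vector_field \<O> V p X' \<Longrightarrow>
      vector_field \<O> V q Y' \<Longrightarrow> field_eq \<O> V X X' \<Longrightarrow> field_eq \<O> V Y Y' \<Longrightarrow> r \<in> V \<Longrightarrow> \<omega> X Y r = \<omega> X' Y' r"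
  and omega_add: "vector_field \<O> V p X \<Longrightarrow> vector_field \<O> V q Y \<Longrightarrow> vector_field \<O> V p X' \<Longrightarrow> r \<in> V \<Longrightarrow>
      \<omega> (add_field X X') Y r = \<omega> X Y r + \<omega> X' Y r"
  and omega_scale: "vector_field \<O> V p X \<Longrightarrow> vector_field \<O> V q Y \<Longrightarrow> h \<in> hom_sect \<O> k V \<Longrightarrow> r \<in> V \<Longrightarrow>
      \<omega> (scale_field h X) Y r = h r * \<omega> X Y r"
  and omega_hamiltonian: "f \<in> hom_sect \<O> k V \<Longrightarrow> vector_field \<O> V p Y \<Longrightarrow> r \<in> V \<Longrightarrow> \<omega> Y (br f) r = Y f r"
  using form[unfolded symplectic_form_of_def, rule_format, OF V, THEN conjunct1]
    form[unfolded symplectic_form_of_def, rule_format, OF V, THEN conjunct2] by meson+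

lemma tensorial_omega:
  assumes "vector_field \<O> V q Y"
  shows "tensorial V (\<lambda>X. \<omega> X Y)"
  unfolding tensorial_def
  using omega_cong[OF _ assms _ assms _ field_eq_refl] omega_add[OF _ assms] omega_scale[OF _ assms]
  by meson

end

text \<open>The bracket axioms give the Leibniz rule for two homogeneous factors, while a vector
  field has to satisfy it for an arbitrary second factor; that factor is split into its even and odd
  parts.\<close>

lemma br_vf:
  assumes U: "open U" and f: "f \<in> hom_sect \<O> k U"
  shows "vector_field \<O> U (k + 1) (br f)"
proof (rule vector_fieldI)
  fix V assume V: "open V" "V \<subseteq> U"
  have f: "f \<in> hom_sect \<O> k V" by (rule hom_mono[OF U V f])
  show "br f g \<in> \<O> V" if "g \<in> \<O> V" for g by (rule br_O[OF V(1) hom_O[OF f] that])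
  show "br f g q = br f h q" if "g \<in> \<O> V" "h \<in> \<O> V" "\<forall>q\<in>V. g q = h q" "q \<in> V" for g h q
    using br_cong[OF V(1) hom_O[OF f] hom_O[OF f] that(1,2) _ that(4)] that(3) by blast
  show "br f (\<lambda>r. g r + h r) q = br f g q + br f h q" if "g \<in> \<O> V" "h \<in> \<O> V" "q \<in> V" for g h q
    by (rule br_add[OF V(1) that(1,2) hom_O[OF f] that(3)])
  show "br f (\<lambda>r. c *\<^sub>R g r) q = c *\<^sub>R br f g q" if "g \<in> \<O> V" "q \<in> V" for g c q
    by (rule br_scaleR[OF V(1) hom_O[OF f] that])
  show "br f g \<in> hom_sect \<O> (k + 1 + l) V" if "g \<in> hom_sect \<O> l V" for g l
    using br_hom[OF V(1) f that] by (simp add: add.assoc add.commute add.left_commute)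
  show "br f (\<lambda>r. g r * h r) q = br f g q * h q + (-1) ^ ((k + 1) * l) * g q * br f h q"
    if g: "g \<in> hom_sect \<O> l V" and h: "h \<in> \<O> V" and q: "q \<in> V" for g h l q
  proof -
    obtain h0 h1 where s: "h0 \<in> hom_sect \<O> 0 V" "h1 \<in> hom_sect \<O> 1 V" "\<And>q. h q = h0 q + h1 q"
      using even_odd_split[OF V(1) h] by blast
    have O: "h0 \<in> \<O> V" "h1 \<in> \<O> V" by (rule hom_O[OF s(1)], rule hom_O[OF s(2)])
    have gO: "g \<in> \<O> V" by (rule hom_O[OF g])
    have hh: "h = (\<lambda>r. h0 r + h1 r)" using s(3) by (rule ext)
    have "br f (\<lambda>r. g r * h r) q = br f (\<lambda>r. g r * h0 r + g r * h1 r) q"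
      unfolding hh distrib_left ..
    also have "\<dots> = br f (\<lambda>r. g r * h0 r) q + br f (\<lambda>r. g r * h1 r) q"
      by (rule br_add[OF V(1) O_mult[OF V(1) gO O(1)] O_mult[OF V(1) gO O(2)] hom_O[OF f] q])
    also have "\<dots> = br f g q * h q + (-1) ^ ((k + 1) * l) * g q * br f h q"
      unfolding br_leibniz[OF V(1) f g s(1) q] br_leibniz[OF V(1) f g s(2) q] hh
        br_add[OF V(1) O hom_O[OF f] q] by (simp add: distrib_left add_ac)
    finally show ?thesis .
  qed
qed

end

section \<open>Affine connections in coordinates\<close>

locale connection = supersheaf \<O>
  for \<O> :: "'p::topological_space set \<Rightarrow> ('p, 'g::supercommutative_algebra) sect set" +
  fixes nab :: "('p, 'g) vfield \<Rightarrow> ('p, 'g) vfield \<Rightarrow> ('p, 'g) vfield"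
  assumes connection: "affine_connection \<O> nab"
begin

context
  fixes V :: "'p set" and p q X Y
  assumes V: "open V" and X: "vector_field \<O> V p X" and Y: "vector_field \<O> V q Y"
begin

lemma nab_vf: "vector_field \<O> V (p + q) (nab X Y)"
  and nab_cong: "vector_field \<O> V p X' \<Longrightarrow> vector_field \<O> V q Y' \<Longrightarrow> field_eq \<O> V X X' \<Longrightarrow>
      field_eq \<O> V Y Y' \<Longrightarrow> field_eq \<O> V (nab X Y) (nab X' Y')"
  and nab_add_left: "vector_field \<O> V p X' \<Longrightarrow>
      field_eq \<O> V (nab (add_field X X') Y) (add_field (nab X Y) (nab X' Y))"
  and nab_add_right: "vector_field \<O> V q Y' \<Longrightarrow>
      field_eq \<O> V (nab X (add_field Y Y')) (add_field (nab X Y) (nab X Y'))"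
  and nab_scale_left: "h \<in> hom_sect \<O> k V \<Longrightarrow>
      field_eq \<O> V (nab (scale_field h X) Y) (scale_field h (nab X Y))"
  and nab_scale_right: "h \<in> hom_sect \<O> k V \<Longrightarrow>
      field_eq \<O> V (nab X (scale_field h Y))
        (add_field (scale_field (X h) Y) (scale_field (\<lambda>r. (-1) ^ (p * k) * h r) (nab X Y)))"
  using connection[unfolded affine_connection_def, rule_format, OF conjI[OF V conjI[OF X Y]]] by meson+

end

lemma field_eqD: "open V \<Longrightarrow> field_eq \<O> V X Y \<Longrightarrow> f \<in> \<O> V \<Longrightarrow> q \<in> V \<Longrightarrow> X f q = Y f q"
  unfolding field_eq_def by blast

lemma tensorial_nab:
  assumes V: "open V" and Y: "vector_field \<O> V q Y" and f: "f \<in> \<O> V"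
  shows "tensorial V (\<lambda>X. nab X Y f)"
  unfolding tensorial_def
proof (intro allI impI conjI ballI; (elim conjE)?)
  fix p X assume X: "vector_field \<O> V p X"
  show "nab X Y f r = nab X' Y f r" if "vector_field \<O> V p X'" "field_eq \<O> V X X'" "r \<in> V" for X' r
    by (rule field_eqD[OF V nab_cong[OF V X Y that(1) Y that(2) field_eq_refl] f that(3)])
  show "nab (add_field X X') Y f r = nab X Y f r + nab X' Y f r"
    if "vector_field \<O> V p X'" "r \<in> V" for X' r
    using field_eqD[OF V nab_add_left[OF V X Y that(1)] f that(2)] unfolding add_field_def .
  show "nab (scale_field h X) Y f r = h r * nab X Y f r" if "h \<in> hom_sect \<O> k V" "r \<in> V" for k h r
    using field_eqD[OF V nab_scale_left[OF V X Y that(1)] f that(2)] unfolding scale_field_def .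
qed

lemma nab_comb_field:
  fixes p :: nat
  assumes "open U" "vector_field \<O> U l X" "finite S" "\<And>A. A \<in> S \<Longrightarrow> a A \<in> hom_sect \<O> (k A) U"
    "\<And>A. A \<in> S \<Longrightarrow> vector_field \<O> U (m A) (b A)" "\<And>A. A \<in> S \<Longrightarrow> even (k A + m A) = even p"
    and f: "f \<in> \<O> U" and r: "r \<in> U"
  shows "nab X (comb_field S a b) f r =
    (\<Sum>A\<in>S. X (a A) r * b A f r + (-1) ^ (l * k A) * a A r * nab X (b A) f r)"
  using assms(3-6)
proof (induction S rule: finite_induct)
  case empty
  have z: "vector_field \<O> U 0 (\<lambda>f q. 0)" by (rule vf_zero[OF assms(1)])
  \<comment> \<open>Additivity on 0 + 0 shows that the covariant derivative of the zero field equals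
    its own double.\<close>
  have "nab X (add_field (\<lambda>f q. 0) (\<lambda>f q. 0)) f r =
      add_field (nab X (\<lambda>f q. 0)) (nab X (\<lambda>f q. 0)) f r"
    by (rule field_eqD[OF assms(1) nab_add_right[OF assms(1,2) z z] f r])
  then show ?case unfolding comb_field_def add_field_def by simp
next
  case (insert A S)
  have aA: "a A \<in> hom_sect \<O> (k A) U" and bA: "vector_field \<O> U (m A) (b A)"
    using insert.prems by blast+
  have "vector_field \<O> U (k A + m A) (scale_field (a A) (b A))"
    by (rule vf_scale_field[OF assms(1) bA aA])
  then have v: "vector_field \<O> U p (scale_field (a A) (b A))"
    using vf_parity insert.prems(3)[of A] by blast
  have c: "vector_field \<O> U p (comb_field S a b)"
    by (rule vf_comb_field[OF assms(1) insert.hyps(1)]) (use insert.prems in blast)+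
  have e: "add_field (scale_field (a A) (b A)) (comb_field S a b) = comb_field (insert A S) a b"
    unfolding add_field_def scale_field_def comb_field_def using insert.hyps by simp
  have IH: "nab X (comb_field S a b) f r =
      (\<Sum>A\<in>S. X (a A) r * b A f r + (-1) ^ (l * k A) * a A r * nab X (b A) f r)"
    by (rule insert.IH) (use insert.prems in blast)+
  have "nab X (comb_field (insert A S) a b) f r =
      nab X (scale_field (a A) (b A)) f r + nab X (comb_field S a b) f r"
    using field_eqD[OF assms(1) nab_add_right[OF assms(1,2) v c] f r]
    unfolding e by (simp only: add_field_def)
  moreover have "nab X (scale_field (a A) (b A)) f r =
      X (a A) r * b A f r + (-1) ^ (l * k A) * a A r * nab X (b A) f r"
    using field_eqD[OF assms(1) nab_scale_right[OF assms(1,2) bA aA] f r]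
    unfolding add_field_def scale_field_def .
  ultimately show ?case unfolding IH using insert.hyps by simp
qed

end

locale coord_connection = coord_chart \<O> U \<phi> \<iota> \<theta> D + connection \<O> nab
  for \<O> :: "'p::topological_space set \<Rightarrow> ('p, 'g::supercommutative_algebra) sect set"
    and U and \<phi> :: "'p \<Rightarrow> 'n::{finite,linorder} coord_space"
    and \<iota> :: "('n coord_space \<Rightarrow> real) \<Rightarrow> ('p, 'g) sect" and \<theta> :: "'n \<Rightarrow> ('p, 'g) sect"
    and D :: "'n + 'n \<Rightarrow> ('p, 'g) vfield" and nab
begin

text \<open>The usual formula for the covariant derivative, with the fields
  \<open>nab X (D A)\<close> carrying the Christoffel symbols. The sign comes from moving
  \<open>X\<close>, of parity \<open>l\<close>, past the component \<open>Y (z A)\<close>, of parity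
  \<open>p + par A\<close>.\<close>

lemma nab_expand:
  assumes V: "open V" "V \<subseteq> U" and X: "vector_field \<O> V l X" and Y: "vector_field \<O> V p Y"
    and f: "f \<in> \<O> V" and r: "r \<in> V"
  shows "nab X Y f r = (\<Sum>A\<in>UNIV. X (Y (z A)) r * D A f r +
    (-1) ^ (l * (p + par A)) * Y (z A) r * nab X (D A) f r)"
proof -
  have "nab X Y f r = nab X (comb_field UNIV (\<lambda>A. Y (z A)) D) f r"
    by (rule field_eqD[OF V(1) nab_cong[OF V(1) X Y X comb_vf[OF V Y] field_eq_refl field_eq_comb[OF V Y]] f r])
  also have "\<dots> = (\<Sum>A\<in>UNIV. X (Y (z A)) r * D A f r +
    (-1) ^ (l * (p + par A)) * Y (z A) r * nab X (D A) f r)"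
    by (rule nab_comb_field[OF V(1) X finite_class.finite_UNIV comp_hom[OF V Y] D_vf[OF V(2)] _ f r,
          where p = p]) auto
  finally show ?thesis .
qed

end

section \<open>Flat Darboux coordinates\<close>

locale darboux_chart = coord_connection \<O> U \<phi> \<iota> \<theta> D nab + odd_symplectic \<O> br \<omega>
  for \<O> :: "'p::topological_space set \<Rightarrow> ('p, 'g::supercommutative_algebra) sect set"
    and U and \<phi> :: "'p \<Rightarrow> 'n::{finite,linorder} coord_space"
    and \<iota> :: "('n coord_space \<Rightarrow> real) \<Rightarrow> ('p, 'g) sect" and \<theta> :: "'n \<Rightarrow> ('p, 'g) sect"
    and D :: "'n + 'n \<Rightarrow> ('p, 'g) vfield" and nab br \<omega> +
  assumes darboux: "darboux_coords br U z"
    and flat: "\<And>A B. field_eq \<O> U (nab (D A) (D B)) (\<lambda>f q. 0)"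
begin

lemma sum_sum_type: "(\<Sum>A\<in>UNIV. F A) = (\<Sum>a\<in>UNIV. F (Inl a)) + (\<Sum>a\<in>UNIV. F (Inr (a :: 'n)))"
  for F :: "'n + 'n \<Rightarrow> 'g"
  unfolding UNIV_Plus_UNIV[symmetric] by (subst sum.Plus) (simp_all add: o_def)

text \<open>In Darboux coordinates the Hamiltonian field of an even coordinate is the coordinate
  field of its odd partner, and that of an odd coordinate is minus the field of its even partner.
  The relation \<omega>(Y, X_f) = Y f and the antisymmetry of \<omega> then give both
  values.\<close>

lemma omega_D:
  assumes V: "open V" "V \<subseteq> U" and Y: "vector_field \<O> V 1 Y" and q: "q \<in> V"
  shows "\<omega> (D (Inl a)) Y q = Y (z (Inr a)) q" "\<omega> (D (Inr a)) Y q = Y (z (Inl a)) q"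
proof -
  have qU: "q \<in> U" using q V by blast
  have zh: "z (Inl a) \<in> hom_sect \<O> 0 V" "z (Inr a) \<in> hom_sect \<O> 1 V"
    using z_hom[OF V, of "Inl a"] z_hom[OF V, of "Inr a"] by simp_all
  have zh': "z (Inl b) \<in> hom_sect \<O> 0 V" for b using z_hom[OF V, of "Inl b"] by simp
  have d: "br (z (Inl a)) (z (Inl b)) q = 0" "br (z (Inl a)) (z (Inr b)) q = (if a = b then 1 else 0)"
    "br (z (Inr a)) (z (Inr b)) q = 0" "br (z (Inl b)) (z (Inr a)) q = (if b = a then 1 else 0)" for b
    using darboux qU unfolding darboux_coords_def by blast+
  have d': "br (z (Inr a)) (z (Inl b)) q = (if b = a then - 1 else 0)" for b
    using br_antisym[OF V(1) zh(2) zh' q, of b] d(4)[of b] by simp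
  note v0 = br_vf[OF V(1) zh(1)] and v1 = br_vf[OF V(1) zh(2)]
  have "\<omega> (br (z (Inl a))) Y q = - ((-1) ^ ((0 + 1) * 1) * \<omega> Y (br (z (Inl a))) q)"
    by (rule omega_antisym[OF V(1) v0 Y q])
  then have "\<omega> (br (z (Inl a))) Y q = Y (z (Inl a)) q"
    using omega_hamiltonian[OF V(1) zh(1) Y q] by simp
  moreover have "\<omega> (br (z (Inl a))) Y q = \<omega> (D (Inr a)) Y q"
    unfolding tensorial_expand[OF V tensorial_omega[OF V(1) Y] v0 q] sum_sum_type d
    by (simp add: if_distrib[of "\<lambda>x. x * _"] cong: if_cong)
  ultimately show "\<omega> (D (Inr a)) Y q = Y (z (Inl a)) q" by simp
  have "\<omega> (br (z (Inr a))) Y q = - ((-1) ^ ((1 + 1) * 1) * \<omega> Y (br (z (Inr a))) q)"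
    by (rule omega_antisym[OF V(1) v1 Y q])
  then have "\<omega> (br (z (Inr a))) Y q = - Y (z (Inr a)) q"
    using omega_hamiltonian[OF V(1) zh(2) Y q] by simp
  moreover have "\<omega> (br (z (Inr a))) Y q = - \<omega> (D (Inl a)) Y q"
    unfolding tensorial_expand[OF V tensorial_omega[OF V(1) Y] v1 q] sum_sum_type d d'
    by (simp add: if_distrib[of "\<lambda>x. x * _"] cong: if_cong)
  ultimately show "\<omega> (D (Inl a)) Y q = Y (z (Inr a)) q" by simp
qed

lemma omega_darboux:
  assumes V: "open V" "V \<subseteq> U" and X: "vector_field \<O> V p X" and Y: "vector_field \<O> V 1 Y" and q: "q \<in> V"
  shows "\<omega> X Y q = (\<Sum>a\<in>UNIV. X (z (Inl a)) q * Y (z (Inr a)) q + X (z (Inr a)) q * Y (z (Inl a)) q)"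
  unfolding tensorial_expand[OF V tensorial_omega[OF V(1) Y] X q] sum_sum_type omega_D[OF V Y q]
    sum.distrib ..

text \<open>Flatness removes the Christoffel terms from \<open>nab_expand\<close>, so covariant
  differentiation is differentiation of components.\<close>

lemma nab_coord:
  assumes V: "open V" "V \<subseteq> U" and X: "vector_field \<O> V l X" and Y: "vector_field \<O> V p Y" and q: "q \<in> V"
  shows "nab X Y (z B) q = X (Y (z B)) q"
proof -
  have zO: "z B \<in> \<O> V" by (rule hom_O[OF z_hom[OF V]])
  have "nab X (D A) (z B) q = 0" for A
    unfolding tensorial_expand[OF V tensorial_nab[OF V(1) D_vf[OF V(2)] zO] X q]
    using flat zO q V unfolding field_eq_def by simp
  moreover have "D A (z B) q = (if A = B then 1 else 0)" for A
    by (rule D_coord) (use q V in blast)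
  ultimately show ?thesis
    unfolding nab_expand[OF V X Y zO q] by (simp add: if_distrib[of "(*) _"] cong: if_cong)
qed

text \<open>The matrix of \<open>\<omega>\<close> in Darboux coordinates is constant, so \<open>\<omega>\<close> is parallel.\<close>

lemma omega_parallel:
  assumes V: "open V" "V \<subseteq> U" and H: "vector_field \<O> V 0 H" and Y: "vector_field \<O> V 1 Y" and q: "q \<in> V"
  shows "H (\<omega> Y Y) q = 2 * \<omega> (nab H Y) Y q"
proof -
  let ?x = "\<lambda>a. Y (z (Inl a))" and ?t = "\<lambda>a. Y (z (Inr a))"
  have x: "?x a \<in> hom_sect \<O> 1 V" for a using comp_hom[OF V Y, of "Inl a"] by simp
  have t: "?t a \<in> hom_sect \<O> 0 V" for a
    using comp_hom[OF V Y, of "Inr a"] hom_parity[of 2 0 V] by (simp add: numeral_2_eq_2)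
  have Hx: "H (?x a) \<in> hom_sect \<O> (0 + 1) V" and Ht: "H (?t a) \<in> hom_sect \<O> (0 + 0) V" for a
    using vf_hom[OF H V(1) subset_refl x] vf_hom[OF H V(1) subset_refl t] by blast+
  \<comment> \<open>The odd \<open>?x a\<close> commutes with the even derivative of
    \<open>?t a\<close>, and the even \<open>?t a\<close> commutes with the odd derivative of
    \<open>?x a\<close>. Hence the two products in each summand have equal derivatives, which
    produces the factor 2.\<close>
  have c1: "?x a q * H (?t a) q = H (?t a) q * ?x a q" for a
    using supercommute[OF hom_grade[OF x q] hom_grade[OF Ht q]] by simp
  have c2: "?t a q * H (?x a) q = H (?x a) q * ?t a q" for a
    using supercommute[OF hom_grade[OF t q] hom_grade[OF Hx q]] by simp
  have p: "(\<lambda>r. ?x a r * ?t a r) \<in> \<O> V" "(\<lambda>r. ?t a r * ?x a r) \<in> \<O> V" for a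
    by (rule O_mult[OF V(1) hom_O[OF x] hom_O[OF t]], rule O_mult[OF V(1) hom_O[OF t] hom_O[OF x]])
  have s: "(\<lambda>r. ?x a r * ?t a r + ?t a r * ?x a r) \<in> \<O> V" for a by (rule O_add[OF V(1) p])
  have n: "vector_field \<O> V 1 (nab H Y)" using nab_vf[OF V(1) H Y] by simp
  have "H (\<omega> Y Y) q = H (\<lambda>r. \<Sum>a\<in>UNIV. ?x a r * ?t a r + ?t a r * ?x a r) q"
    by (rule vf_cong[OF H V(1) subset_refl hom_O[OF omega_hom[OF V(1) Y Y]] O_sum[OF V(1) s]
        omega_darboux[OF V Y Y] q])
  also have "\<dots> = (\<Sum>a\<in>UNIV. H (\<lambda>r. ?x a r * ?t a r) q + H (\<lambda>r. ?t a r * ?x a r) q)"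
    unfolding vf_sum[OF H V(1) subset_refl s q] vf_add[OF H V(1) subset_refl p q] ..
  also have "\<dots> = (\<Sum>a\<in>UNIV. 2 * (H (?x a) q * ?t a q + H (?t a) q * ?x a q))"
    unfolding vf_leibniz[OF H V(1) subset_refl x hom_O[OF t] q]
      vf_leibniz[OF H V(1) subset_refl t hom_O[OF x] q]
    by (simp add: c1 c2 distrib_left mult_2 add_ac)
  also have "\<dots> = 2 * \<omega> (nab H Y) Y q"
    unfolding omega_darboux[OF V n Y q] nab_coord[OF V H Y q] sum_distrib_left ..
  finally show ?thesis .
qed

end

section \<open>Coordinate fields from the bracket\<close>

text \<open>Finitely many neighbourhoods are intersected. The application is to a matrix identity
  between germs, one neighbourhood for each entry.\<close>

lemma finite_local:
  assumes "finite K" "open U" "p \<in> U"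
    and "\<And>i. i \<in> K \<Longrightarrow> \<exists>V. open V \<and> p \<in> V \<and> V \<subseteq> U \<and> P i V"
    and mono: "\<And>i V W. P i V \<Longrightarrow> open W \<Longrightarrow> W \<subseteq> V \<Longrightarrow> P i W"
  shows "\<exists>V. open V \<and> p \<in> V \<and> V \<subseteq> U \<and> (\<forall>i\<in>K. P i V)"
  using assms(1,4)
proof (induction K rule: finite_induct)
  case empty
  show ?case using assms(2,3) by blast
next
  case (insert i K)
  have "\<exists>V. open V \<and> p \<in> V \<and> V \<subseteq> U \<and> (\<forall>i\<in>K. P i V)"
    by (rule insert.IH[OF insert.prems[OF insertI2]])
  then obtain V where V: "open V" "p \<in> V" "V \<subseteq> U" "\<forall>i\<in>K. P i V" by (elim exE conjE)
  obtain W where W: "open W" "p \<in> W" "W \<subseteq> U" "P i W"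
    using insert.prems[OF insertI1] by (elim exE conjE)
  have o: "open (V \<inter> W)" using V(1) W(1) by (rule open_Int)
  have "P j (V \<inter> W)" if "j \<in> insert i K" for j
  proof (cases "j = i")
    case True
    then show ?thesis using mono[OF W(4) o] by simp
  next
    case False
    then have "P j V" using that V(4) by simp
    then show ?thesis using mono[OF _ o] by simp
  qed
  with o V(2,3) W(2) show ?case by (intro exI[of _ "V \<inter> W"]) auto
qed

context super_chart
begin

lemma chart_restrict:
  assumes V: "open V" "V \<subseteq> U"
  shows "chart \<O> V \<phi> \<iota> \<theta>"
proof -
  obtain \<psi> where "homeomorphism U (\<phi> ` U) \<phi> \<psi>" using chart_homeo by blast
  then have "homeomorphism V (\<phi> ` V) \<phi> \<psi>"
    by (rule homeomorphism_of_subsets) (use V in auto)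
  then have h: "\<exists>\<psi>. homeomorphism V (\<phi> ` V) \<phi> \<psi>" by blast
  have t: "\<forall>i. \<theta> i \<in> hom_sect \<O> 1 V" using hom_mono[OF chart_open V theta_hom] by blast
  note r = chart[unfolded chart_def, THEN conjunct2, THEN conjunct2, THEN conjunct2, THEN conjunct2,
    THEN spec, THEN mp]
  show ?thesis
    unfolding chart_def
    by (rule conjI[OF V(1) conjI[OF open_image[OF V] conjI[OF h conjI[OF t]]]], intro allI impI,
      rule r) (use V in blast)
qed

end

locale symplectic_chart = super_chart \<O> U \<phi> \<iota> \<theta> + odd_symplectic \<O> br \<omega>
  for \<O> :: "'p::topological_space set \<Rightarrow> ('p, 'g::supercommutative_algebra) sect set"
    and U and \<phi> :: "'p \<Rightarrow> 'n::{finite,linorder} coord_space"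
    and \<iota> :: "('n coord_space \<Rightarrow> real) \<Rightarrow> ('p, 'g) sect" and \<theta> :: "'n \<Rightarrow> ('p, 'g) sect"
    and br \<omega>
begin

text \<open>The fields \<open>\<Sum> N\<^sub>A\<^sub>X {z\<^sup>X, \<cdot>}\<close>, where \<open>N\<close> is the inverse of the matrix of brackets, are
  dual to the coordinates; averaging \<open>N\<close> over the grading makes its entries homogeneous.\<close>

lemma local_coord_fields:
  assumes inv: "invertible_mod {0} UNIV (\<lambda>A B. br (z A) (z B) q)" and q: "q \<in> U"
  obtains V D where "open V" "q \<in> V" "V \<subseteq> U" "coord_fields \<O> V z D"
proof -
  let ?s = "\<lambda>A B. (-1 :: 'g) ^ (par (A :: 'n + 'n) + par (B :: 'n + 'n) + 1)"
  let ?W = "\<lambda>A B. br (z A) (z B)"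
  let ?d = "\<lambda>A B. if A = B then 1 else 0 :: 'g"
  obtain N where N: "\<And>A B. (\<Sum>X\<in>UNIV. N A X * ?W X B q) = ?d A B"
    using inv unfolding invertible_mod_def by auto
  have "\<exists>V f. open V \<and> q \<in> V \<and> f \<in> \<O> V \<and> f q = N A B" for A B
    using germ_section[of q "N A B"] by metis
  then obtain V0 n where V0: "\<And>A B. open (V0 A B)" "\<And>A B. q \<in> V0 A B"
    and n: "\<And>A B. n A B \<in> \<O> (V0 A B)" "\<And>A B. n A B q = N A B"
    by metis
  define V where "V = U \<inter> (\<Inter>A\<in>UNIV. \<Inter>B\<in>UNIV. V0 A B)"
  have V: "open V" "V \<subseteq> U"
    unfolding V_def by (intro open_Int chart_open open_INT ballI V0(1) finite_class.finite_UNIV) blast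
  have qV: "q \<in> V" unfolding V_def using q V0(2) by blast
  have nV: "n A B \<in> \<O> V" for A B
    by (rule O_mono[OF V0(1) V(1) _ n(1)]) (auto simp: V_def)
  \<comment> \<open>The projection of the entry to parity \<open>par A + par B + 1\<close>, the
    parity of the bracket of two coordinates.\<close>
  define m where "m A B = (\<lambda>r. (1/2) *\<^sub>R (n A B r + ?s A B * grade_inv (n A B r)))" for A B
  have m: "m A B \<in> hom_sect \<O> (par A + par B + 1) V" for A B
  proof (rule hom_I)
    show "m A B \<in> \<O> V"
      unfolding m_def by (intro O_scaleR O_add O_sign O_grade V(1) nV)
    show "grade_inv (m A B r) = (-1) ^ (par A + par B + 1) * m A B r" for r
      unfolding m_def
      by (cases "even (par A + par B)")
        (simp_all add: grade_inv_scaleR grade_inv_add grade_inv_minus grade_inv_diff grade_inv_grade_inv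
          scaleR_right_diff_distrib add.commute)
  qed
  have zV: "z A \<in> hom_sect \<O> (par A) V" for A by (rule hom_mono[OF chart_open V coords_hom])
  have W: "?W A B \<in> hom_sect \<O> (par A + par B + 1) V" for A B
    by (rule br_hom[OF V(1) zV zV])
  let ?F = "\<lambda>A B r. \<Sum>X\<in>UNIV. m A X r * ?W X B r"
  have Fq: "?F A B q = ?d A B" for A B
  proof -
    \<comment> \<open>The bracket matrix is homogeneous already. Averaging \<open>N\<close>
      therefore averages the product of the two matrices, and averaging fixes the identity
      matrix.\<close>
    have W': "?W X B q = ?s X B * grade_inv (?W X B q)" for X
      unfolding hom_grade[OF W qV] by (simp flip: power_add mult.assoc mult_2)
    have t: "m A X q * ?W X B q = (1/2) *\<^sub>R (N A X * ?W X B q + (-1) ^ (par A + par B) * grade_inv (N A X * ?W X B q))" for X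
    proof -
      have "?s A X * grade_inv (N A X) * (?s X B * grade_inv (?W X B q)) =
          (-1) ^ (par A + par B) * grade_inv (N A X * ?W X B q)"
        unfolding grade_inv_mult
        by (cases "even (par A)"; cases "even (par B)"; cases "even (par X)") simp_all
      then have "?s A X * grade_inv (N A X) * ?W X B q =
          (-1) ^ (par A + par B) * grade_inv (N A X * ?W X B q)"
        unfolding W'[symmetric] .
      then show ?thesis unfolding m_def n(2) by (simp only: mult_scaleR_left distrib_right)
    qed
    have "?F A B q = (1/2) *\<^sub>R (?d A B + (-1) ^ (par A + par B) * grade_inv (?d A B))"
      unfolding t N[symmetric] grade_inv_sum sum_distrib_left sum.distrib[symmetric] scaleR_sum_right ..
    also have "\<dots> = ?d A B"
      by (cases "A = B") (simp_all add: grade_inv_1 grade_inv_0 scaleR_half_double del: one_add_one)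
    finally show ?thesis .
  qed
  have FO: "?F A B \<in> \<O> V" for A B by (intro O_sum O_mult V(1) hom_O[OF m] hom_O[OF W])
  have dO: "(\<lambda>r. ?d A B) \<in> \<O> V" for A B by (cases "A = B") (simp_all add: O_0 O_1 V(1))
  \<comment> \<open>So far the inversion holds for germs at \<open>q\<close>; equality of finitely
    many germs spreads to a common neighbourhood.\<close>
  have "\<exists>V'. open V' \<and> q \<in> V' \<and> V' \<subseteq> V \<and> (\<forall>i\<in>UNIV. \<forall>r\<in>V'. ?F (fst i) (snd i) r = ?d (fst i) (snd i))"
  proof (rule finite_local[OF finite_class.finite_UNIV V(1) qV])
    fix i :: "('n + 'n) \<times> ('n + 'n)"
    obtain V' where "open V'" "q \<in> V'" "V' \<subseteq> V" "\<And>r. r \<in> V' \<Longrightarrow> ?F (fst i) (snd i) r = ?d (fst i) (snd i)"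
      by (rule germ_eq[OF V(1) qV FO dO Fq]) blast
    then show "\<exists>V'. open V' \<and> q \<in> V' \<and> V' \<subseteq> V \<and> (\<forall>r\<in>V'. ?F (fst i) (snd i) r = ?d (fst i) (snd i))"
      by blast
  qed blast
  then obtain V' where V': "open V'" "q \<in> V'" "V' \<subseteq> V"
    and F: "\<And>A B r. r \<in> V' \<Longrightarrow> ?F A B r = ?d A B"
    by auto
  have "coord_fields \<O> V' z (\<lambda>A. comb_field UNIV (m A) (\<lambda>X. br (z X)))"
    unfolding coord_fields_def
  proof (intro conjI allI ballI)
    have b: "vector_field \<O> V' (par X + 1) (br (z X))" for X
      by (rule vf_restrict[OF br_vf[OF V(1) zV] V'(3)])
    show "vector_field \<O> V' (par A) (comb_field UNIV (m A) (\<lambda>X. br (z X)))" for A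
      by (rule vf_comb_field[OF V'(1) finite_class.finite_UNIV hom_mono[OF V(1) V'(1,3) m] b]) auto
    show "comb_field UNIV (m A) (\<lambda>X. br (z X)) (z B) r = (if A = B then 1 else 0)" if "r \<in> V'" for A B r
      unfolding comb_field_def using F[OF that] .
  qed
  then show thesis by (rule that[OF V'(1,2) subset_trans[OF V'(3) V(2)]])
qed

end

section \<open>Non-degenerate submanifolds\<close>

text \<open>The set consists of right multiples of the two generators. It is also closed under left
  multiplication, because \<open>x\<close> is central and
  \<open>y * t = t * grade_inv y\<close>.\<close>

lemma adapted_ideal:
  fixes x t :: "'g::supercommutative_algebra"
  assumes "grade_inv x = x" "grade_inv t = - t"
  shows "ring_ideal {x * a + t * b | a b. True}" (is "ring_ideal ?I")
proof -
  have x: "y * x = x * y" for y using even_commute[OF assms(1)] by simp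
  have t: "y * t = t * grade_inv y" for y
  proof -
    \<comment> \<open>Twice the even part of \<open>y\<close> commutes with \<open>t\<close>; below,
      twice the odd part anticommutes with it.\<close>
    have "(y + grade_inv y) * t = t * (y + grade_inv y)"
      by (rule even_commute) (simp add: grade_inv_add grade_inv_grade_inv add.commute)
    moreover have "(y - grade_inv y) * t = - (t * (y - grade_inv y))"
      by (rule odd_anticommute) (simp_all add: grade_inv_diff grade_inv_grade_inv assms(2))
    ultimately have "(y + grade_inv y) * t + (y - grade_inv y) * t =
        t * (y + grade_inv y) - t * (y - grade_inv y)" by simp
    then have "2 *\<^sub>R (y * t) = 2 *\<^sub>R (t * grade_inv y)"
      by (simp add: scaleR_2 distrib_left distrib_right left_diff_distrib right_diff_distrib)
    then show ?thesis by simp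
  qed
  have "0 \<in> ?I" using mult_zero_right by (metis (mono_tags, lifting) add_0 mem_Collect_eq)
  moreover have "u + v \<in> ?I" if "u \<in> ?I" "v \<in> ?I" for u v
  proof -
    obtain a b a' b' where "u = x * a + t * b" "v = x * a' + t * b'" using \<open>u \<in> ?I\<close> \<open>v \<in> ?I\<close> by blast
    then have "u + v = x * (a + a') + t * (b + b')" by (simp add: distrib_left add_ac)
    then show ?thesis by blast
  qed
  moreover have "u * y \<in> ?I" "y * u \<in> ?I" if "u \<in> ?I" for u y
  proof -
    obtain a b where u: "u = x * a + t * b" using \<open>u \<in> ?I\<close> by blast
    then have "u * y = x * (a * y) + t * (b * y)" by (simp add: distrib_right mult.assoc)
    then show "u * y \<in> ?I" by blast
    have "y * u = x * (y * a) + t * (grade_inv y * b)"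
      unfolding u by (simp add: distrib_left mult.assoc[symmetric] x t)
    then show "y * u \<in> ?I" by blast
  qed
  ultimately show ?thesis unfolding ring_ideal_def by (intro conjI ballI allI)
qed

section \<open>Adapted charts and tangent fields\<close>

locale adapted_fields = coord_chart \<O> U \<phi> \<iota> \<theta> D + odd_symplectic \<O> br \<omega>
  for \<O> :: "'p::topological_space set \<Rightarrow> ('p, 'g::supercommutative_algebra) sect set"
    and U and \<phi> :: "'p \<Rightarrow> 'n::{finite,linorder} coord_space"
    and \<iota> :: "('n coord_space \<Rightarrow> real) \<Rightarrow> ('p, 'g) sect" and \<theta> :: "'n \<Rightarrow> ('p, 'g) sect"
    and D :: "'n + 'n \<Rightarrow> ('p, 'g) vfield" and br \<omega> +
  fixes C :: "'p set" and J :: "'p \<Rightarrow> 'g set" and c :: 'n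
  assumes adapted: "adapted_chart \<O> C J U \<phi> \<iota> \<theta> c"
    and nondegenerate: "\<And>q. q \<in> C \<inter> U \<Longrightarrow>
      invertible_mod (J q) (tangent_indices c) (\<lambda>A B. \<omega> (D A) (D B) q)"
begin

abbreviation "xc \<equiv> z (Inl c)"
abbreviation "tc \<equiv> z (Inr c)"

lemma J_eq: "q \<in> C \<inter> U \<Longrightarrow> J q = {xc q * a + tc q * b | a b. True}"
  using adapted unfolding adapted_chart_def coords_def by simp

lemma xc_hom: "xc \<in> hom_sect \<O> 0 U" and tc_hom: "tc \<in> hom_sect \<O> 1 U"
  using coords_hom[of "Inl c"] coords_hom[of "Inr c"] by simp_all

lemma J_ideal: "q \<in> C \<inter> U \<Longrightarrow> ring_ideal (J q)"
  unfolding J_eq by (rule adapted_ideal) (use hom_grade[OF xc_hom] hom_grade[OF tc_hom] in auto)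

lemma J_coords:
  assumes "q \<in> C \<inter> U"
  shows "xc q \<in> J q" "tc q \<in> J q"
proof -
  have "xc q = xc q * 1 + tc q * 0" "tc q = xc q * 0 + tc q * 1" by simp_all
  then show "xc q \<in> J q" "tc q \<in> J q" unfolding J_eq[OF assms] by blast+
qed

text \<open>\<open>J\<close> is generated by the two normal coordinates, so by the Leibniz rule
  tangency can be tested on them.\<close>

lemma tangent_toI:
  assumes V: "open V" "V \<subseteq> U" and X: "vector_field \<O> V p X"
    and t: "\<And>q. q \<in> C \<inter> V \<Longrightarrow> X xc q \<in> J q" "\<And>q. q \<in> C \<inter> V \<Longrightarrow> X tc q \<in> J q"
  shows "tangent_to \<O> C J V X"
  unfolding tangent_to_def eq_on_C_def
proof (intro allI impI ballI, elim conjE)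
  fix V' f q assume V': "open V'" "V' \<subseteq> V" and f: "f \<in> \<O> V'" and J: "\<forall>q\<in>C \<inter> V'. f q - 0 \<in> J q"
    and q: "q \<in> C \<inter> V'"
  have qU: "q \<in> C \<inter> U" using q V' V by blast
  note Jq = J_ideal[OF qU]
  have "f q \<in> J q" using J q by auto
  then obtain a b where ab: "f q = xc q * a + tc q * b" unfolding J_eq[OF qU] by blast
  obtain Va fa where a: "open Va" "q \<in> Va" "fa \<in> \<O> Va" "fa q = a" by (rule germ_section)
  obtain Vb fb where b: "open Vb" "q \<in> Vb" "fb \<in> \<O> Vb" "fb q = b" by (rule germ_section)
  define N where "N = V' \<inter> Va \<inter> Vb"
  have N: "open N" "N \<subseteq> V" and qN: "q \<in> N" and NV': "N \<subseteq> V'" and NU: "N \<subseteq> U"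
    and NVa: "N \<subseteq> Va" and NVb: "N \<subseteq> Vb"
    unfolding N_def using V V' a b q by auto
  have h: "xc \<in> hom_sect \<O> 0 N" "tc \<in> hom_sect \<O> 1 N"
    by (rule hom_mono[OF chart_open N(1) NU xc_hom], rule hom_mono[OF chart_open N(1) NU tc_hom])
  have O: "fa \<in> \<O> N" "fb \<in> \<O> N"
    by (rule O_mono[OF a(1) N(1) NVa a(3)], rule O_mono[OF b(1) N(1) NVb b(3)])
  have m: "(\<lambda>r. xc r * fa r) \<in> \<O> N" "(\<lambda>r. tc r * fb r) \<in> \<O> N"
    by (rule O_mult[OF N(1) hom_O[OF h(1)] O(1)], rule O_mult[OF N(1) hom_O[OF h(2)] O(2)])
  \<comment> \<open>Only the germ of \<open>f\<close> at \<open>q\<close> is known to have this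
    form, and the coefficients have been extended to sections near \<open>q\<close>; a vector field
    depends only on the germ.\<close>
  have "X f q = X (\<lambda>r. xc r * fa r + tc r * fb r) q"
    by (rule vf_germ[OF X N O_mono[OF V'(1) N(1) NV' f] O_add[OF N(1) m] qN]) (simp add: ab a b)
  also have "\<dots> = X xc q * fa q + (-1) ^ (p * 0) * xc q * X fa q +
      (X tc q * fb q + (-1) ^ (p * 1) * tc q * X fb q)"
    unfolding vf_add[OF X N m qN] vf_leibniz[OF X N h(1) O(1) qN] vf_leibniz[OF X N h(2) O(2) qN] ..
  also have "\<dots> \<in> J q"
    using q V' by (intro ideal_add[OF Jq] ideal_right[OF Jq] ideal_left[OF Jq] t J_coords[OF qU]) auto
  finally show "X f q - 0 \<in> J q" by simp
qed

lemma tangent_D: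
  assumes V: "open V" "V \<subseteq> U" and A: "A \<in> tangent_indices c"
  shows "tangent_to \<O> C J V (D A)"
proof (rule tangent_toI[OF V D_vf[OF V(2)]])
  fix q assume q: "q \<in> C \<inter> V"
  then have qU: "q \<in> C \<inter> U" using V by blast
  show "D A xc q \<in> J q" "D A tc q \<in> J q"
    using A qU ideal_0[OF J_ideal[OF qU]] by (auto simp: D_coord tangent_indices_def)
qed

lemma sum_indices: "(\<Sum>A\<in>UNIV. F A) = F (Inl c) + F (Inr c) + (\<Sum>A\<in>tangent_indices c. F A)"
  for F :: "'n + 'n \<Rightarrow> 'g"
proof -
  have "(\<Sum>A\<in>UNIV. F A) = (\<Sum>A\<in>{Inl c, Inr c}. F A) + (\<Sum>A\<in>tangent_indices c. F A)"
    unfolding tangent_indices_def by (subst sum.subset_diff[of "{Inl c, Inr c}"]) (simp_all add: add.commute)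
  then show ?thesis by simp
qed

lemma orthogonal_tangent:
  assumes "open V" "orthogonal_to \<O> \<omega> C J V Y" "vector_field \<O> V r T" "tangent_to \<O> C J V T" "q \<in> C \<inter> V"
  shows "\<omega> Y T q \<in> J q"
  using assms unfolding orthogonal_to_def eq_on_C_def by force

text \<open>The coordinate fields tangent to \<open>C\<close> pair with \<open>Y\<close> into
  \<open>J\<close>, which leaves the two normal terms in the expansion of \<open>Z\<close>.\<close>

lemma orthogonal_expand:
  assumes V: "open V" "V \<subseteq> U" and Y: "vector_field \<O> V p Y" and o: "orthogonal_to \<O> \<omega> C J V Y"
    and Z: "vector_field \<O> V r Z" and q: "q \<in> C \<inter> V"
  shows "\<omega> Z Y q - (Z xc q * \<omega> (D (Inl c)) Y q + Z tc q * \<omega> (D (Inr c)) Y q) \<in> J q"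
proof -
  have qV: "q \<in> V" and qU: "q \<in> C \<inter> U" using q V by blast+
  note Jq = J_ideal[OF qU]
  have "\<omega> (D A) Y q \<in> J q" if A: "A \<in> tangent_indices c" for A
    unfolding omega_antisym[OF V(1) D_vf[OF V(2)] Y qV]
    by (rule ideal_uminus[OF Jq ideal_left[OF Jq orthogonal_tangent[OF V(1) o D_vf[OF V(2)] tangent_D[OF V A] q]]])
  then have "(\<Sum>A\<in>tangent_indices c. Z (z A) q * \<omega> (D A) Y q) \<in> J q"
    by (intro ideal_sum[OF Jq] ideal_left[OF Jq])
  then show ?thesis
    unfolding tensorial_expand[OF V tensorial_omega[OF V(1) Y] Z qV] sum_indices by simp
qed

end

section \<open>The orthogonal plane and its frame \<open>H\<close>, \<open>\<Phi>\<close>\<close>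

locale normal_pair = adapted_fields \<O> U \<phi> \<iota> \<theta> D br \<omega> C J c
  for \<O> :: "'p::topological_space set \<Rightarrow> ('p, 'g::supercommutative_algebra) sect set"
    and U and \<phi> :: "'p \<Rightarrow> 'n::{finite,linorder} coord_space"
    and \<iota> :: "('n coord_space \<Rightarrow> real) \<Rightarrow> ('p, 'g) sect" and \<theta> :: "'n \<Rightarrow> ('p, 'g) sect"
    and D :: "'n + 'n \<Rightarrow> ('p, 'g) vfield" and br \<omega> C J c +
  fixes V :: "'p set" and H \<Phi> :: "('p, 'g) vfield"
  assumes V: "open V" "V \<subseteq> U"
    and H: "vector_field \<O> V 0 H" "orthogonal_to \<O> \<omega> C J V H"
    and \<Phi>: "vector_field \<O> V 1 \<Phi>" "orthogonal_to \<O> \<omega> C J V \<Phi>"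
    and omega_H: "\<And>q. q \<in> C \<inter> V \<Longrightarrow> \<omega> H \<Phi> q - 1 \<in> J q"
begin

lemma omega_\<Phi>_H: "q \<in> V \<Longrightarrow> \<omega> \<Phi> H q = - \<omega> H \<Phi> q"
  using omega_antisym[OF V(1) \<Phi>(1) H(1)] by simp

text \<open>Modulo \<open>J\<close>, the pairing of an orthogonal field with \<open>Z\<close> only involves the components of \<open>Z\<close>
  in the two directions normal to \<open>C\<close>. For \<open>Z = Y\<close> and the two orthogonal fields \<open>H\<close>, \<open>\<Phi>\<close> this is a
  system with invertible \<open>1|1\<close> matrix for the normal components of \<open>Y\<close>; the tangent ones are
  then controlled by the non-degeneracy of \<open>\<omega>\<close> along \<open>C\<close>.\<close>

lemma orthogonal_in_ideal:
  assumes Y: "vector_field \<O> V p Y" "orthogonal_to \<O> \<omega> C J V Y" and q: "q \<in> C \<inter> V"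
    and Y\<Phi>: "\<omega> Y \<Phi> q \<in> J q" and YH: "\<omega> Y H q \<in> J q"
  shows "Y (z A) q \<in> J q"
proof -
  have qV: "q \<in> V" and qU: "q \<in> C \<inter> U" using q V by blast+
  note Jq = J_ideal[OF qU]
  let ?e = "\<omega> (D (Inl c)) \<Phi> q" and ?r = "\<omega> (D (Inr c)) \<Phi> q"
    and ?s = "\<omega> (D (Inl c)) H q" and ?e' = "\<omega> (D (Inr c)) H q"
  have par: "vector_field \<O> V 0 (D (Inl c))" "vector_field \<O> V 1 (D (Inr c))"
    using D_vf[OF V(2), of "Inl c"] D_vf[OF V(2), of "Inr c"] by simp_all
  have g: "grade_inv ?e = ?e" "grade_inv ?r = - ?r" "grade_inv ?s = - ?s" "grade_inv ?e' = ?e'"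
    using hom_grade[OF omega_hom[OF V(1) par(1) \<Phi>(1)] qV] hom_grade[OF omega_hom[OF V(1) par(2) \<Phi>(1)] qV]
      hom_grade[OF omega_hom[OF V(1) par(1) H(1)] qV] hom_grade[OF omega_hom[OF V(1) par(2) H(1)] qV]
    by simp_all
  have gH: "grade_inv (H tc q) = - H tc q" "grade_inv (\<Phi> xc q) = - \<Phi> xc q" "grade_inv (\<Phi> tc q) = \<Phi> tc q"
    using hom_grade[OF comp_hom[OF V H(1), of "Inr c"] qV] hom_grade[OF comp_hom[OF V \<Phi>(1), of "Inl c"] qV]
      hom_grade[OF comp_hom[OF V \<Phi>(1), of "Inr c"] qV]
    by simp_all
  note n = orthogonal_expand[OF V \<Phi> _ q] orthogonal_expand[OF V H _ q]
  have y1: "Y xc q * ?e + Y tc q * ?r \<in> J q" using n(1)[OF Y(1)] Y\<Phi> ideal_cong[OF Jq] by blast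
  have y2: "Y xc q * ?s + Y tc q * ?e' \<in> J q" using n(2)[OF Y(1)] YH ideal_cong[OF Jq] by blast
  \<comment> \<open>The normalisation of \<open>H\<close> and \<open>\<Phi>\<close>, written in
    normal components: it supplies the two invertibility hypotheses of
    \<open>odd_elimination\<close>, with value 1 here and, by antisymmetry, -1 below.\<close>
  have h: "H xc q * ?e + H tc q * ?r - 1 \<in> J q"
    using ideal_diff[OF Jq omega_H[OF q] n(1)[OF H(1)]] by (simp add: algebra_simps)
  have "\<omega> \<Phi> H q + 1 \<in> J q"
    using ideal_uminus[OF Jq omega_H[OF q]] omega_\<Phi>_H[OF qV] by simp
  then have p: "\<Phi> xc q * ?s + \<Phi> tc q * ?e' + 1 \<in> J q"
    using ideal_diff[OF Jq _ n(2)[OF \<Phi>(1)], of "\<omega> \<Phi> H q + 1"] by (simp add: algebra_simps)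
  have Y0: "Y xc q \<in> J q" and Y1: "Y tc q \<in> J q"
    using odd_elimination[OF Jq y1 y2 h p g(1,4) gH(3) g(2,3) gH(1,2)] by blast+
  obtain N where N: "\<And>A B. A \<in> tangent_indices c \<Longrightarrow> B \<in> tangent_indices c \<Longrightarrow>
      (\<Sum>X\<in>tangent_indices c. \<omega> (D A) (D X) q * N X B) - (if A = B then 1 else 0) \<in> J q"
    using nondegenerate[OF qU] unfolding invertible_mod_def by blast
  \<comment> \<open>Orthogonality of \<open>Y\<close> to the tangent field \<open>D B\<close>, minus
    the normal contributions, which are already known to lie in \<open>J\<close>.\<close>
  have w: "(\<Sum>A\<in>tangent_indices c. Y (z A) q * \<omega> (D A) (D B) q) \<in> J q" if B: "B \<in> tangent_indices c" for B
  proof -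
    have YB: "\<omega> Y (D B) q \<in> J q"
      by (rule orthogonal_tangent[OF V(1) Y(2) D_vf[OF V(2)] tangent_D[OF V B] q])
    have e: "\<omega> Y (D B) q = Y xc q * \<omega> (D (Inl c)) (D B) q + Y tc q * \<omega> (D (Inr c)) (D B) q +
        (\<Sum>A\<in>tangent_indices c. Y (z A) q * \<omega> (D A) (D B) q)"
      unfolding tensorial_expand[OF V tensorial_omega[OF V(1) D_vf[OF V(2)]] Y(1) qV] sum_indices ..
    have "Y xc q * \<omega> (D (Inl c)) (D B) q + Y tc q * \<omega> (D (Inr c)) (D B) q \<in> J q"
      by (rule ideal_add[OF Jq ideal_right[OF Jq Y0] ideal_right[OF Jq Y1]])
    then have "\<omega> Y (D B) q -
        (Y xc q * \<omega> (D (Inl c)) (D B) q + Y tc q * \<omega> (D (Inr c)) (D B) q) \<in> J q"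
      by (rule ideal_diff[OF Jq YB])
    then show ?thesis unfolding e add_diff_cancel_left' .
  qed
  have t: "Y (z B) q \<in> J q" if B: "B \<in> tangent_indices c" for B
  proof -
    let ?T = "tangent_indices c"
    let ?d = "\<lambda>A. (if A = B then 1 else 0 :: 'g)"
    \<comment> \<open>The components of \<open>Y\<close> stand to the left of the matrix of
      \<omega>, so they are isolated by multiplying with its right inverse \<open>N\<close>.\<close>
    have "(\<Sum>X\<in>?T. (\<Sum>A\<in>?T. Y (z A) q * \<omega> (D A) (D X) q) * N X B) -
      (\<Sum>A\<in>?T. Y (z A) q * ((\<Sum>X\<in>?T. \<omega> (D A) (D X) q * N X B) - ?d A)) \<in> J q"
      by (intro ideal_diff[OF Jq] ideal_sum[OF Jq] ideal_right[OF Jq w] ideal_left[OF Jq N] B)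
    moreover have "(\<Sum>X\<in>?T. (\<Sum>A\<in>?T. Y (z A) q * \<omega> (D A) (D X) q) * N X B) =
        (\<Sum>A\<in>?T. Y (z A) q * (\<Sum>X\<in>?T. \<omega> (D A) (D X) q * N X B))"
      unfolding sum_distrib_left sum_distrib_right mult.assoc by (rule sum.swap)
    moreover have "(\<Sum>A\<in>?T. Y (z A) q * ?d A) = Y (z B) q"
      using B by (simp add: if_distrib[of "(*) _"] cong: if_cong)
    ultimately show ?thesis by (simp only: right_diff_distrib sum_subtractf) simp
  qed
  show ?thesis
    using t Y0 Y1 unfolding tangent_indices_def by (cases "A \<in> {Inl c, Inr c}") auto
qed

text \<open>The field \<open>?Y\<close>, the difference of \<open>X\<close> and \<omega>(X, \<Phi>)
  H - \<omega>(X, H) \<Phi>, is orthogonal to \<open>C\<close> and pairs with \<open>H\<close> and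
  \<open>\<Phi>\<close> into \<open>J q\<close>. By \<open>orthogonal_in_ideal\<close> its
  components lie in \<open>J q\<close>, hence so does its image under \<open>L\<close>. The minus
  sign reflects \<omega>(\<Phi>, H) = -1 modulo \<open>J q\<close>.\<close>

lemma orthogonal_decomposition:
  assumes X: "vector_field \<O> V p X" "orthogonal_to \<O> \<omega> C J V X" and q: "q \<in> C \<inter> V"
    and null: "\<omega> \<Phi> \<Phi> q \<in> J q" and L: "tensorial V L"
  shows "L X q - (\<omega> X \<Phi> q * L H q - \<omega> X H q * L \<Phi> q) \<in> J q"
proof -
  have qV: "q \<in> V" and qU: "q \<in> C \<inter> U" using q V by blast+
  note Jq = J_ideal[OF qU]
  let ?a = "\<omega> X \<Phi>" and ?b = "\<omega> X H"
  have a: "?a \<in> hom_sect \<O> (p + 1 + 1) V" by (rule omega_hom[OF V(1) X(1) \<Phi>(1)])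
  have b: "?b \<in> hom_sect \<O> (p + 0 + 1) V" by (rule omega_hom[OF V(1) X(1) H(1)])
  \<comment> \<open>The coefficients have parity \<open>p + 2\<close> and \<open>p + 1\<close>, and
    multiply an even and an odd field; both products have parity \<open>p\<close> modulo 2.\<close>
  have aH: "vector_field \<O> V p (scale_field ?a H)"
    using vf_scale_field[OF V(1) H(1) a] vf_parity[of "p + 1 + 1 + 0" p] by simp
  have b\<Phi>: "vector_field \<O> V p (scale_field ?b \<Phi>)"
    using vf_scale_field[OF V(1) \<Phi>(1) b] vf_parity[of "p + 0 + 1 + 1" p] by simp
  let ?K = "sub_field (scale_field ?a H) (scale_field ?b \<Phi>)"
  let ?Y = "sub_field X ?K"
  have K: "vector_field \<O> V p ?K" by (rule vf_sub_field[OF V(1) aH b\<Phi>])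
  have Y: "vector_field \<O> V p ?Y" by (rule vf_sub_field[OF V(1) X(1) K])
  \<comment> \<open>Stated for functionals on smaller open sets too, because orthogonality of
    \<open>?Y\<close> is tested against tangent fields on these.\<close>
  have exp: "M ?Y r = M X r - (?a r * M H r - ?b r * M \<Phi> r)"
    if W: "open W" "W \<subseteq> V" and M: "tensorial W M" and r: "r \<in> W" for W M r
  proof -
    note rs = vf_restrict[OF _ W(2)]
    have "M ?Y r = M X r - M ?K r"
      by (rule tensorial_sub_field[OF W(1) M rs[OF X(1)] rs[OF K] r])
    also have "M ?K r = M (scale_field ?a H) r - M (scale_field ?b \<Phi>) r"
      by (rule tensorial_sub_field[OF W(1) M rs[OF aH] rs[OF b\<Phi>] r])
    also have "\<dots> = ?a r * M H r - ?b r * M \<Phi> r"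
      unfolding tensorial_scale[OF M rs[OF H(1)] hom_mono[OF V(1) W a] r]
        tensorial_scale[OF M rs[OF \<Phi>(1)] hom_mono[OF V(1) W b] r] ..
    finally show ?thesis .
  qed
  have o: "orthogonal_to \<O> \<omega> C J V ?Y"
    unfolding orthogonal_to_def eq_on_C_def
  proof (intro allI impI ballI, elim conjE)
    fix W l T r assume W: "open W" "W \<subseteq> V" and T: "vector_field \<O> W l T" "tangent_to \<O> C J W T"
      and r: "r \<in> C \<inter> W"
    have rW: "r \<in> W" and rU: "r \<in> C \<inter> U" using r W V by blast+
    note Jr = J_ideal[OF rU]
    have "\<omega> Z T r \<in> J r" if "orthogonal_to \<O> \<omega> C J V Z" for Z
      using that W T r unfolding orthogonal_to_def eq_on_C_def by force
    note t = this[OF X(2)] this[OF H(2)] this[OF \<Phi>(2)]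
    have "\<omega> X T r - (?a r * \<omega> H T r - ?b r * \<omega> \<Phi> T r) \<in> J r"
      by (intro ideal_diff[OF Jr] ideal_left[OF Jr] t)
    then show "\<omega> ?Y T r - 0 \<in> J r"
      unfolding exp[OF W tensorial_omega[OF W(1) T(1)] rW] by simp
  qed
  have "\<omega> ?Y \<Phi> q = - (?a q * (\<omega> H \<Phi> q - 1)) + ?b q * \<omega> \<Phi> \<Phi> q"
    unfolding exp[OF V(1) subset_refl tensorial_omega[OF V(1) \<Phi>(1)] qV] by (simp add: right_diff_distrib)
  moreover have "- (?a q * (\<omega> H \<Phi> q - 1)) + ?b q * \<omega> \<Phi> \<Phi> q \<in> J q"
    by (intro ideal_add[OF Jq] ideal_uminus[OF Jq] ideal_left[OF Jq] omega_H q null)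
  ultimately have Y\<Phi>: "\<omega> ?Y \<Phi> q \<in> J q" by (simp only:)
  \<comment> \<open>On even fields \<omega> is antisymmetric, so an even field pairs to zero with
    itself.\<close>
  have "\<omega> H H q = - \<omega> H H q" using omega_antisym[OF V(1) H(1) H(1) qV] by simp
  then have "2 *\<^sub>R \<omega> H H q = 0" by (metis add.right_inverse scaleR_2)
  then have HH: "\<omega> H H q = 0" by simp
  have "\<omega> ?Y H q = - (?b q * (\<omega> H \<Phi> q - 1))"
    unfolding exp[OF V(1) subset_refl tensorial_omega[OF V(1) H(1)] qV] HH omega_\<Phi>_H[OF qV]
    by (simp add: right_diff_distrib)
  moreover have "- (?b q * (\<omega> H \<Phi> q - 1)) \<in> J q"
    by (intro ideal_uminus[OF Jq] ideal_left[OF Jq] omega_H q)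
  ultimately have YH: "\<omega> ?Y H q \<in> J q" by (simp only:)
  have "?Y (z A) q \<in> J q" for A by (rule orthogonal_in_ideal[OF Y o q Y\<Phi> YH])
  then have "L ?Y q \<in> J q" by (rule tensorial_in_ideal[OF V L Y qV Jq])
  then show ?thesis unfolding exp[OF V(1) subset_refl L qV] .
qed

end

section \<open>The connection term along the submanifold\<close>

context supersheaf
begin

lemma vf_diff:
  assumes "vector_field \<O> U p X" "open V" "V \<subseteq> U" "f \<in> \<O> V" "g \<in> \<O> V" "q \<in> V"
  shows "X (\<lambda>r. f r - g r) q = X f q - X g q"
proof -
  have "X (\<lambda>r. f r + (-1) *\<^sub>R g r) q = X f q + (-1) *\<^sub>R X g q"
    unfolding vf_add[OF assms(1,2,3,4) O_scaleR[OF assms(2,5)] assms(6)] vf_scaleR[OF assms(1,2,3,5,6)] ..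
  then show ?thesis by simp
qed

lemma orthogonal_restrict:
  "orthogonal_to \<O> \<omega> C J U X \<Longrightarrow> V \<subseteq> U \<Longrightarrow> orthogonal_to \<O> \<omega> C J V X"
  unfolding orthogonal_to_def by (meson subset_trans)

lemma tangent_restrict: "tangent_to \<O> C J U X \<Longrightarrow> V \<subseteq> U \<Longrightarrow> tangent_to \<O> C J V X"
  unfolding tangent_to_def by (meson subset_trans)

text \<open>Split \<open>X\<close> into \<open>P' X\<close> and \<open>X - P' X\<close>. Along
  \<open>C\<close> the first part is orthogonal and fixed by \<open>P\<close>, the second is tangent
  and killed by \<open>P\<close>.\<close>

lemma projector_unique_on_C:
  assumes U: "open U" and I: "\<And>q. q \<in> C \<Longrightarrow> ring_ideal (J q)"
    and P: "orthogonal_projector \<O> \<omega> C J U P" and P': "orthogonal_projector \<O> \<omega> C J U P'"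
    and X: "vector_field \<O> U p X" and f: "f \<in> \<O> U" and q: "q \<in> C \<inter> U"
  shows "P X f q - P' X f q \<in> J q"
proof -
  note p = P[unfolded orthogonal_projector_def, rule_format, OF conjI[OF U conjI[OF subset_refl]]]
  note p' = P'[unfolded orthogonal_projector_def, rule_format, OF conjI[OF U conjI[OF subset_refl X]]]
  let ?T = "sub_field X (P' X)"
  have v': "vector_field \<O> U p (P' X)" using p' by (rule conjunct1)
  have o': "orthogonal_to \<O> \<omega> C J U (P' X)" and t': "tangent_to \<O> C J U ?T" using p' by meson+
  have vT: "vector_field \<O> U p ?T" by (rule vf_sub_field[OF U X v'])
  have "add_field (P' X) ?T = X" unfolding add_field_def sub_field_def by simp
  moreover have "field_eq \<O> U (P (add_field (P' X) ?T)) (add_field (P (P' X)) (P ?T))"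
    using p[OF v'] vT by meson
  ultimately have "P X f q = P (P' X) f q + P ?T f q"
    using U f q unfolding field_eq_def add_field_def by auto
  moreover have "field_eq_on_C \<O> C J U (P (P' X)) (P' X)" using p[OF v'] o' by meson
  then have "P (P' X) f q - P' X f q \<in> J q"
    using U f q unfolding field_eq_on_C_def eq_on_C_def by blast
  moreover have "field_eq_on_C \<O> C J U (P ?T) (\<lambda>f q. 0)" using p[OF vT] t' by meson
  then have "P ?T f q - 0 \<in> J q"
    using U f q unfolding field_eq_on_C_def eq_on_C_def by blast
  ultimately show ?thesis
    using ideal_add[OF I, of q "P (P' X) f q - P' X f q" "P ?T f q"] q by (simp add: algebra_simps)
qed

end

section \<open>Trace and divergence along \<open>C\<close>\<close>

context coord_chart
begin

lemma tensorial_cong_on_C: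
  assumes V: "open V" "V \<subseteq> U" and L: "tensorial V L" and X: "vector_field \<O> V p X"
    and Y: "vector_field \<O> V p Y" and q: "q \<in> V" and I: "ring_ideal I"
    and c: "\<And>A. X (z A) q - Y (z A) q \<in> I"
  shows "L X q - L Y q \<in> I"
proof -
  have "sub_field X Y (z A) q \<in> I" for A unfolding sub_field_def by (rule c)
  then have "L (sub_field X Y) q \<in> I"
    by (rule tensorial_in_ideal[OF V L vf_sub_field[OF V(1) X Y] q I])
  then show ?thesis unfolding tensorial_sub_field[OF V(1) L X Y q] .
qed

end

context coord_connection
begin

text \<open>This form is tensorial in each field \<open>Y B\<close>, which allows these fields to be
  changed or decomposed. The two factors commute: their parities differ by one modulo 2, so one of
  them is even.\<close>

lemma trace_as_sum:
  assumes Y: "\<And>B. vector_field \<O> U (par B) (Y B)" and \<Psi>: "vector_field \<O> U 1 \<Psi>" and q: "q \<in> U"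
  shows "(\<Sum>A\<in>UNIV. \<Sum>B\<in>UNIV. nab (D A) \<Psi> (z B) q * Y B (z A) q) = (\<Sum>B\<in>UNIV. nab (Y B) \<Psi> (z B) q)"
proof -
  note V = chart_open subset_refl
  have "nab (D A) \<Psi> (z B) q * Y B (z A) q = Y B (z A) q * nab (D A) \<Psi> (z B) q" for A B
  proof -
    have n: "nab (D A) \<Psi> (z B) \<in> hom_sect \<O> (par A + 1 + par B) U"
      by (rule comp_hom[OF V nab_vf[OF chart_open D_vf[OF subset_refl] \<Psi>]])
    have y: "Y B (z A) \<in> hom_sect \<O> (par B + par A) U"
      by (rule comp_hom[OF V Y])
    have "even ((par A + 1 + par B) * (par B + par A))" by auto
    then show ?thesis using supercommute[OF hom_grade[OF n q] hom_grade[OF y q]] by simp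
  qed
  moreover have "nab (Y B) \<Psi> (z B) q = (\<Sum>A\<in>UNIV. Y B (z A) q * nab (D A) \<Psi> (z B) q)" for B
    by (rule tensorial_expand[OF V tensorial_nab[OF chart_open \<Psi> hom_O[OF coords_hom]] Y q])
  ultimately show ?thesis by (simp only:) (rule sum.swap)
qed

text \<open>\<open>\<rho> D\<close> is even, so the product rule carries no sign. The outcome
  separates a term of order zero in \<open>\<Psi>\<close> from the plain derivatives of its
  components.\<close>

lemma divergence_expand:
  assumes \<rho>: "\<rho> D \<in> hom_sect \<O> 0 U" "unit_elem (\<rho> D q)" and \<Psi>: "vector_field \<O> U 1 \<Psi>" and q: "q \<in> U"
  shows "divergence z D \<rho> \<Psi> q =
    (\<Sum>B\<in>UNIV. unit_inv (\<rho> D q) * D B (\<rho> D) q * \<Psi> (z B) q + D B (\<Psi> (z B)) q)"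
proof -
  obtain h where h: "\<rho> D q * h = 1" "h * \<rho> D q = 1" using \<rho>(2) unfolding unit_elem_def by blast
  have "unit_inv (\<rho> D q) = h"
    unfolding unit_inv_def
  proof (rule the_equality)
    show "k = h" if "\<rho> D q * k = 1 \<and> k * \<rho> D q = 1" for k
      using that h by (metis mult.assoc mult.left_neutral mult.right_neutral)
  qed (use h in simp)
  then have u: "unit_inv (\<rho> D q) * \<rho> D q = 1" using h by simp
  have "D B (\<lambda>r. \<rho> D r * \<Psi> (z B) r) q = D B (\<rho> D) q * \<Psi> (z B) q + \<rho> D q * D B (\<Psi> (z B)) q" for B
    using vf_leibniz[OF D_vf[OF subset_refl] chart_open subset_refl \<rho>(1)
        hom_O[OF comp_hom[OF chart_open subset_refl \<Psi>]] q] by simp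
  then show ?thesis
    unfolding divergence_def sum_distrib_left
    by (simp add: distrib_left mult.assoc[symmetric] u)
qed

text \<open>Terms of order zero in the difference of the two extensions lie in \<open>J\<close> at
  once. The derivative terms from trace and divergence combine to derivatives along
  \<open>D B - Y B\<close>, which is tangent to \<open>C\<close>.\<close>

lemma trace_minus_divergence_on_C:
  assumes Y: "\<And>B. vector_field \<O> U (par B) (Y B)" and t: "\<And>B. tangent_to \<O> C J U (sub_field (D B) (Y B))"
    and \<rho>: "\<rho> D \<in> hom_sect \<O> 0 U" "unit_elem (\<rho> D q)"
    and v: "vector_field \<O> U 1 \<Psi>\<^sub>1" "vector_field \<O> U 1 \<Psi>\<^sub>2"
    and e: "field_eq_on_C \<O> C J U \<Psi>\<^sub>1 \<Psi>\<^sub>2" and q: "q \<in> C \<inter> U" and I: "ring_ideal (J q)"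
  shows "((\<Sum>B\<in>UNIV. nab (Y B) \<Psi>\<^sub>1 (z B) q) - divergence z D \<rho> \<Psi>\<^sub>1 q) -
    ((\<Sum>B\<in>UNIV. nab (Y B) \<Psi>\<^sub>2 (z B) q) - divergence z D \<rho> \<Psi>\<^sub>2 q) \<in> J q"
proof -
  note V = chart_open subset_refl
  have qU: "q \<in> U" using q by blast
  have zO: "z B \<in> \<O> U" for B by (rule hom_O[OF coords_hom])
  let ?u = "unit_inv (\<rho> D q)"
  let ?g = "\<lambda>A B. nab (Y B) (D A) (z B) q"
  let ?s = "\<lambda>A B. (-1 :: 'g) ^ (par (B :: 'n + 'n) * (1 + par (A :: 'n + 'n)))"
  have n: "nab (Y B) \<Psi> (z B) q = Y B (\<Psi> (z B)) q + (\<Sum>A\<in>UNIV. ?s A B * \<Psi> (z A) q * ?g A B)"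
    if "vector_field \<O> U 1 \<Psi>" for \<Psi> B
    unfolding nab_expand[OF V Y that zO qU] D_coord[OF qU] sum.distrib
    by (simp add: if_distrib[of "(*) _"] cong: if_cong)
  have \<chi>: "\<forall>r\<in>C \<inter> U. (\<Psi>\<^sub>1 (z B) r - \<Psi>\<^sub>2 (z B) r) - 0 \<in> J r" for B
    using e zO[of B] chart_open unfolding field_eq_on_C_def eq_on_C_def by auto
  then have \<chi>q: "\<Psi>\<^sub>1 (z B) q - \<Psi>\<^sub>2 (z B) q \<in> J q" for B using q by simp
  have O: "\<Psi>\<^sub>1 (z B) \<in> \<O> U" "\<Psi>\<^sub>2 (z B) \<in> \<O> U" for B
    by (rule vf_O[OF v(1) V zO], rule vf_O[OF v(2) V zO])
  have dO: "(\<lambda>r. \<Psi>\<^sub>1 (z B) r - \<Psi>\<^sub>2 (z B) r) \<in> \<O> U" for B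
    using O_add[OF chart_open O(1)[of B] O_uminus[OF chart_open O(2)[of B]]]
    by (simp only: diff_conv_add_uminus)
  \<comment> \<open>The tangent field is applied to a component of the difference of the extensions,
    which vanishes along \<open>C\<close>.\<close>
  have d: "(D B (\<Psi>\<^sub>1 (z B)) q - D B (\<Psi>\<^sub>2 (z B)) q) - (Y B (\<Psi>\<^sub>1 (z B)) q - Y B (\<Psi>\<^sub>2 (z B)) q) \<in> J q" for B
  proof -
    have "sub_field (D B) (Y B) (\<lambda>r. \<Psi>\<^sub>1 (z B) r - \<Psi>\<^sub>2 (z B) r) q - 0 \<in> J q"
      using t[of B, unfolded tangent_to_def eq_on_C_def, rule_format, OF conjI[OF V] dO[of B] \<chi>[of B, rule_format] q]
      by simp
    then show ?thesis
      unfolding sub_field_def vf_diff[OF D_vf[OF subset_refl] V O qU] vf_diff[OF Y V O qU] by simp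
  qed
  have "(\<Sum>B\<in>UNIV. (\<Sum>A\<in>UNIV. ?s A B * (\<Psi>\<^sub>1 (z A) q - \<Psi>\<^sub>2 (z A) q) * ?g A B)
      - ?u * D B (\<rho> D) q * (\<Psi>\<^sub>1 (z B) q - \<Psi>\<^sub>2 (z B) q)
      - ((D B (\<Psi>\<^sub>1 (z B)) q - D B (\<Psi>\<^sub>2 (z B)) q) - (Y B (\<Psi>\<^sub>1 (z B)) q - Y B (\<Psi>\<^sub>2 (z B)) q))) \<in> J q"
    by (intro ideal_sum[OF I] ideal_diff[OF I] d ideal_left[OF I] ideal_right[OF I] \<chi>q)
  moreover have "((\<Sum>B\<in>UNIV. nab (Y B) \<Psi>\<^sub>1 (z B) q) - divergence z D \<rho> \<Psi>\<^sub>1 q) -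
    ((\<Sum>B\<in>UNIV. nab (Y B) \<Psi>\<^sub>2 (z B) q) - divergence z D \<rho> \<Psi>\<^sub>2 q) =
    (\<Sum>B\<in>UNIV. (\<Sum>A\<in>UNIV. ?s A B * (\<Psi>\<^sub>1 (z A) q - \<Psi>\<^sub>2 (z A) q) * ?g A B)
      - ?u * D B (\<rho> D) q * (\<Psi>\<^sub>1 (z B) q - \<Psi>\<^sub>2 (z B) q)
      - ((D B (\<Psi>\<^sub>1 (z B)) q - D B (\<Psi>\<^sub>2 (z B)) q) - (Y B (\<Psi>\<^sub>1 (z B)) q - Y B (\<Psi>\<^sub>2 (z B)) q)))"
    unfolding n[OF v(1)] n[OF v(2)] divergence_expand[where \<rho> = \<rho>, OF \<rho> v(1) qU]
      divergence_expand[where \<rho> = \<rho>, OF \<rho> v(2) qU]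
      right_diff_distrib left_diff_distrib sum.distrib sum_subtractf
    by (simp only: algebra_simps)
  ultimately show ?thesis by (simp only:)
qed

end

text \<open>The trace is written in the coordinates on \<open>U\<close>, whereas the decomposition
  of \<open>Y B\<close> rests on an adapted chart on \<open>V\<close>; the link is that the
  difference of the connections is a tensorial functional. Parallelism of \<omega> enters through
  the two equations \<open>par\<close> at the point \<open>q\<close>.\<close>

lemma flat_difference_trace:
  fixes \<O> :: "'p::topological_space set \<Rightarrow> ('p, 'g::supercommutative_algebra) sect set"
    and D :: "'n::{finite,linorder} + 'n \<Rightarrow> ('p, 'g) vfield"
  assumes c1: "coord_connection \<O> U \<phi> \<iota> \<theta> D nab\<^sub>1" and c2: "coord_connection \<O> U \<phi> \<iota> \<theta> D nab\<^sub>2"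
    and np: "normal_pair \<O> V \<phi>' \<iota>' \<theta>' D' br \<omega> C J c V H \<Phi>" and VU: "V \<subseteq> U"
    and tf: "torsion_free \<O> nab\<^sub>1" "torsion_free \<O> nab\<^sub>2" and q: "q \<in> C \<inter> V"
    and par: "H (\<omega> \<Phi> \<Phi>) q = 2 * \<omega> (nab\<^sub>1 H \<Phi>) \<Phi> q" "H (\<omega> \<Phi> \<Phi>) q = 2 * \<omega> (nab\<^sub>2 H \<Phi>) \<Phi> q"
    and Y: "\<And>B. vector_field \<O> V (par B) (Y B)" "\<And>B. orthogonal_to \<O> \<omega> C J V (Y B)"
      "\<And>B. tangent_to \<O> C J V (sub_field (D B) (Y B))"
    and null: "\<omega> \<Phi> \<Phi> q \<in> J q"
  shows "(\<Sum>B\<in>UNIV. nab\<^sub>1 (Y B) \<Phi> (coords \<iota> \<theta> B) q) - (\<Sum>B\<in>UNIV. nab\<^sub>2 (Y B) \<Phi> (coords \<iota> \<theta> B) q) \<in> J q"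
proof -
  interpret c1: coord_connection \<O> U \<phi> \<iota> \<theta> D nab\<^sub>1 by (rule c1)
  interpret c2: coord_connection \<O> U \<phi> \<iota> \<theta> D nab\<^sub>2 by (rule c2)
  interpret np: normal_pair \<O> V \<phi>' \<iota>' \<theta>' D' br \<omega> C J c V H \<Phi> by (rule np)
  let ?z = "coords \<iota> \<theta>"
  note V = np.V(1) VU
  have qV: "q \<in> V" using q by blast
  note I = np.J_ideal[OF q]
  have zO: "?z B \<in> \<O> V" for B by (rule c1.hom_O[OF c1.z_hom[OF V]])
  let ?L = "\<lambda>B X q. nab\<^sub>1 X \<Phi> (?z B) q - nab\<^sub>2 X \<Phi> (?z B) q"
  have L: "c1.tensorial V (?L B)" for B
    by (rule c1.tensorial_diff[OF c1.tensorial_nab[OF V(1) np.\<Phi>(1) zO] c2.tensorial_nab[OF V(1) np.\<Phi>(1) zO]])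
  \<comment> \<open>For an odd field paired with itself the sign is -1, so both sides of the torsion
    identity are doubled: the covariant derivative of \<open>\<Phi>\<close> along itself is its
    square, whatever the connection.\<close>
  have self: "nab \<Phi> \<Phi> f q = \<Phi> (\<Phi> f) q" if "torsion_free \<O> nab" "f \<in> \<O> V" for nab f
  proof -
    have "nab \<Phi> \<Phi> f q - (-1) ^ (1 * 1) * nab \<Phi> \<Phi> f q = \<Phi> (\<Phi> f) q - (-1) ^ (1 * 1) * \<Phi> (\<Phi> f) q"
      using that(1)[unfolded torsion_free_def, rule_format, OF conjI[OF V(1) conjI[OF np.\<Phi>(1) np.\<Phi>(1)]]]
        V(1) that(2) qV unfolding field_eq_def by blast
    then have "2 *\<^sub>R nab \<Phi> \<Phi> f q = 2 *\<^sub>R \<Phi> (\<Phi> f) q" by (simp add: scaleR_2)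
    then show ?thesis by simp
  qed
  have L\<Phi>: "?L B \<Phi> q = 0" for B by (simp add: self[OF tf(1) zO] self[OF tf(2) zO])
  have Lc: "?L B (Y B) q - \<omega> (Y B) \<Phi> q * ?L B H q \<in> J q" for B
    using np.orthogonal_decomposition[OF Y(1) Y(2) q null L, of B B] unfolding L\<Phi> by simp
  \<comment> \<open>The two fields differ by a tangent one, which \<open>\<Phi>\<close> annihilates
    along \<open>C\<close>.\<close>
  have yd: "\<omega> (Y B) \<Phi> q - \<omega> (D B) \<Phi> q \<in> J q" for B
  proof -
    have v: "vector_field \<O> V (par B) (sub_field (D B) (Y B))"
      by (rule c1.vf_sub_field[OF V(1) c1.D_vf[OF V(2)] Y(1)])
    have "\<omega> \<Phi> (sub_field (D B) (Y B)) q \<in> J q"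
      by (rule np.orthogonal_tangent[OF V(1) np.\<Phi>(2) v Y(3) q])
    then have "\<omega> (sub_field (D B) (Y B)) \<Phi> q \<in> J q"
      unfolding np.omega_antisym[OF V(1) v np.\<Phi>(1) qV]
      by (intro ideal_uminus[OF I] ideal_left[OF I])
    then have "\<omega> (D B) \<Phi> q - \<omega> (Y B) \<Phi> q \<in> J q"
      unfolding c1.tensorial_sub_field[OF V(1) np.tensorial_omega[OF V(1) np.\<Phi>(1)] c1.D_vf[OF V(2)] Y(1) qV] .
    then show ?thesis using ideal_uminus[OF I] by fastforce
  qed
  have n1: "vector_field \<O> V 1 (nab\<^sub>1 H \<Phi>)" and n2: "vector_field \<O> V 1 (nab\<^sub>2 H \<Phi>)"
    using c1.nab_vf[OF V(1) np.H(1) np.\<Phi>(1)] c2.nab_vf[OF V(1) np.H(1) np.\<Phi>(1)] by simp_all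
  let ?Z = "sub_field (nab\<^sub>1 H \<Phi>) (nab\<^sub>2 H \<Phi>)"
  have Z: "vector_field \<O> V 1 ?Z" by (rule c1.vf_sub_field[OF V(1) n1 n2])
  \<comment> \<open>Both covariant derivatives pair with \<open>\<Phi>\<close> to half of the same
    derivative, so their difference pairs to zero exactly and not just modulo
    \<open>J q\<close>.\<close>
  have "2 *\<^sub>R \<omega> (nab\<^sub>1 H \<Phi>) \<Phi> q = 2 *\<^sub>R \<omega> (nab\<^sub>2 H \<Phi>) \<Phi> q"
    using par by (simp add: scaleR_2 mult_2)
  then have "\<omega> ?Z \<Phi> q = 0"
    unfolding c1.tensorial_sub_field[OF V(1) np.tensorial_omega[OF V(1) np.\<Phi>(1)] n1 n2 qV] by simp
  \<comment> \<open>The parities of the two factors differ by one modulo 2, so one factor is even.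
    After the exchange the sum is the expansion of the pairing of \<open>?Z\<close> with
    \<open>\<Phi>\<close>.\<close>
  moreover have "\<omega> (D B) \<Phi> q * ?L B H q = ?Z (?z B) q * \<omega> (D B) \<Phi> q" for B
  proof -
    have w: "\<omega> (D B) \<Phi> \<in> hom_sect \<O> (par B + 1 + 1) V"
      by (rule np.omega_hom[OF V(1) c1.D_vf[OF V(2)] np.\<Phi>(1)])
    have zz: "?Z (?z B) \<in> hom_sect \<O> (1 + par B) V" by (rule c1.comp_hom[OF V Z])
    have "even ((par B + 1 + 1) * (1 + par B))" by auto
    then have "\<omega> (D B) \<Phi> q * ?Z (?z B) q = ?Z (?z B) q * \<omega> (D B) \<Phi> q"
      using supercommute[OF c1.hom_grade[OF w qV] c1.hom_grade[OF zz qV]] by simp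
    then show ?thesis by (simp only: sub_field_def)
  qed
  then have "(\<Sum>B\<in>UNIV. \<omega> (D B) \<Phi> q * ?L B H q) = \<omega> ?Z \<Phi> q"
    unfolding c1.tensorial_expand[OF V np.tensorial_omega[OF V(1) np.\<Phi>(1)] Z qV] by simp
  ultimately have s0: "(\<Sum>B\<in>UNIV. \<omega> (D B) \<Phi> q * ?L B H q) = 0" by simp
  have "?L B (Y B) q - \<omega> (D B) \<Phi> q * ?L B H q \<in> J q" for B
    using ideal_add[OF I Lc ideal_right[OF I yd], of B B "?L B H q"] by (simp add: left_diff_distrib)
  then have "(\<Sum>B\<in>UNIV. ?L B (Y B) q - \<omega> (D B) \<Phi> q * ?L B H q) \<in> J q"
    by (rule ideal_sum[OF I])
  then show ?thesis using s0 by (simp add: sum_subtractf)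
qed

section \<open>Local data around a point of \<open>C\<close>\<close>

text \<open>An adapted chart comes from the submanifold and remains adapted on smaller open sets. It
  is shrunk first into \<open>U\<close> and then until coordinate fields exist; these are built from
  the non-degenerate bracket.\<close>

lemma local_adapted_fields:
  fixes \<O> :: "'p::{t2_space,second_countable_topology} set \<Rightarrow>
      ('p, 'g::supercommutative_algebra) sect set"
  assumes os: "odd_symplectic_supermanifold TYPE('n::{finite,linorder}) \<O> br \<omega>"
    and nd: "nondegenerate_submanifold TYPE('n::{finite,linorder}) \<O> \<omega> C J" and U: "open U" "q \<in> C \<inter> U"
  obtains V and \<phi> :: "'p \<Rightarrow> 'n::{finite,linorder} coord_space" and \<iota> \<theta> D c
  where "open V" "q \<in> V" "V \<subseteq> U" "adapted_fields \<O> V \<phi> \<iota> \<theta> D br \<omega> C J c"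
proof -
  have sh: "structure_sheaf \<O>" and b: "odd_poisson_bracket \<O> br"
    and nb: "nondegenerate_bracket TYPE('n) \<O> br" and f: "symplectic_form_of \<O> br \<omega>"
    using os unfolding odd_symplectic_supermanifold_def supermanifold_def by simp_all
  have sub: "submanifold TYPE('n) \<O> C J"
    using nd unfolding nondegenerate_submanifold_def by (rule conjunct1)
  obtain U' and \<phi> :: "'p \<Rightarrow> 'n coord_space" and \<iota> \<theta> c
    where a: "q \<in> U'" "adapted_chart \<O> C J U' \<phi> \<iota> \<theta> c"
    using sub[unfolded submanifold_def] U(2) by blast
  have ch: "chart \<O> U' \<phi> \<iota> \<theta>" using a(2) unfolding adapted_chart_def by (rule conjunct1)
  have s0: "supersheaf \<O>" using sh by unfold_locales
  interpret c': super_chart \<O> U' \<phi> \<iota> \<theta>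
    by (intro super_chart.intro super_chart_axioms.intro s0 ch)
  have W: "open (U' \<inter> U)" "U' \<inter> U \<subseteq> U'" using c'.chart_open U(1) by auto
  have restrict: "adapted_chart \<O> C J V \<phi> \<iota> \<theta> c" if V: "open V" "V \<subseteq> U'" for V
    unfolding adapted_chart_def
  proof (intro conjI c'.chart_restrict[OF V])
    have e: "C \<inter> U' = {q \<in> U'. \<phi> q $ c = 0}"
      and j: "\<forall>q\<in>C \<inter> U'. J q = {\<iota> (\<lambda>x. x $ c) q * a + \<theta> c q * b | a b. True}"
      using a(2) unfolding adapted_chart_def by blast+
    show "C \<inter> V = {q \<in> V. \<phi> q $ c = 0}" using e V(2) by blast
    show "\<forall>q\<in>C \<inter> V. J q = {\<iota> (\<lambda>x. x $ c) q * a + \<theta> c q * b | a b. True}" using j V(2) by blast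
  qed
  have chW: "chart \<O> (U' \<inter> U) \<phi> \<iota> \<theta>" by (rule c'.chart_restrict[OF W])
  have od: "odd_symplectic \<O> br \<omega>"
    by (intro odd_symplectic.intro odd_symplectic_axioms.intro s0 b f)
  interpret w: symplectic_chart \<O> "U' \<inter> U" \<phi> \<iota> \<theta> br \<omega>
    by (intro symplectic_chart.intro super_chart.intro super_chart_axioms.intro s0 chW od)
  have qW: "q \<in> U' \<inter> U" using a(1) U(2) by blast
  have inv: "invertible_mod {0} UNIV (\<lambda>A B. br (coords \<iota> \<theta> A) (coords \<iota> \<theta> B) q)"
    using nb[unfolded nondegenerate_bracket_def] chW qW by blast
  obtain V D where V: "open V" "q \<in> V" "V \<subseteq> U' \<inter> U" "coord_fields \<O> V (coords \<iota> \<theta>) D"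
    by (rule w.local_coord_fields[OF inv qW])
  have V': "V \<subseteq> U'" "V \<subseteq> U" using V(3) by blast+
  have aV: "adapted_chart \<O> C J V \<phi> \<iota> \<theta> c" by (rule restrict[OF V(1) V'(1)])
  have "\<forall>q\<in>C \<inter> V. invertible_mod (J q) (tangent_indices c) (\<lambda>A B. \<omega> (D A) (D B) q)"
    using nd[unfolded nondegenerate_submanifold_def] aV V(4) by blast
  then have "adapted_fields \<O> V \<phi> \<iota> \<theta> D br \<omega> C J c"
    by (intro adapted_fields.intro coord_chart.intro coord_chart_axioms.intro super_chart.intro
      super_chart_axioms.intro s0 c'.chart_restrict[OF V(1) V'(1)] V(4) od adapted_fields_axioms.intro aV)
      blast
  with that V(1,2) V'(2) show thesis by blast
qed

text \<open>\<open>J\<close> is given as a family of sets of germs; in an adapted chart each set is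
  generated by an even and an odd coordinate.\<close>

lemma submanifold_ideal:
  fixes \<O> :: "'p::{t2_space,second_countable_topology} set \<Rightarrow>
      ('p, 'g::supercommutative_algebra) sect set"
  assumes os: "odd_symplectic_supermanifold TYPE('n::{finite,linorder}) \<O> br \<omega>"
    and nd: "nondegenerate_submanifold TYPE('n::{finite,linorder}) \<O> \<omega> C J" and r: "r \<in> C"
  shows "ring_ideal (J r)"
proof -
  have r': "r \<in> C \<inter> UNIV" using r by simp
  obtain V \<phi> \<iota> \<theta> D c where V: "r \<in> V"
    and a: "adapted_fields \<O> V (\<phi> :: 'p \<Rightarrow> 'n coord_space) \<iota> \<theta> D br \<omega> C J c"
    by (rule local_adapted_fields[OF os nd open_UNIV r'])
  show ?thesis by (rule adapted_fields.J_ideal[OF a]) (use r V in blast)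
qed

text \<open>Parallelism of \<omega> is restated without coordinates, so that it can be used at the
  same time for two connections that are flat in different Darboux charts.\<close>

lemma darboux_flat_parallel:
  fixes \<O> :: "'p::{t2_space,second_countable_topology} set \<Rightarrow>
      ('p, 'g::supercommutative_algebra) sect set"
  assumes od: "odd_symplectic \<O> br \<omega>" and df: "darboux_flat TYPE('n::{finite,linorder}) \<O> br nab"
  obtains V where "open V" "q \<in> V"
    "\<And>W H Y r. open W \<Longrightarrow> W \<subseteq> V \<Longrightarrow> vector_field \<O> W 0 H \<Longrightarrow> vector_field \<O> W 1 Y \<Longrightarrow> r \<in> W \<Longrightarrow>
      H (\<omega> Y Y) r = 2 * \<omega> (nab H Y) Y r"
proof -
  interpret odd_symplectic \<O> br \<omega> by (rule od)
  obtain V and \<phi> :: "'p \<Rightarrow> 'n coord_space" and \<iota> \<theta> D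
    where V: "q \<in> V" "chart \<O> V \<phi> \<iota> \<theta>" "darboux_coords br V (coords \<iota> \<theta>)"
      "coord_fields \<O> V (coords \<iota> \<theta>) D" "\<And>A B. field_eq \<O> V (nab (D A) (D B)) (\<lambda>f q. 0)"
    and an: "affine_connection \<O> nab"
    using df unfolding darboux_flat_def by metis
  interpret darboux_chart \<O> V \<phi> \<iota> \<theta> D nab br \<omega>
    by unfold_locales (use V an in auto)
  show thesis using that[OF chart_open V(1)] omega_parallel by blast
qed

text \<open>The data are exchanged one at a time: first the connection (\<open>diff\<close>), then
  the extension of \<open>\<Psi>\<close> (\<open>ext\<close>), finally the projector. Each exchange
  alters the value by an element of \<open>J q\<close>.\<close>

lemma A_conn_independent:
  fixes \<O> :: "'p::{t2_space,second_countable_topology} set \<Rightarrow>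
      ('p, 'g::supercommutative_algebra) sect set"
    and \<phi> :: "'p \<Rightarrow> 'n::{finite,linorder} coord_space"
  assumes os: "odd_symplectic_supermanifold TYPE('n) \<O> br \<omega>"
    and vol: "volume_element \<O> \<rho>"
    and nd: "nondegenerate_submanifold TYPE('n) \<O> \<omega> C J"
    and df: "darboux_flat TYPE('n) \<O> br nab\<^sub>1" "darboux_flat TYPE('n) \<O> br nab\<^sub>2"
    and ch: "chart \<O> U \<phi> \<iota> \<theta>" and D: "coord_fields \<O> U (coords \<iota> \<theta>) D"
    and \<Psi>: "admissible_field \<O> \<omega> C J U (coords \<iota> \<theta>) \<Psi>"
    and H: "normal_companion \<O> \<omega> C J U \<Psi> H"
    and v: "vector_field \<O> U 1 \<Psi>\<^sub>1" "vector_field \<O> U 1 \<Psi>\<^sub>2"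
    and e: "field_eq_on_C \<O> C J U \<Psi>\<^sub>1 \<Psi>" "field_eq_on_C \<O> C J U \<Psi>\<^sub>2 \<Psi>"
    and P: "orthogonal_projector \<O> \<omega> C J U \<P>\<^sub>1" "orthogonal_projector \<O> \<omega> C J U \<P>\<^sub>2"
    and q: "q \<in> C \<inter> U"
  shows "A_conn (coords \<iota> \<theta>) D \<rho> \<P>\<^sub>1 nab\<^sub>1 \<Psi>\<^sub>1 q - A_conn (coords \<iota> \<theta>) D \<rho> \<P>\<^sub>2 nab\<^sub>2 \<Psi>\<^sub>2 q \<in> J q"
proof -
  let ?z = "coords \<iota> \<theta>"
  have s0: "supersheaf \<O>" and od: "odd_symplectic \<O> br \<omega>"
    using os unfolding odd_symplectic_supermanifold_def supermanifold_def
    by (simp_all add: supersheaf.intro odd_symplectic.intro odd_symplectic_axioms.intro)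
  have an: "affine_connection \<O> nab\<^sub>1" "affine_connection \<O> nab\<^sub>2"
    and tf: "torsion_free \<O> nab\<^sub>1" "torsion_free \<O> nab\<^sub>2"
    using df unfolding darboux_flat_def by simp_all
  interpret od: odd_symplectic \<O> br \<omega> by (rule od)
  have sc: "super_chart \<O> U \<phi> \<iota> \<theta>" by (intro super_chart.intro super_chart_axioms.intro s0 ch)
  have cc: "coord_chart \<O> U \<phi> \<iota> \<theta> D" by (intro coord_chart.intro coord_chart_axioms.intro sc D)
  have c1: "coord_connection \<O> U \<phi> \<iota> \<theta> D nab\<^sub>1" and c2: "coord_connection \<O> U \<phi> \<iota> \<theta> D nab\<^sub>2"
    by (intro coord_connection.intro connection.intro connection_axioms.intro cc s0 an)+
  interpret c1: coord_connection \<O> U \<phi> \<iota> \<theta> D nab\<^sub>1 by (rule c1)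
  interpret c2: coord_connection \<O> U \<phi> \<iota> \<theta> D nab\<^sub>2 by (rule c2)
  note UU = c1.chart_open subset_refl
  have qU: "q \<in> U" using q by blast
  note I = submanifold_ideal[OF os nd]
  have Iq: "ring_ideal (J q)" using I q by blast
  have v\<Psi>: "vector_field \<O> U 1 \<Psi>" and o\<Psi>: "orthogonal_to \<O> \<omega> C J U \<Psi>"
    and n\<Psi>: "eq_on_C C J U (\<omega> \<Psi> \<Psi>) (\<lambda>q. 0)"
    using \<Psi> unfolding admissible_field_def by simp_all
  have vH: "vector_field \<O> U 0 H" and oH: "orthogonal_to \<O> \<omega> C J U H"
    and nH: "eq_on_C C J U (\<omega> H \<Psi>) (\<lambda>q. 1)"
    using H unfolding normal_companion_def by simp_all
  have P1: "vector_field \<O> U (par B) (\<P>\<^sub>1 (D B))" "orthogonal_to \<O> \<omega> C J U (\<P>\<^sub>1 (D B))"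
    "tangent_to \<O> C J U (sub_field (D B) (\<P>\<^sub>1 (D B)))" for B
    using P(1)[unfolded orthogonal_projector_def, rule_format, OF conjI[OF UU(1) conjI[OF UU(2) c1.D_vf[OF subset_refl]]], of B]
    by meson+
  have P2: "vector_field \<O> U (par B) (\<P>\<^sub>2 (D B))" for B
    using P(2)[unfolded orthogonal_projector_def, rule_format, OF conjI[OF UU(1) conjI[OF UU(2) c1.D_vf[OF subset_refl]]], of B]
    by meson
  have zO: "?z B \<in> \<O> U" for B by (rule od.hom_O[OF c1.coords_hom])
  have comp: "\<Psi>\<^sub>1 (?z A) r - \<Psi> (?z A) r \<in> J r" "\<Psi>\<^sub>2 (?z A) r - \<Psi> (?z A) r \<in> J r" if "r \<in> C \<inter> U" for A r
    using e[unfolded field_eq_on_C_def eq_on_C_def, rule_format, OF conjI[OF UU] zO that] by simp_all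
  have e12: "field_eq_on_C \<O> C J U \<Psi>\<^sub>1 \<Psi>\<^sub>2"
    unfolding field_eq_on_C_def eq_on_C_def
  proof (intro allI impI ballI, elim conjE)
    fix V f r assume "open V" "V \<subseteq> U" "f \<in> \<O> V" "r \<in> C \<inter> V"
    note a = this
    have "ring_ideal (J r)" using a I by blast
    moreover have "\<Psi>\<^sub>1 f r - \<Psi> f r \<in> J r" "\<Psi>\<^sub>2 f r - \<Psi> f r \<in> J r"
      using e[unfolded field_eq_on_C_def eq_on_C_def, rule_format, OF conjI[OF a(1,2)] a(3,4)] by simp_all
    ultimately show "\<Psi>\<^sub>1 f r - \<Psi>\<^sub>2 f r \<in> J r"
      using ideal_diff[of "J r" "\<Psi>\<^sub>1 f r - \<Psi> f r" "\<Psi>\<^sub>2 f r - \<Psi> f r"] by simp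
  qed
  \<comment> \<open>\<open>\<Psi>\<^sub>1\<close> and \<open>\<Psi>\<close> have the same components
    along \<open>C\<close>. Hence \<open>\<Psi>\<^sub>1\<close> inherits from \<open>\<Psi>\<close>
    the orthogonality to \<open>C\<close>, the normalisation against \<open>H\<close> and, at
    \<open>q\<close>, the nullity.\<close>
  have w: "\<omega> \<Psi>\<^sub>1 Y r - \<omega> \<Psi> Y r \<in> J r"
    if "open V" "V \<subseteq> U" "vector_field \<O> V p Y" "r \<in> C \<inter> V" for V p Y r
  proof (rule c1.tensorial_cong_on_C[OF that(1,2) od.tensorial_omega[OF that(1,3)]
        od.vf_restrict[OF v(1) that(2)] od.vf_restrict[OF v\<Psi> that(2)]])
    show "r \<in> V" "ring_ideal (J r)" using that I by blast+
    show "\<Psi>\<^sub>1 (?z A) r - \<Psi> (?z A) r \<in> J r" for A using comp that by blast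
  qed
  have o1: "orthogonal_to \<O> \<omega> C J U \<Psi>\<^sub>1"
    unfolding orthogonal_to_def eq_on_C_def
  proof (intro allI impI ballI, elim conjE)
    fix V p Y r assume a: "open V" "V \<subseteq> U" "vector_field \<O> V p Y" "tangent_to \<O> C J V Y" "r \<in> C \<inter> V"
    then have "\<omega> \<Psi> Y r \<in> J r" using o\<Psi> unfolding orthogonal_to_def eq_on_C_def by force
    moreover have "ring_ideal (J r)" using a I by blast
    ultimately show "\<omega> \<Psi>\<^sub>1 Y r - 0 \<in> J r" using w[OF a(1,2,3,5)] ideal_cong by fastforce
  qed
  have H1: "\<omega> H \<Psi>\<^sub>1 r - 1 \<in> J r" if r: "r \<in> C \<inter> U" for r
  proof -
    have "r \<in> U" "ring_ideal (J r)" using r I by blast+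
    have "\<omega> H \<Psi>\<^sub>1 r - \<omega> H \<Psi> r = - (\<omega> \<Psi>\<^sub>1 H r - \<omega> \<Psi> H r)"
      using od.omega_antisym[OF UU(1) vH v(1) \<open>r \<in> U\<close>] od.omega_antisym[OF UU(1) vH v\<Psi> \<open>r \<in> U\<close>] by simp
    then have "\<omega> H \<Psi>\<^sub>1 r - \<omega> H \<Psi> r \<in> J r"
      using ideal_uminus[OF \<open>ring_ideal (J r)\<close> w[OF UU vH r]] by (simp only:)
    moreover have "\<omega> H \<Psi> r - 1 \<in> J r" using nH r unfolding eq_on_C_def by blast
    ultimately show ?thesis by (rule ideal_trans[OF \<open>ring_ideal (J r)\<close>])
  qed
  have null: "\<omega> \<Psi>\<^sub>1 \<Psi>\<^sub>1 q \<in> J q"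
  proof -
    have "\<omega> \<Psi> \<Psi> q \<in> J q" using n\<Psi> q unfolding eq_on_C_def by force
    then have "\<omega> \<Psi>\<^sub>1 \<Psi> q \<in> J q" using w[OF UU v\<Psi> q] ideal_cong[OF Iq] by blast
    \<comment> \<open>Symmetry of \<omega> on odd fields brings the second slot into the first, so
      that \<open>w\<close> can be applied once more.\<close>
    moreover have "\<omega> \<Psi> \<Psi>\<^sub>1 q = \<omega> \<Psi>\<^sub>1 \<Psi> q"
      using od.omega_antisym[OF UU(1) v\<Psi> v(1) qU] by simp
    ultimately show ?thesis using w[OF UU v(1) q] ideal_cong[OF Iq] by metis
  qed
  obtain U\<^sub>1 where U1: "open U\<^sub>1" "q \<in> U\<^sub>1"
    "\<And>W H Y r. open W \<Longrightarrow> W \<subseteq> U\<^sub>1 \<Longrightarrow> vector_field \<O> W 0 H \<Longrightarrow> vector_field \<O> W 1 Y \<Longrightarrow> r \<in> W \<Longrightarrow>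
      H (\<omega> Y Y) r = 2 * \<omega> (nab\<^sub>1 H Y) Y r"
    using darboux_flat_parallel[OF od df(1)] by blast
  obtain U\<^sub>2 where U2: "open U\<^sub>2" "q \<in> U\<^sub>2"
    "\<And>W H Y r. open W \<Longrightarrow> W \<subseteq> U\<^sub>2 \<Longrightarrow> vector_field \<O> W 0 H \<Longrightarrow> vector_field \<O> W 1 Y \<Longrightarrow> r \<in> W \<Longrightarrow>
      H (\<omega> Y Y) r = 2 * \<omega> (nab\<^sub>2 H Y) Y r"
    using darboux_flat_parallel[OF od df(2)] by blast
  \<comment> \<open>The Darboux charts of the two connections and the adapted chart are unrelated;
    they are compared on a common neighbourhood of \<open>q\<close>.\<close>
  have oI: "open (U \<inter> U\<^sub>1 \<inter> U\<^sub>2)" "q \<in> C \<inter> (U \<inter> U\<^sub>1 \<inter> U\<^sub>2)" using UU U1 U2 q by auto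
  obtain V \<phi>' \<iota>' \<theta>' D' c' where V: "open V" "q \<in> V" "V \<subseteq> U \<inter> U\<^sub>1 \<inter> U\<^sub>2"
    and ad: "adapted_fields \<O> V (\<phi>' :: 'p \<Rightarrow> 'n coord_space) \<iota>' \<theta>' D' br \<omega> C J c'"
    by (rule local_adapted_fields[OF os nd oI])
  have VU: "V \<subseteq> U" "V \<subseteq> U\<^sub>1" "V \<subseteq> U\<^sub>2" and qV: "q \<in> C \<inter> V" using V q by auto
  note rs = od.vf_restrict[OF _ VU(1)] and os = od.orthogonal_restrict[OF _ VU(1)]
    and ts = od.tangent_restrict[OF _ VU(1)]
  have np: "normal_pair \<O> V \<phi>' \<iota>' \<theta>' D' br \<omega> C J c' V H \<Psi>\<^sub>1"
  proof (rule normal_pair.intro[OF ad])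
    have h: "\<omega> H \<Psi>\<^sub>1 r - 1 \<in> J r" if "r \<in> C \<inter> V" for r
      by (rule H1) (use that VU(1) in blast)
    show "normal_pair_axioms \<O> V \<omega> C J V H \<Psi>\<^sub>1"
    proof
      show "open V" "V \<subseteq> V" by (rule V(1), rule subset_refl)
      show "vector_field \<O> V 0 H" "vector_field \<O> V 1 \<Psi>\<^sub>1"
        by (rule rs[OF vH], rule rs[OF v(1)])
      show "orthogonal_to \<O> \<omega> C J V H" by (rule os[OF oH])
      show "orthogonal_to \<O> \<omega> C J V \<Psi>\<^sub>1" by (rule os[OF o1])
    qed (rule h)
  qed
  have diff: "(\<Sum>B\<in>UNIV. nab\<^sub>1 (\<P>\<^sub>1 (D B)) \<Psi>\<^sub>1 (?z B) q) - (\<Sum>B\<in>UNIV. nab\<^sub>2 (\<P>\<^sub>1 (D B)) \<Psi>\<^sub>1 (?z B) q) \<in> J q"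
  proof (rule flat_difference_trace[OF c1 c2 np VU(1) tf qV])
    show "H (\<omega> \<Psi>\<^sub>1 \<Psi>\<^sub>1) q = 2 * \<omega> (nab\<^sub>1 H \<Psi>\<^sub>1) \<Psi>\<^sub>1 q"
      by (rule U1(3)[OF V(1) VU(2) rs[OF vH] rs[OF v(1)] V(2)])
    show "H (\<omega> \<Psi>\<^sub>1 \<Psi>\<^sub>1) q = 2 * \<omega> (nab\<^sub>2 H \<Psi>\<^sub>1) \<Psi>\<^sub>1 q"
      by (rule U2(3)[OF V(1) VU(3) rs[OF vH] rs[OF v(1)] V(2)])
    show "vector_field \<O> V (par B) (\<P>\<^sub>1 (D B))" for B by (rule rs[OF P1(1)])
    show "orthogonal_to \<O> \<omega> C J V (\<P>\<^sub>1 (D B))" for B by (rule os[OF P1(2)])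
    show "tangent_to \<O> C J V (sub_field (D B) (\<P>\<^sub>1 (D B)))" for B by (rule ts[OF P1(3)])
  qed (rule null)
  have \<rho>: "\<rho> D \<in> hom_sect \<O> 0 U" "unit_elem (\<rho> D q)"
    using vol[unfolded volume_element_def, rule_format, OF conjI[OF UU(1) c1.coord_frame[OF D]]] qU by meson+
  have ext: "((\<Sum>B\<in>UNIV. nab\<^sub>2 (\<P>\<^sub>1 (D B)) \<Psi>\<^sub>1 (?z B) q) - divergence ?z D \<rho> \<Psi>\<^sub>1 q) -
    ((\<Sum>B\<in>UNIV. nab\<^sub>2 (\<P>\<^sub>1 (D B)) \<Psi>\<^sub>2 (?z B) q) - divergence ?z D \<rho> \<Psi>\<^sub>2 q) \<in> J q"
    by (rule c2.trace_minus_divergence_on_C[where Y = "\<lambda>B. \<P>\<^sub>1 (D B)" and \<rho> = \<rho> and J = J,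
          OF P1(1) P1(3) \<rho> v e12 q Iq])
  \<comment> \<open>The last exchange: the two projectors agree along \<open>C\<close>, and the
    covariant derivative is tensorial in its direction.\<close>
  have "nab\<^sub>2 (\<P>\<^sub>1 (D B)) \<Psi>\<^sub>2 (?z B) q - nab\<^sub>2 (\<P>\<^sub>2 (D B)) \<Psi>\<^sub>2 (?z B) q \<in> J q" for B
  proof (rule c1.tensorial_cong_on_C[OF UU c2.tensorial_nab[OF UU(1) v(2) zO] P1(1) P2 qU Iq])
    show "\<P>\<^sub>1 (D B) (?z A) q - \<P>\<^sub>2 (D B) (?z A) q \<in> J q" for A
      by (rule od.projector_unique_on_C[OF UU(1) I P c1.D_vf[OF subset_refl] zO q])
  qed
  then have "(\<Sum>B\<in>UNIV. nab\<^sub>2 (\<P>\<^sub>1 (D B)) \<Psi>\<^sub>2 (?z B) q - nab\<^sub>2 (\<P>\<^sub>2 (D B)) \<Psi>\<^sub>2 (?z B) q) \<in> J q"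
    by (rule ideal_sum[OF Iq])
  from ideal_add[OF Iq ideal_add[OF Iq diff ext] this]
  show ?thesis
    unfolding A_conn_def c1.trace_as_sum[OF P1(1) v(1) qU] c2.trace_as_sum[OF P2 v(2) qU] sum_subtractf
    by (simp add: algebra_simps)
qed

theorem proposition7:
  fixes \<O> :: "'p::{t2_space,second_countable_topology} set \<Rightarrow>
                ('p, 'g::supercommutative_algebra) sect set"
    and br :: "('p, 'g) sect \<Rightarrow> ('p, 'g) sect \<Rightarrow> ('p, 'g) sect"
    and \<omega> :: "('p, 'g) vfield \<Rightarrow> ('p, 'g) vfield \<Rightarrow> ('p, 'g) sect"
    and \<rho> :: "('n::{finite,linorder} + 'n \<Rightarrow> ('p, 'g) vfield) \<Rightarrow> ('p, 'g) sect"
    and C :: "'p set" and J :: "'p \<Rightarrow> 'g set"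
    and nab\<^sub>1 nab\<^sub>2 :: "('p, 'g) vfield \<Rightarrow> ('p, 'g) vfield \<Rightarrow> ('p, 'g) vfield"
    and U :: "'p set" and \<phi> :: "'p \<Rightarrow> 'n coord_space"
    and \<iota> :: "('n coord_space \<Rightarrow> real) \<Rightarrow> ('p, 'g) sect" and \<theta> :: "'n \<Rightarrow> ('p, 'g) sect"
    and D b :: "'n + 'n \<Rightarrow> ('p, 'g) vfield" and c :: 'n
    and \<Psi> \<Psi>\<^sub>1 \<Psi>\<^sub>2 H :: "('p, 'g) vfield"
    and \<P>\<^sub>1 \<P>\<^sub>2 :: "('p, 'g) vfield \<Rightarrow> ('p, 'g) vfield"
  assumes "odd_symplectic_supermanifold TYPE('n) \<O> br \<omega>"
    and "volume_element \<O> \<rho>"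
    and "nondegenerate_submanifold TYPE('n) \<O> \<omega> C J"
    and "darboux_flat TYPE('n) \<O> br nab\<^sub>1"
    and "darboux_flat TYPE('n) \<O> br nab\<^sub>2"
    and "chart \<O> U \<phi> \<iota> \<theta>"
    and "coord_fields \<O> U (coords \<iota> \<theta>) D"
    and "admissible_field \<O> \<omega> C J U (coords \<iota> \<theta>) \<Psi>"
    and "normal_companion \<O> \<omega> C J U \<Psi> H"
    and "tangent_frame \<O> C J U c b"
    and "vector_field \<O> U 1 \<Psi>\<^sub>1" and "field_eq_on_C \<O> C J U \<Psi>\<^sub>1 \<Psi>"
    and "vector_field \<O> U 1 \<Psi>\<^sub>2" and "field_eq_on_C \<O> C J U \<Psi>\<^sub>2 \<Psi>"
    and "orthogonal_projector \<O> \<omega> C J U \<P>\<^sub>1"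
    and "orthogonal_projector \<O> \<omega> C J U \<P>\<^sub>2"
  shows "eq_on_C C J U
           (s_C J (coords \<iota> \<theta>) D \<rho> nab\<^sub>1 \<P>\<^sub>1 \<Psi>\<^sub>1 \<Psi> H c b)
           (s_C J (coords \<iota> \<theta>) D \<rho> nab\<^sub>2 \<P>\<^sub>2 \<Psi>\<^sub>2 \<Psi> H c b)"
  unfolding eq_on_C_def s_C_def
proof
  fix q assume q: "q \<in> C \<inter> U"
  have I: "ring_ideal (J q)" using submanifold_ideal[OF assms(1,3)] q by blast
  show "A_conn (coords \<iota> \<theta>) D \<rho> \<P>\<^sub>1 nab\<^sub>1 \<Psi>\<^sub>1 q * sqrt_on_C J (volume_on_C \<rho> H \<Psi> c b) q -
      A_conn (coords \<iota> \<theta>) D \<rho> \<P>\<^sub>2 nab\<^sub>2 \<Psi>\<^sub>2 q * sqrt_on_C J (volume_on_C \<rho> H \<Psi> c b) q \<in> J q"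
    \<comment> \<open>Both sides contain the same representative of the square root, so the
      difference is a right multiple of the difference of the two values of
      \<open>A_conn\<close>.\<close>
    unfolding left_diff_distrib[symmetric]
    by (rule ideal_right[OF I A_conn_independent[OF assms(1,2,3,4,5,6,7,8,9,11,13,12,14,15,16) q]])
qed

end
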